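(* Let $X$ be a compact connected abelian group with $\dim X<\infty$, and let $\{T_1,T_2\}$ be a set of two (distinct) epimorphisms of $X$. Then $\{T_1,T_2\}$ is mixing if and only if there is no closed subgroup $Y\ne X$ of $X$ such that for some $l\ge 1$, $Y$ is invariant under $T_1^l$ and $T_2^l$, and the maps induced by $T_1^l$ and $T_2^l$ on $X/Y$ are equal.
   Context: $m$ is the normalized Haar measure on $X$ and $\mathcal{B}$ is the completion of the Borel $\sigma$-algebra. An epimorphism of $X$ is a continuous surjective homomorphism $X\to X$. The set $\{T_1,T_2\}$ is mixing if for all $B_1,B_2\in\mathcal{B}$, $m(T_1^{-n}B_1\cap T_2^{-n}B_2)\to m(B_1)m(B_2)$ as $n\to\infty$. A subgroup $Y$ is invariant under a map $S$ if $S(Y)\subset Y$. *)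

theory Defs
  imports "HOL-Probability.Probability" "HOL-Library.Set_Algebras" "HOL-Library.Extended_Nat"
begin

(* Lebesgue covering dimension: every finite open cover of X has a finite open refinement
   such that no point lies in more than n + 1 of its members. *)

definition covering_dim_le :: "'a topology \<Rightarrow> nat \<Rightarrow> bool" where
  "covering_dim_le X n \<longleftrightarrow>
     (\<forall>\<U>. finite \<U> \<and> (\<forall>U\<in>\<U>. openin X U) \<and> \<Union>\<U> = topspace X \<longrightarrow>
        (\<exists>\<V>. finite \<V> \<and> (\<forall>V\<in>\<V>. openin X V) \<and> \<Union>\<V> = topspace X \<and>
              (\<forall>V\<in>\<V>. \<exists>U\<in>\<U>. V \<subseteq> U) \<and>
              (\<forall>x\<in>topspace X. card {V \<in> \<V>. x \<in> V} \<le> n + 1)))"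

(* The infimum of the empty set of bounds is \<infinity>.  The empty space gets dimension 0 here;
   a group is never empty. *)

definition covering_dim :: "'a topology \<Rightarrow> enat" where
  "covering_dim X = (INF n\<in>{n. covering_dim_le X n}. enat n)"

lemma covering_dim_finite_iff: "covering_dim X < \<infinity> \<longleftrightarrow> (\<exists>n. covering_dim_le X n)"
  unfolding covering_dim_def INF_less_iff by simp

(* The Haar measure is kept on the Borel sets; completion is applied where it is used.
   The two approximation clauses say that the finite Borel measure is Radon, as is part of the
   definition of a Haar measure on a general (not necessarily metrizable) compact group. *)

definition normalized_haar_measure :: "'a::topological_ab_group_add measure \<Rightarrow> bool" where
  "normalized_haar_measure \<mu> \<longleftrightarrow>
     prob_space \<mu> \<and> sets \<mu> = sets borel \<and>
     (\<forall>a. \<forall>B\<in>sets borel. emeasure \<mu> (a +o B) = emeasure \<mu> B) \<and>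
     (\<forall>B\<in>sets borel. emeasure \<mu> B = (INF U\<in>{U. open U \<and> B \<subseteq> U}. emeasure \<mu> U)) \<and>
     (\<forall>U. open U \<longrightarrow> emeasure \<mu> U = (SUP K\<in>{K. compact K \<and> K \<subseteq> U}. emeasure \<mu> K))"

definition epimorphism :: "('a::topological_ab_group_add \<Rightarrow> 'a) \<Rightarrow> bool" where
  "epimorphism T \<longleftrightarrow> continuous_on UNIV T \<and> surj T \<and> Modules.additive T"

definition mixing_pair :: "'a measure \<Rightarrow> ('a \<Rightarrow> 'a) \<Rightarrow> ('a \<Rightarrow> 'a) \<Rightarrow> bool" where
  "mixing_pair m T1 T2 \<longleftrightarrow>
     (\<forall>B1\<in>sets m. \<forall>B2\<in>sets m.
        (\<lambda>n. measure m (((T1 ^^ n) -` B1 \<inter> space m) \<inter> ((T2 ^^ n) -` B2 \<inter> space m)))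
          \<longlonglongrightarrow> measure m B1 * measure m B2)"

definition add_subgroup :: "'a::ab_group_add set \<Rightarrow> bool" where
  "add_subgroup Y \<longleftrightarrow> 0 \<in> Y \<and> (\<forall>x\<in>Y. \<forall>y\<in>Y. x + y \<in> Y) \<and> (\<forall>x\<in>Y. - x \<in> Y)"

definition invariant_under :: "('a \<Rightarrow> 'a) \<Rightarrow> 'a set \<Rightarrow> bool" where
  "invariant_under S Y \<longleftrightarrow> S ` Y \<subseteq> Y"

definition cosets :: "'a::ab_group_add set \<Rightarrow> 'a set set" where
  "cosets Y = range (\<lambda>x. x +o Y)"

(* Written as a union over representatives; by induced_map_coset below this is the
   usual x + Y |-> S x + Y whenever that map is well defined. *)

definition induced_map :: "('a::ab_group_add \<Rightarrow> 'a) \<Rightarrow> 'a set \<Rightarrow> 'a set \<Rightarrow> 'a set" where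
  "induced_map S Y C = (\<Union>x\<in>C. S x +o Y)"

lemma add_subgroup_coset_eq:
  assumes "add_subgroup Y" "y \<in> Y"
  shows "(x + y) +o Y = x +o Y"
proof (rule set_eqI)
  fix z
  have "z - (x + y) \<in> Y \<longleftrightarrow> z - x \<in> Y"
  proof
    assume "z - (x + y) \<in> Y"
    then have "(z - (x + y)) + y \<in> Y"
      using assms unfolding add_subgroup_def by blast
    then show "z - x \<in> Y" by (simp add: algebra_simps)
  next
    assume "z - x \<in> Y"
    then have "(z - x) + (- y) \<in> Y"
      using assms unfolding add_subgroup_def by blast
    then show "z - (x + y) \<in> Y" by (simp add: algebra_simps)
  qed
  then show "z \<in> (x + y) +o Y \<longleftrightarrow> z \<in> x +o Y"
    by (simp add: set_minus_plus)
qed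

lemma induced_map_coset:
  assumes "add_subgroup Y" "Modules.additive S" "invariant_under S Y"
  shows "induced_map S Y (x +o Y) = S x +o Y"
proof -
  interpret Modules.additive S by fact
  have "S z +o Y = S x +o Y" if z: "z \<in> x +o Y" for z
  proof -
    from z obtain y where "y \<in> Y" "z = x + y"
      by (auto simp: elt_set_plus_def)
    then show ?thesis
      using assms add_subgroup_coset_eq[of Y "S y" "S x"]
      by (auto simp: add invariant_under_def)
  qed
  moreover have "x \<in> x +o Y"
    using assms by (auto simp: elt_set_plus_def add_subgroup_def)
  ultimately show ?thesis
    unfolding induced_map_def by blast
qed

end

theory Submission
  imports Defs "HOL-Computational_Algebra.Primes" "HOL-Computational_Algebra.Polynomial"
begin

text \<open>A closed subgroup \<open>Y\<close> as in the statement prevents mixing because two disjoint nonempty open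
  \<open>Y\<close>-saturated sets stay disjoint under simultaneous iteration along multiples of \<open>l\<close>.

  Conversely, trigonometric polynomials are dense, so failure of mixing yields characters
  \<open>\<phi>1\<close>, \<open>\<phi>2\<close>, not both trivial, with \<open>\<phi>1 \<circ> T1\<^sup>n = \<phi>2 \<circ> T2\<^sup>n\<close> for infinitely many \<open>n\<close>.
  Connectedness makes the dual group torsion-free and finite dimension makes its rank finite, so up to
  a common multiple this is an equation \<open>M1\<^sup>n v = M2\<^sup>n w\<close> between integer vectors.  By the
  Skolem--Mahler--Lech theorem it then holds along an arithmetic progression \<open>n = a + l m\<close>, and the
  annihilator of the \<open>T1\<^sup>l\<close>-orbit of \<open>\<phi>1 \<circ> T1\<^sup>a\<close> is the required subgroup.

  Enough characters are produced without spectral theory: normalized convolution powers of a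
  hermitian kernel converge to an idempotent, and a minimal idempotent below it is a multiple of a
  character.  The rank is at most the covering dimension because independent characters take
  arbitrary unit values simultaneously, which allows to place fine grids of a cube in the group and
  to apply Kuhn's lemma.\<close>

section \<open>The Skolem--Mahler--Lech theorem\<close>

text \<open>The group need not be metrizable, so the Borel sets of its square may exceed the product
  sigma-algebra; Stone-Weierstrass approximation and the regularity of the Haar measure replace
  product measurability and separability. The dual group has finite rank but, as for solenoids, need
  not be finitely generated, so in a maximal independent system the dual of an epimorphism is only a
  rational matrix. Denominators are cleared by one integer \<open>N\<close> common to both maps: at
  time \<open>n\<close> both sides of the character equation are then raised to the same power,
  which torsion-freeness removes again at the end. Surjectivity of \<open>T\<close> makes the dual
  map injective, so the integer matrix has a left inverse up to a nonzero integer \<open>d\<close>.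
  For a prime \<open>p\<close> not dividing \<open>d\<close>, some power of the matrix is the
  identity mod \<open>p\<close>, and this congruence is what produces the series treated by Hansel's
  argument. The progression may start at some \<open>a > 0\<close>. Its first term says that
  \<open>\<phi>1\<close> after \<open>T1 ^^ a\<close> and \<open>\<phi>2\<close> after
  \<open>T2 ^^ a\<close> are one and the same character; this merges the two characters into the
  single one needed for the subgroup.\<close>

lemma power_dvd_coeff_synthetic_div:
  fixes P Q :: "int poly" and e :: "nat \<Rightarrow> nat" and p t :: int
  assumes "mono e" "P = [:-t, 1:] * Q" and P: "\<And>j. p ^ e j dvd coeff P j"
  shows "p ^ e (Suc j) dvd coeff Q j"
proof -
  have step: "coeff Q j = coeff P (Suc j) + t * coeff Q (Suc j)" for j
    using assms(2) by (simp add: coeff_pCons)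
  \<comment> \<open>Descending induction along Horner's recursion \<open>step\<close>: above the
    degree the coefficients of \<open>Q\<close> vanish, and \<open>m\<close> measures how far
    \<open>j\<close> lies below that point.\<close>
  have "p ^ e (Suc j) dvd coeff Q j" if "degree Q < j + m" for j m
    using that
  proof (induction m arbitrary: j)
    case 0
    then show ?case by (simp add: coeff_eq_0)
  next
    case (Suc m)
    have "p ^ e (Suc j) dvd p ^ e (Suc (Suc j))"
      using \<open>mono e\<close> by (intro le_imp_power_dvd) (simp add: monoD)
    then have "p ^ e (Suc j) dvd coeff Q (Suc j)"
      using Suc.IH[of "Suc j"] Suc.prems by (auto intro: dvd_trans)
    then show ?case
      using P[of "Suc j"] by (subst step) (intro dvd_add dvd_mult)
  qed
  from this[of j "Suc (degree Q)"] show ?thesis by simp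
qed

text \<open>Dividing out one root shifts the exponent function \<open>e\<close> by one place. When
  all roots are gone, every coefficient of the quotient is divisible by
  \<open>p ^ e (card S)\<close>, hence so are its values and those of \<open>P\<close>.\<close>

lemma power_dvd_poly_of_roots:
  fixes P :: "int poly" and e :: "nat \<Rightarrow> nat" and p x :: int
  assumes "finite S" "mono e" and "\<And>j. p ^ e j dvd coeff P j"
    and "\<And>t. t \<in> S \<Longrightarrow> poly P t = 0"
  shows "p ^ e (card S) dvd poly P x"
  using assms
proof (induction S arbitrary: P e rule: finite_induct)
  case empty
  have "p ^ e 0 dvd coeff P i * x ^ i" for i
    using empty.prems(1,2) by (metis dvd_mult2 dvd_trans le0 le_imp_power_dvd monoD)
  then show ?case
    by (simp add: poly_altdef dvd_sum)
next
  case (insert t S)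
  then obtain Q where Q: "P = [:-t, 1:] * Q"
    using poly_eq_0_iff_dvd[of P t] by (auto elim: dvdE)
  have "p ^ e (Suc (card S)) dvd poly Q x"
  proof (rule insert.IH[where e="\<lambda>j. e (Suc j)"])
    show "mono (\<lambda>j. e (Suc j))"
      using insert.prems(1) by (simp add: mono_def)
    show "p ^ e (Suc j) dvd coeff Q j" for j
      using power_dvd_coeff_synthetic_div[OF insert.prems(1) Q insert.prems(2)] .
    show "poly Q s = 0" if "s \<in> S" for s
      using insert.prems(3)[of s] that insert.hyps Q by auto
  qed
  then show ?case
    using insert.hyps Q by simp
qed

text \<open>Collecting the multiples of \<open>p\<close> up to \<open>n\<close> gives the recursion
  \<open>split\<close>, from \<open>n\<close> to \<open>n div p\<close>. By Legendre the exponent of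
  \<open>p\<close> in the factorial is at most \<open>n / (p - 1)\<close>; the bound
  \<open>n / 2\<close> is where \<open>3 \<le> p\<close> enters.\<close>

lemma fact_eq_power_mult_coprime:
  fixes p :: nat
  assumes "prime p" "3 \<le> p"
  shows "\<exists>a w. fact n = p ^ a * w \<and> coprime w p \<and> 2 * a \<le> n"
proof (induction n rule: less_induct)
  case (less n)
  have split: "\<exists>w. fact n = p ^ (n div p) * fact (n div p) * w \<and> coprime w p" for n :: nat
  proof (induction n)
    case 0
    show ?case by (rule exI[of _ 1]) simp
  next
    case (Suc n)
    then obtain w where w: "fact n = p ^ (n div p) * fact (n div p) * w" "coprime w p"
      by auto
    show ?case
    proof (cases "p dvd Suc n")
      case True
      then have d: "Suc n div p = Suc (n div p)"
        by (simp add: div_Suc dvd_eq_mod_eq_0)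
      have *: "Suc n = p * Suc (n div p)"
        using True d by (metis dvd_mult_div_cancel)
      have "fact (Suc n) = Suc n * fact n" by simp
      also have "\<dots> = (p * Suc (n div p)) * (p ^ (n div p) * fact (n div p) * w)"
        by (simp only: * [symmetric] w(1))
      also have "\<dots> = p ^ (Suc n div p) * fact (Suc n div p) * w"
        unfolding d by (simp add: algebra_simps)
      finally have "fact (Suc n) = p ^ (Suc n div p) * fact (Suc n div p) * w" .
      then show ?thesis using w(2) by blast
    next
      case False
      then have "Suc n div p = n div p"
        by (simp add: div_Suc dvd_eq_mod_eq_0)
      moreover have "coprime (w * Suc n) p"
        using False w(2) \<open>prime p\<close>
        by (metis coprime_commute coprime_mult_right_iff prime_imp_coprime)
      ultimately show ?thesis
        using w(1) by (intro exI[of _ "w * Suc n"]) (simp add: algebra_simps)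
    qed
  qed
  show ?case
  proof (cases "n = 0")
    case True
    then show ?thesis by (intro exI[of _ 0] exI[of _ 1]) simp
  next
    case False
    then have "n div p < n" using assms(2) by simp
    from less.IH[OF this] obtain a w where a: "fact (n div p) = p ^ a * w" "coprime w p" "2 * a \<le> n div p"
      by blast
    obtain w' where w': "fact n = p ^ (n div p) * fact (n div p) * w'" "coprime w' p"
      using split by blast
    have "2 * (n div p + a) \<le> 3 * (n div p)" using a(3) by simp
    also have "\<dots> \<le> p * (n div p)" using assms(2) by (intro mult_right_mono) auto
    also have "\<dots> \<le> n" by simp
    finally have "2 * (n div p + a) \<le> n" .
    moreover have "fact n = p ^ (n div p + a) * (w * w')"
      using w'(1) a(1) by (simp add: power_add)
    moreover have "coprime (w * w') p" using a(2) w'(2) by simp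
    ultimately show ?thesis by blast
  qed
qed

text \<open>The polynomial is the falling factorial \<open>x (x - 1) ... (x - k + 1)\<close>;
  multiplying the binomial coefficient by \<open>fact k\<close> is what keeps its coefficients
  integral.\<close>

lemma ex_int_poly_falling_factorial:
  "\<exists>P::int poly. degree P \<le> k \<and> (\<forall>x::nat. poly P (int x) = int (fact k * (x choose k)))"
proof (induction k)
  case 0
  show ?case by (rule exI[of _ 1]) simp
next
  case (Suc k)
  then obtain P :: "int poly" where P: "degree P \<le> k" "\<And>x::nat. poly P (int x) = int (fact k * (x choose k))"
    by auto
  define Q where "Q = [:- int k, 1:] * P"
  have "degree Q \<le> Suc k"
    unfolding Q_def using degree_mult_le[of "[:- int k, 1:]" P] P(1) by simp
  moreover have "poly Q (int x) = int (fact (Suc k) * (x choose Suc k))" for x :: nat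
  proof -
    have "(int x - int k) * int (x choose k) = int (Suc k) * int (x choose Suc k)"
    proof (cases "k \<le> x")
      case True
      have "Suc k * (x choose Suc k) = (x - k) * (x choose k)"
        using binomial_absorb_comp[of x k] Suc_times_binomial_eq[of "x-1" k]
        by (cases x) (auto simp: binomial_absorption mult.commute)
      then show ?thesis using True by (metis of_nat_diff of_nat_mult)
    qed (simp add: binomial_eq_0)
    then show ?thesis
      unfolding Q_def by (simp add: P(2) algebra_simps)
  qed
  ultimately show ?case by blast
qed

text \<open>Hansel's elementary form of the Skolem--Mahler--Lech theorem: truncated at \<open>n\<close>, the series is,
  up to a factor prime to \<open>p\<close>, an integer polynomial whose \<open>j\<close>-th coefficient is divisible by
  \<open>p\<close> to the power \<open>j/2\<close>; dividing out \<open>k\<close> integer roots leaves a polynomial divisible by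
  \<open>p\<close> to the power \<open>k/2\<close>.\<close>

theorem hansel_zero:
  fixes u d :: "nat \<Rightarrow> int" and p :: nat
  assumes "prime p" "3 \<le> p"
    and u: "\<And>n. u n = (\<Sum>k\<le>n. int (n choose k) * int p ^ k * d k)"
    and inf: "infinite {n. u n = 0}"
  shows "u t = 0"
proof -
  have dvd: "int p ^ (k div 2) dvd u t" for k
  proof -
    obtain S where S: "S \<subseteq> {n. u n = 0}" "finite S" "card S = k"
      using inf infinite_arbitrarily_large by blast
    \<comment> \<open>The polynomial \<open>P\<close> below interpolates \<open>u\<close>, up to the
      factor \<open>c\<close>, only at arguments up to \<open>n\<close>; this choice covers the
      chosen roots and \<open>t\<close>.\<close>
    define n where "n = Max (insert t S)"
    have le: "s \<le> n" if "s \<in> insert t S" for s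
      unfolding n_def using that S(2) by (intro Max_ge) auto
    obtain a w where aw: "\<And>i. fact i = p ^ a i * w i" "\<And>i. coprime (w i) p" "\<And>i. 2 * a i \<le> i"
      using fact_eq_power_mult_coprime[OF assms(1,2)] by metis
    obtain F where F: "\<And>i. degree (F i :: int poly) \<le> i"
      "\<And>i x. poly (F i) (int x) = int (fact i * (x choose i))"
      using ex_int_poly_falling_factorial by metis
    \<comment> \<open>Expressing the binomial coefficient through \<open>F i\<close> costs a
      division by \<open>fact i = p ^ a i * w i\<close>. The power of \<open>p\<close> is absorbed
      by \<open>p ^ i\<close>, leaving \<open>p ^ (i - a i)\<close>; the factors \<open>w i\<close>
      are cleared by \<open>c\<close>, which is prime to \<open>p\<close>.\<close>
    define c where "c = (\<Prod>i\<le>n. w i)"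
    define P where "P = (\<Sum>i\<le>n. smult (int (c div w i) * int p ^ (i - a i) * d i) (F i))"
    have wc: "w i dvd c" if "i \<le> n" for i
      unfolding c_def using that by (intro dvd_prodI) auto
    have "poly P (int x) = int c * u x" if "x \<le> n" for x
    proof -
      have "poly P (int x) = (\<Sum>i\<le>n. int c * (int (x choose i) * int p ^ i * d i))"
        unfolding P_def poly_sum
      proof (intro sum.cong refl)
        fix i assume "i \<in> {..n}"
        then have c: "c = w i * (c div w i)" using wc by simp
        have "p ^ i = p ^ a i * p ^ (i - a i)"
          using aw(3)[of i] by (simp flip: power_add)
        then have "(c div w i) * p ^ (i - a i) * fact i = w i * (c div w i) * p ^ i"
          by (simp add: aw(1))
        then have "(c div w i) * p ^ (i - a i) * fact i = c * p ^ i"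
          by (simp only: c[symmetric])
        then have *: "int (c div w i) * int p ^ (i - a i) * int (fact i) = int c * int p ^ i"
          by (metis of_nat_mult of_nat_power)
        have "poly (smult (int (c div w i) * int p ^ (i - a i) * d i) (F i)) (int x)
            = (int (c div w i) * int p ^ (i - a i) * int (fact i)) * d i * int (x choose i)"
          by (simp add: F(2))
        also have "\<dots> = int c * (int (x choose i) * int p ^ i * d i)"
          unfolding * by simp
        finally show "poly (smult (int (c div w i) * int p ^ (i - a i) * d i) (F i)) (int x)
            = int c * (int (x choose i) * int p ^ i * d i)" .
      qed
      also have "\<dots> = (\<Sum>i\<le>x. int c * (int (x choose i) * int p ^ i * d i))"
        using that by (intro sum.mono_neutral_right) (auto simp: binomial_eq_0)
      finally show ?thesis
        by (simp add: u sum_distrib_left)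
    qed
    note P_eq = this
    have "int p ^ (card (int ` S) div 2) dvd poly P (int t)"
    proof (rule power_dvd_poly_of_roots[where e="\<lambda>j. j div 2"])
      show "finite (int ` S)" using S by simp
      show "mono (\<lambda>j::nat. j div 2)" by (auto intro: monoI div_le_mono)
      show "poly P x = 0" if "x \<in> int ` S" for x
        using that S le P_eq by force
      show "int p ^ (j div 2) dvd coeff P j" for j
        unfolding P_def coeff_sum
      proof (rule dvd_sum)
        fix i
        show "int p ^ (j div 2) dvd coeff (smult (int (c div w i) * int p ^ (i - a i) * d i) (F i)) j"
        proof (cases "j \<le> i")
          case True
          \<comment> \<open>Since \<open>F i\<close> has degree at most \<open>i\<close>, only the
            terms with \<open>i \<ge> j\<close> contribute to the \<open>j\<close>-th coefficient,
            and these carry at least half of their \<open>i\<close> factors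
            \<open>p\<close>.\<close>
          have "j div 2 \<le> i - a i" using True aw(3)[of i] by linarith
          then have "int p ^ (j div 2) dvd int p ^ (i - a i)" by (rule le_imp_power_dvd)
          then show ?thesis by (simp add: dvd_mult dvd_mult2)
        next
          case False
          then have "coeff (F i) j = 0" using F(1)[of i] by (intro coeff_eq_0) auto
          then show ?thesis by simp
        qed
      qed
    qed
    then have "int p ^ (k div 2) dvd int c * u t"
      using P_eq[of t] le[of t] S by (simp add: card_image)
    moreover have "coprime c p"
      unfolding c_def using aw(2) by (intro prod_coprime_left) auto
    then have "coprime (int p ^ (k div 2)) (int c)"
      by (simp add: coprime_commute)
    ultimately show ?thesis
      using coprime_dvd_mult_right_iff by blast
  qed
  show ?thesis
  proof (rule ccontr)
    assume "u t \<noteq> 0"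
    \<comment> \<open>A nonzero integer cannot be divisible by a power of \<open>p\<close> exceeding
      its absolute value, and \<open>m < p ^ m\<close>. The exponent halves \<open>k\<close>, so
      \<open>k = 2 * m\<close> is taken.\<close>
    define m where "m = nat \<bar>u t\<bar>"
    have "int p ^ m dvd u t" using dvd[of "2 * m"] by simp
    then have "int p ^ m \<le> int m"
      using \<open>u t \<noteq> 0\<close> dvd_imp_le_int[of "u t" "int p ^ m"] unfolding m_def by simp
    moreover have "m < p ^ m"
      using assms(2) by (intro power_gt_expt) auto
    ultimately show False by (metis not_le of_nat_le_iff of_nat_power)
  qed
qed

section \<open>Iterates of integer linear maps and their congruences\<close>

definition int_linear :: "((nat \<Rightarrow> int) \<Rightarrow> (nat \<Rightarrow> int)) \<Rightarrow> bool" where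
  "int_linear M \<longleftrightarrow> (\<forall>c v w. M (\<lambda>i. c * v i + w i) = (\<lambda>i. c * M v i + M w i))"

text \<open>This is the lattice of integer vectors of length \<open>r\<close> inside one fixed
  function type, so that the rank may depend on the group and linear maps can be iterated with
  \<open>^^\<close>.\<close>

definition supported :: "nat \<Rightarrow> (nat \<Rightarrow> int) set" where
  "supported r = {v. \<forall>i\<ge>r. v i = 0}"

lemma int_linear_axpy: "int_linear M \<Longrightarrow> M (\<lambda>i. c * v i + w i) = (\<lambda>i. c * M v i + M w i)"
  unfolding int_linear_def by blast

lemma int_linear_zero: "int_linear M \<Longrightarrow> M (\<lambda>i. 0) = (\<lambda>i. 0)"
  using int_linear_axpy[of M 1 "\<lambda>i. 0" "\<lambda>i. 0"] by (simp add: fun_eq_iff)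

lemma int_linear_scale: "int_linear M \<Longrightarrow> M (\<lambda>i. c * v i) = (\<lambda>i. c * M v i)"
  using int_linear_axpy[of M c v "\<lambda>i. 0"] int_linear_zero[of M] by simp

lemma int_linear_diff: "int_linear M \<Longrightarrow> M (\<lambda>i. w i - v i) = (\<lambda>i. M w i - M v i)"
  using int_linear_axpy[of M "-1" v w] by simp

lemma int_linear_sum:
  assumes "int_linear M" "finite A"
  shows "M (\<lambda>i. \<Sum>j\<in>A. c j * v j i) = (\<lambda>i. \<Sum>j\<in>A. c j * M (v j) i)"
  using assms(2)
proof (induction A rule: finite_induct)
  case empty
  then show ?case using int_linear_zero[OF assms(1)] by simp
next
  case (insert a A)
  then show ?case
    using int_linear_axpy[OF assms(1), of "c a" "v a" "\<lambda>i. \<Sum>j\<in>A. c j * v j i"] by simp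
qed

lemma int_linear_funpow: "int_linear M \<Longrightarrow> int_linear (M ^^ n)"
  by (induction n) (auto simp: int_linear_def)

lemma supported_funpow:
  "(\<And>v. v \<in> supported r \<Longrightarrow> M v \<in> supported r) \<Longrightarrow> v \<in> supported r \<Longrightarrow> (M ^^ n) v \<in> supported r"
  by (induction n) auto

text \<open>The binomial expansion of \<open>(1 + p B) ^ n\<close>. Peeling off the innermost
  application of \<open>K\<close> uses linearity of \<open>K ^^ n\<close> alone, so \<open>B\<close>
  may be given by mere division of \<open>K v - v\<close> by \<open>p\<close>.\<close>

lemma funpow_binomial:
  fixes p :: int
  assumes K: "int_linear K"
    and B: "\<And>v. v \<in> supported r \<Longrightarrow> K v = (\<lambda>i. p * B v i + v i)"
      "\<And>v. v \<in> supported r \<Longrightarrow> B v \<in> supported r"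
    and "x \<in> supported r"
  shows "(K ^^ n) x i = (\<Sum>k\<le>n. int (n choose k) * p ^ k * (B ^^ k) x i)"
  using \<open>x \<in> supported r\<close>
proof (induction n arbitrary: x)
  case 0
  then show ?case by simp
next
  case (Suc n)
  let ?b = "\<lambda>k. p ^ k * (B ^^ k) x i"
  have "(K ^^ Suc n) x = (K ^^ n) (\<lambda>i. p * B x i + x i)"
    using B(1)[OF Suc.prems] by (simp only: funpow_Suc_right o_apply)
  then have "(K ^^ Suc n) x i = p * (K ^^ n) (B x) i + (K ^^ n) x i"
    using int_linear_axpy[OF int_linear_funpow[OF K]] by simp
  also have "\<dots> = (\<Sum>k\<le>n. int (n choose k) * ?b (Suc k)) + (\<Sum>k\<le>n. int (n choose k) * ?b k)"
    using Suc.IH[OF B(2)[OF Suc.prems]] Suc.IH[OF Suc.prems]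
    by (simp add: sum_distrib_left funpow_swap1 algebra_simps)
  also have "(\<Sum>k\<le>n. int (n choose k) * ?b k) = (\<Sum>k\<le>Suc n. int (n choose k) * ?b k)"
    by (simp add: binomial_eq_0)
  also have "\<dots> = ?b 0 + (\<Sum>k\<le>n. int (n choose Suc k) * ?b (Suc k))"
    by (subst sum.atMost_Suc_shift) simp
  also have "(\<Sum>k\<le>n. int (n choose k) * ?b (Suc k)) + (?b 0 + (\<Sum>k\<le>n. int (n choose Suc k) * ?b (Suc k)))
     = ?b 0 + (\<Sum>k\<le>n. int (Suc n choose Suc k) * ?b (Suc k))"
    by (simp add: sum.distrib algebra_simps)
  also have "\<dots> = (\<Sum>k\<le>Suc n. int (Suc n choose k) * ?b k)"
    by (subst sum.atMost_Suc_shift) simp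
  finally show ?case by (simp add: mult.assoc)
qed

text \<open>A map congruent to the identity mod \<open>p\<close> is \<open>1 + p B\<close>, so each
  coordinate of the difference of the two orbits is a series of the shape handled by
  \<open>hansel_zero\<close>.\<close>

lemma funpow_eq_of_infinite:
  fixes p :: nat
  assumes p: "prime p" "3 \<le> p"
    and K1: "int_linear K1" "\<And>v. v \<in> supported r \<Longrightarrow> K1 v \<in> supported r"
      "\<And>v i. v \<in> supported r \<Longrightarrow> int p dvd K1 v i - v i"
    and K2: "int_linear K2" "\<And>v. v \<in> supported r \<Longrightarrow> K2 v \<in> supported r"
      "\<And>v i. v \<in> supported r \<Longrightarrow> int p dvd K2 v i - v i"
    and xy: "x \<in> supported r" "y \<in> supported r"
    and inf: "infinite {n. (K1 ^^ n) x = (K2 ^^ n) y}"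
  shows "(K1 ^^ t) x = (K2 ^^ t) y"
proof
  fix i
  define B where "B K v = (\<lambda>i. (K v i - v i) div int p)" for K and v :: "nat \<Rightarrow> int"
  have expand: "(K ^^ n) x i = (\<Sum>k\<le>n. int (n choose k) * int p ^ k * (B K ^^ k) x i)"
    if K: "int_linear K" "\<And>v. v \<in> supported r \<Longrightarrow> K v \<in> supported r"
      "\<And>v i. v \<in> supported r \<Longrightarrow> int p dvd K v i - v i" and x: "x \<in> supported r" for K x n
  proof (rule funpow_binomial[OF K(1) _ _ x])
    show "K v = (\<lambda>i. int p * B K v i + v i)" if "v \<in> supported r" for v
      using K(3)[OF that] by (simp add: B_def fun_eq_iff)
    show "B K v \<in> supported r" if "v \<in> supported r" for v
      using K(2)[OF that] that by (simp add: B_def supported_def)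
  qed
  define u where "u n = (K1 ^^ n) x i - (K2 ^^ n) y i" for n
  have "u t = 0"
  proof (rule hansel_zero[OF p])
    show "u n = (\<Sum>k\<le>n. int (n choose k) * int p ^ k * ((B K1 ^^ k) x i - (B K2 ^^ k) y i))" for n
      using expand[OF K1 xy(1), of n] expand[OF K2 xy(2), of n]
      by (simp only: u_def right_diff_distrib sum_subtractf)
    show "infinite {n. u n = 0}"
      by (rule infinite_super[OF _ inf]) (auto simp: u_def)
  qed
  then show "(K1 ^^ t) x i = (K2 ^^ t) y i" by (simp add: u_def)
qed

lemma funpow_cong_id:
  fixes p :: int
  assumes K: "\<And>v. v \<in> supported r \<Longrightarrow> K v \<in> supported r"
      "\<And>v i. v \<in> supported r \<Longrightarrow> p dvd K v i - v i"
    and "v \<in> supported r"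
  shows "p dvd (K ^^ n) v i - v i"
proof (induction n)
  case (Suc n)
  have "p dvd K ((K ^^ n) v) i - (K ^^ n) v i"
    using K(2) supported_funpow[of r K v n] K(1) assms(3) by blast
  from dvd_add[OF this Suc] show ?case by simp
qed simp

text \<open>Modulo \<open>p\<close> there are only finitely many matrices, so two powers of
  \<open>M\<close> agree; the smaller power can be cancelled because \<open>M'\<close> inverts
  \<open>M\<close> up to the unit \<open>d\<close>.\<close>

lemma ex_funpow_cong_id:
  fixes p d :: int
  assumes p: "prime p" "\<not> p dvd d"
    and M: "int_linear M" "\<And>v. v \<in> supported r \<Longrightarrow> M v \<in> supported r"
    and M': "int_linear M'" "\<And>v. v \<in> supported r \<Longrightarrow> M' (M v) = (\<lambda>i. d * v i)"
  shows "\<exists>l\<ge>1. \<forall>v\<in>supported r. \<forall>i. p dvd (M ^^ l) v i - v i"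
proof -
  have "p > 0" using p(1) prime_gt_0_int by blast
  define e :: "nat \<Rightarrow> nat \<Rightarrow> int" where "e j i = (if i = j then 1 else 0)" for i j
  \<comment> \<open>\<open>f n\<close> records the entries of the matrix of \<open>M ^^ n\<close>
    modulo \<open>p\<close>, where \<open>e j\<close> are the unit vectors.\<close>
  define f where "f n = (\<lambda>q\<in>{..<r}\<times>{..<r}. (M ^^ n) (e (fst q)) (snd q) mod p)" for n
  have "range f \<subseteq> ({..<r}\<times>{..<r}) \<rightarrow>\<^sub>E {0..<p}"
    using \<open>p > 0\<close> unfolding f_def by (intro image_subsetI restrict_PiE_iff[THEN iffD2]) auto
  then have "finite (range f)"
    by (rule finite_subset) (intro finite_PiE, auto)
  then have "\<not> inj f" using range_inj_infinite by blast
  then obtain n n' where nn: "n < n'" "f n = f n'"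
    unfolding inj_def by (metis nat_neq_iff)
  define l where "l = n' - n"
  have sup: "(M ^^ n) v \<in> supported r" if "v \<in> supported r" for v n
    using supported_funpow[of r M v n] M(2) that by blast
  have "p dvd (M ^^ l) v i - v i" if v: "v \<in> supported r" for v i
  proof -
    define w where "w = (\<lambda>i. (M ^^ l) v i - v i)"
    have w: "w \<in> supported r" using sup[OF v, of l] v by (auto simp: w_def supported_def)
    have dvd: "p dvd (M ^^ n) w i" for i
    proof (cases "i < r")
      case True
      have v_eq: "v = (\<lambda>i. \<Sum>j<r. v j * e j i)"
      proof
        fix i
        show "v i = (\<Sum>j<r. v j * e j i)"
          using v by (cases "i < r") (auto simp: e_def supported_def if_distrib cong: if_cong)
      qed
      have expand: "(M ^^ m) v i = (\<Sum>j<r. v j * (M ^^ m) (e j) i)" for m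
        using int_linear_sum[OF int_linear_funpow[OF M(1)], of "{..<r}" m v e] v_eq by simp
      have "(M ^^ n) w = (\<lambda>i. (M ^^ n) ((M ^^ l) v) i - (M ^^ n) v i)"
        unfolding w_def by (rule int_linear_diff[OF int_linear_funpow[OF M(1)]])
      moreover have "(M ^^ n) ((M ^^ l) v) = (M ^^ n') v"
        using nn(1) by (simp add: l_def flip: funpow_add[THEN fun_cong, simplified])
      ultimately have "(M ^^ n) w i = (\<Sum>j<r. v j * ((M ^^ n') (e j) i - (M ^^ n) (e j) i))"
        by (simp add: expand sum_subtractf algebra_simps)
      moreover have "p dvd (M ^^ n') (e j) i - (M ^^ n) (e j) i" if "j < r" for j
        using fun_cong[OF nn(2), of "(j, i)"] that True by (simp add: f_def mod_eq_dvd_iff dvd_diff_commute)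
      ultimately show ?thesis by (auto intro!: dvd_sum dvd_mult)
    next
      case False
      then show ?thesis using sup[OF w, of n] by (simp add: supported_def)
    qed
    \<comment> \<open>This is the cancellation: \<open>M ^^ n\<close> sends \<open>w\<close> into
      \<open>p\<close> times the lattice, and applying \<open>M' ^^ n\<close> shows that
      \<open>d ^ n * w i\<close> is divisible by \<open>p\<close>.\<close>
    have inv: "(M' ^^ n) ((M ^^ n) w) = (\<lambda>i. d ^ n * w i)" for n
    proof (induction n)
      case (Suc n)
      have "(M' ^^ Suc n) ((M ^^ Suc n) w) = (M' ^^ n) (M' (M ((M ^^ n) w)))"
        by (simp only: funpow_Suc_right o_apply) (simp add: funpow_swap1)
      also have "\<dots> = (\<lambda>i. d * (d ^ n * w i))"
        using M'(2)[OF sup[OF w]] Suc int_linear_scale[OF int_linear_funpow[OF M'(1)]] by simp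
      finally show ?case by (simp add: mult.assoc)
    qed simp
    define z where "z = (\<lambda>i. (M ^^ n) w i div p)"
    have "(M ^^ n) w = (\<lambda>i. p * z i)" using dvd by (simp add: z_def fun_eq_iff)
    then have "(\<lambda>i. d ^ n * w i) = (\<lambda>i. p * (M' ^^ n) z i)"
      using inv[of n] int_linear_scale[OF int_linear_funpow[OF M'(1)]] by simp
    then have "p dvd d ^ n * w i" by (metis dvd_triv_left)
    then show ?thesis
      using p prime_dvd_mult_iff prime_dvd_power unfolding w_def by blast
  qed
  then show ?thesis using nn(1) by (intro exI[of _ l]) (auto simp: l_def)
qed

theorem skolem_mahler_lech_pair:
  fixes d1 d2 :: int
  assumes M1: "int_linear M1" "\<And>v. v \<in> supported r \<Longrightarrow> M1 v \<in> supported r"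
      "int_linear N1" "\<And>v. v \<in> supported r \<Longrightarrow> N1 (M1 v) = (\<lambda>i. d1 * v i)" "d1 \<noteq> 0"
    and M2: "int_linear M2" "\<And>v. v \<in> supported r \<Longrightarrow> M2 v \<in> supported r"
      "int_linear N2" "\<And>v. v \<in> supported r \<Longrightarrow> N2 (M2 v) = (\<lambda>i. d2 * v i)" "d2 \<noteq> 0"
    and xy: "x \<in> supported r" "y \<in> supported r"
    and inf: "infinite {n. (M1 ^^ n) x = (M2 ^^ n) y}"
  shows "\<exists>a l. l \<ge> 1 \<and> (\<forall>m. (M1 ^^ (a + l * m)) x = (M2 ^^ (a + l * m)) y)"
proof -
  \<comment> \<open>The size of \<open>p\<close> guarantees both \<open>3 \<le> p\<close> and that
    \<open>p\<close> divides neither of the nonzero integers \<open>d1\<close>,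
    \<open>d2\<close>.\<close>
  obtain p :: nat where p: "prime p" "p > nat (\<bar>d1\<bar> + \<bar>d2\<bar> + 3)"
    using bigger_prime by blast
  have nd: "\<not> int p dvd d1" "\<not> int p dvd d2"
    using p(2) M1(5) M2(5) dvd_imp_le_int[of d1 "int p"] dvd_imp_le_int[of d2 "int p"] by auto
  have pp: "prime (int p)" using p by simp
  obtain l1 where l1: "l1 \<ge> 1" "\<And>v i. v \<in> supported r \<Longrightarrow> int p dvd (M1 ^^ l1) v i - v i"
    using ex_funpow_cong_id[OF pp nd(1) M1(1-4)] by blast
  obtain l2 where l2: "l2 \<ge> 1" "\<And>v i. v \<in> supported r \<Longrightarrow> int p dvd (M2 ^^ l2) v i - v i"
    using ex_funpow_cong_id[OF pp nd(2) M2(1-4)] by blast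
  define l where "l = l1 * l2"
  have s1: "(M1 ^^ n) v \<in> supported r" if "v \<in> supported r" for v n
    using supported_funpow[of r M1 v n] M1(2) that by blast
  have s2: "(M2 ^^ n) v \<in> supported r" if "v \<in> supported r" for v n
    using supported_funpow[of r M2 v n] M2(2) that by blast
  have c1: "int p dvd (M1 ^^ l) v i - v i" if "v \<in> supported r" for v i
    using funpow_cong_id[of r "M1 ^^ l1" "int p" v l2 i] s1 l1(2) that
    by (simp add: l_def funpow_mult)
  have c2: "int p dvd (M2 ^^ l) v i - v i" if "v \<in> supported r" for v i
    using funpow_cong_id[of r "M2 ^^ l2" "int p" v l1 i] s2 l2(2) that
    by (simp add: l_def funpow_mult mult.commute)
  have "l > 0" using l1(1) l2(1) by (simp add: l_def)
  let ?Z = "{n. (M1 ^^ n) x = (M2 ^^ n) y}"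
  \<comment> \<open>Along one residue class mod \<open>l\<close> the equation concerns the
    \<open>l\<close>-th powers, both congruent to the identity, started at the images of
    \<open>x\<close> and \<open>y\<close> under the \<open>a\<close>-th powers.\<close>
  have "\<exists>a\<in>{..<l}. infinite {n \<in> ?Z. n mod l = a}"
    using inf \<open>l > 0\<close> by (intro pigeonhole_infinite_rel[of ?Z "{..<l}" "\<lambda>n a. n mod l = a"]) auto
  then obtain a where a: "a < l" "infinite {n \<in> ?Z. n mod l = a}" by auto
  have shift: "(M ^^ (a + l * m)) v = ((M ^^ l) ^^ m) ((M ^^ a) v)"
    for M :: "(nat \<Rightarrow> int) \<Rightarrow> nat \<Rightarrow> int" and v m
    by (simp add: funpow_mult add.commute[of a] funpow_add)
  have "{n \<in> ?Z. n mod l = a} \<subseteq> (\<lambda>m. a + l * m) ` {m. (M1 ^^ (a + l * m)) x = (M2 ^^ (a + l * m)) y}"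
  proof
    fix n assume n: "n \<in> {n \<in> ?Z. n mod l = a}"
    then have "n = a + l * (n div l)" by auto
    with n show "n \<in> (\<lambda>m. a + l * m) ` {m. (M1 ^^ (a + l * m)) x = (M2 ^^ (a + l * m)) y}"
      by (metis (mono_tags, lifting) imageI mem_Collect_eq)
  qed
  then have "infinite {m. (M1 ^^ (a + l * m)) x = (M2 ^^ (a + l * m)) y}"
    using a(2) finite_imageI finite_subset by blast
  then have inf': "infinite {m. ((M1 ^^ l) ^^ m) ((M1 ^^ a) x) = ((M2 ^^ l) ^^ m) ((M2 ^^ a) y)}"
    unfolding shift .
  have "((M1 ^^ l) ^^ m) ((M1 ^^ a) x) = ((M2 ^^ l) ^^ m) ((M2 ^^ a) y)" for m
    by (rule funpow_eq_of_infinite[where p=p and r=r, OF p(1) _ _ s1 c1 _ s2 c2 s1 s2 inf'])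
      (use p M1(1) M2(1) xy in \<open>auto intro: int_linear_funpow\<close>)
  then show ?thesis
    using \<open>l > 0\<close> by (intro exI[of _ a] exI[of _ l]) (simp add: shift)
qed

section \<open>Haar integration of continuous functions\<close>

locale compact_haar_group =
  fixes \<mu> :: "'a::{topological_ab_group_add, t2_space} measure"
  assumes compact_UNIV: "compact (UNIV :: 'a set)"
    and haar: "normalized_haar_measure \<mu>"
begin

sublocale prob_space \<mu>
  using haar by (simp add: normalized_haar_measure_def)

lemma sets_eq: "sets \<mu> = sets borel"
  using haar by (simp add: normalized_haar_measure_def)

lemma space_eq: "space \<mu> = UNIV"
  using sets_eq_imp_space_eq[OF sets_eq] by simp

lemma measurable_continuous:
  fixes f :: "'a \<Rightarrow> 'b::topological_space"
  assumes "continuous_on UNIV f"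
  shows "f \<in> borel_measurable \<mu>"
  using borel_measurable_continuous_onI[OF assms] measurable_cong_sets[OF sets_eq refl] by blast

lemma continuous_bounded:
  fixes f :: "'a \<Rightarrow> 'b::real_normed_vector"
  assumes "continuous_on UNIV f"
  obtains B where "B \<ge> 0" "\<And>x. norm (f x) \<le> B"
proof -
  have "bounded (range f)"
    using compact_continuous_image[OF assms compact_UNIV] compact_imp_bounded by blast
  then obtain B where B: "\<forall>x. norm (f x) \<le> B" by (auto simp: bounded_iff)
  then have "B \<ge> 0" using norm_ge_zero order_trans by blast
  with B show ?thesis using that by blast
qed

lemma integrable_continuous:
  fixes f :: "'a \<Rightarrow> 'b::{banach, second_countable_topology}"
  assumes "continuous_on UNIV f"
  shows "integrable \<mu> f"
proof -
  obtain B where "\<And>x. norm (f x) \<le> B" using continuous_bounded[OF assms] by blast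
  then show ?thesis
    using measurable_continuous[OF assms] by (intro integrable_const_bound[of _ B]) auto
qed

lemma norm_integral_le:
  fixes f :: "'a \<Rightarrow> 'b::{banach, second_countable_topology}"
  assumes "continuous_on UNIV f" "\<And>x. norm (f x) \<le> B"
  shows "norm (\<integral>x. f x \<partial>\<mu>) \<le> B"
proof -
  have c: "continuous_on UNIV (\<lambda>x. norm (f x))" using assms(1) by (intro continuous_intros)
  have "norm (\<integral>x. f x \<partial>\<mu>) \<le> (\<integral>x. norm (f x) \<partial>\<mu>)"
    by (rule integral_norm_bound)
  also have "\<dots> \<le> (\<integral>x. B \<partial>\<mu>)"
    using assms(2) by (intro integral_mono integrable_continuous c) auto
  finally show ?thesis using prob_space by simp
qed

lemma measurable_endo:
  fixes f :: "'a \<Rightarrow> 'a"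
  assumes "continuous_on UNIV f"
  shows "f \<in> measurable \<mu> \<mu>"
  using measurable_continuous[OF assms] measurable_cong_sets[OF refl sets_eq] by blast

lemma emeasure_translate: "B \<in> sets borel \<Longrightarrow> emeasure \<mu> (a +o B) = emeasure \<mu> B"
  using haar by (simp add: normalized_haar_measure_def)

lemma continuous_translate:
  fixes f :: "'a \<Rightarrow> 'b::topological_space"
  assumes "continuous_on UNIV f"
  shows "continuous_on UNIV (\<lambda>x. f (a + x))"
  by (rule continuous_on_compose2[OF assms]) (auto intro!: continuous_intros)

lemma vimage_translate: "(\<lambda>x::'a. a + x) -` B = (- a) +o B"
  by (simp add: set_eq_iff add.commute flip: set_minus_plus)

lemma distr_translate: "distr \<mu> \<mu> (\<lambda>x. a + x) = \<mu>"
proof (rule measure_eqI)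
  have m: "(\<lambda>x. a + x) \<in> measurable \<mu> \<mu>"
    by (intro measurable_endo continuous_intros)
  fix A assume "A \<in> sets (distr \<mu> \<mu> (\<lambda>x. a + x))"
  then have A: "A \<in> sets \<mu>" by simp
  then show "emeasure (distr \<mu> \<mu> (\<lambda>x. a + x)) A = emeasure \<mu> A"
    using m by (simp add: emeasure_distr space_eq vimage_translate emeasure_translate sets_eq)
qed simp

lemma integral_translate:
  fixes f :: "'a \<Rightarrow> 'b::{banach, second_countable_topology}"
  assumes "continuous_on UNIV f"
  shows "(\<integral>x. f (a + x) \<partial>\<mu>) = (\<integral>x. f x \<partial>\<mu>)"
proof -
  have m: "(\<lambda>x. a + x) \<in> measurable \<mu> \<mu>"
    by (intro measurable_endo continuous_intros)
  show ?thesis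
    using integral_distr[OF m measurable_continuous[OF assms]] by (simp add: distr_translate)
qed

text \<open>Finitely many translates of \<open>U\<close> cover the compact group, and all of them
  have the same measure.\<close>

lemma measure_open_pos:
  assumes "open U" "x \<in> U"
  shows "measure \<mu> U > 0"
proof -
  have op: "open (a +o U)" for a
    using open_vimage[OF assms(1), of "\<lambda>x. - a + x"] vimage_translate[of "- a" U]
    by (simp add: continuous_intros)
  have cov: "UNIV \<subseteq> (\<Union>a. a +o U)"
  proof
    fix y :: 'a
    have "y \<in> (y - x) +o U" using assms(2) by (simp flip: set_minus_plus)
    then show "y \<in> (\<Union>a. a +o U)" by blast
  qed
  obtain A where A: "finite A" "UNIV \<subseteq> (\<Union>a\<in>A. a +o U)"
    by (rule compactE_image[OF compact_UNIV, of UNIV "\<lambda>a. a +o U"]) (use op cov in auto)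
  have sets: "a +o U \<in> sets \<mu>" for a
    using op sets_eq by simp
  have "1 = measure \<mu> UNIV" using prob_space by (simp add: space_eq)
  also have "\<dots> \<le> measure \<mu> (\<Union>a\<in>A. a +o U)"
    using A sets by (intro finite_measure_mono sets.finite_UN) auto
  also have "\<dots> \<le> (\<Sum>a\<in>A. measure \<mu> (a +o U))"
    using A sets by (intro measure_UNION_le) auto
  also have "\<dots> = card A * measure \<mu> U"
    using assms(1) by (simp add: measure_def emeasure_translate)
  finally show ?thesis
    by (metis (no_types, opaque_lifting) less_eq_real_def measure_nonneg mult_zero_right not_one_le_zero)
qed

lemma integral_pos:
  fixes g :: "'a \<Rightarrow> real"
  assumes g: "continuous_on UNIV g" "\<And>x. g x \<ge> 0" and x: "g x > 0"
  shows "(\<integral>x. g x \<partial>\<mu>) > 0"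
proof -
  define U where "U = g -` {g x / 2<..}"
  have U: "open U" unfolding U_def by (rule open_vimage[OF open_greaterThan g(1)])
  have "x \<in> U" using x by (simp add: U_def)
  have "0 < g x / 2 * measure \<mu> U"
    using measure_open_pos[OF U \<open>x \<in> U\<close>] x by simp
  also have "\<dots> = (\<integral>y. g x / 2 * indicator U y \<partial>\<mu>)"
    using U by (simp add: space_eq sets_eq)
  also have "\<dots> \<le> (\<integral>y. g y \<partial>\<mu>)"
  proof (rule integral_mono)
    show "integrable \<mu> (\<lambda>y. g x / 2 * indicator U y)"
      using U by (intro integrable_mult_right integrable_real_indicator)
        (auto simp: sets_eq less_top[symmetric])
    show "integrable \<mu> g" by (rule integrable_continuous[OF g(1)])
    show "g x / 2 * indicator U y \<le> g y" for y
      using g(2)[of y] x by (auto simp: U_def indicator_def)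
  qed
  finally show ?thesis .
qed

section \<open>Urysohn functions and Fubini's theorem for continuous functions\<close>

lemma ex_Urysohn:
  fixes A B :: "'a set"
  assumes "closed A" "closed B" "A \<inter> B = {}"
  obtains f :: "'a \<Rightarrow> real" where "continuous_on UNIV f" "\<And>x. 0 \<le> f x" "\<And>x. f x \<le> 1"
    "\<And>x. x \<in> A \<Longrightarrow> f x = 0" "\<And>x. x \<in> B \<Longrightarrow> f x = 1"
proof -
  have "Hausdorff_space (euclidean :: 'a topology)"
    unfolding Hausdorff_space_def disjnt_def using hausdorff by (metis open_openin)
  then have "normal_space (euclidean :: 'a topology)"
    using compact_UNIV
    by (intro compact_Hausdorff_or_regular_imp_normal_space) (auto simp: compact_space_def)
  then obtain f where f: "continuous_map euclidean (top_of_set {0..1::real}) f" "f ` A \<subseteq> {0}" "f ` B \<subseteq> {1}"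
    using Urysohn_lemma[of euclidean A B 0 1] assms by (auto simp: disjnt_def)
  then have "continuous_on UNIV f" "\<And>x. f x \<in> {0..1}"
    by (auto simp: continuous_map_in_subtopology)
  then show ?thesis using f that by (auto simp: image_subset_iff)
qed

text \<open>Finite sums of products of functions of one variable. For these, exchanging the
  integrals is immediate, and it passes to uniform limits; by Stone-Weierstrass this reaches every
  continuous function on the square without appeal to the product sigma-algebra.\<close>

inductive_set tensors :: "('a \<times> 'a \<Rightarrow> real) set" where
  tensor: "continuous_on UNIV g \<Longrightarrow> continuous_on UNIV h \<Longrightarrow> (\<lambda>z. g (fst z) * h (snd z)) \<in> tensors"
| tensor_add: "F \<in> tensors \<Longrightarrow> G \<in> tensors \<Longrightarrow> (\<lambda>z. F z + G z) \<in> tensors"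

lemma tensors_mult:
  assumes "F \<in> tensors" "G \<in> tensors"
  shows "(\<lambda>z. F z * G z) \<in> tensors"
  using assms
proof (induction arbitrary: G)
  case (tensor g h)
  from tensor(3,1,2) show ?case
  proof (induction)
    case (tensor g' h')
    have "(\<lambda>z. (g (fst z) * g' (fst z)) * (h (snd z) * h' (snd z))) \<in> tensors"
      using tensor by (intro tensors.tensor continuous_intros)
    then show ?case by (simp add: mult_ac)
  next
    case (tensor_add F G)
    then show ?case by (simp add: distrib_left tensors.tensor_add)
  qed
next
  case (tensor_add F F')
  then show ?case by (simp add: distrib_right tensors.tensor_add)
qed

lemma tensors_continuous: "F \<in> tensors \<Longrightarrow> continuous_on UNIV F"
proof (induction rule: tensors.induct)
  case (tensor g h)
  have "continuous_on UNIV (\<lambda>z::'a \<times> 'a. g (fst z))"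
    by (rule continuous_on_compose2[OF tensor(1)]) (auto intro: continuous_on_fst)
  moreover have "continuous_on UNIV (\<lambda>z::'a \<times> 'a. h (snd z))"
    by (rule continuous_on_compose2[OF tensor(2)]) (auto intro: continuous_on_snd)
  ultimately show ?case by (rule continuous_on_mult)
qed (intro continuous_intros)

lemma continuous_slices:
  fixes F :: "'a \<times> 'a \<Rightarrow> 'b::topological_space"
  assumes "continuous_on UNIV F"
  shows "continuous_on UNIV (\<lambda>y. F (x, y))" "continuous_on UNIV (\<lambda>x. F (x, y))"
  by (rule continuous_on_compose2[OF assms]; auto intro!: continuous_intros)+

lemma tensors_integral:
  "F \<in> tensors \<Longrightarrow> continuous_on UNIV (\<lambda>x. \<integral>y. F (x, y) \<partial>\<mu>) \<and> continuous_on UNIV (\<lambda>y. \<integral>x. F (x, y) \<partial>\<mu>) \<and>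
    (\<integral>x. \<integral>y. F (x, y) \<partial>\<mu> \<partial>\<mu>) = (\<integral>y. \<integral>x. F (x, y) \<partial>\<mu> \<partial>\<mu>)"
proof (induction rule: tensors.induct)
  case (tensor g h)
  then show ?case by (auto intro!: continuous_intros)
next
  case (tensor_add F G)
  note cont = continuous_slices[OF tensors_continuous[OF tensor_add(1)]]
    continuous_slices[OF tensors_continuous[OF tensor_add(2)]]
  show ?case
    using tensor_add.IH cont
    by (simp add: Bochner_Integration.integral_add integrable_continuous continuous_on_add)
qed

lemma tensors_dense:
  assumes F: "continuous_on UNIV F" and "e > 0"
  obtains G where "G \<in> tensors" "\<And>z. \<bar>F z - G z\<bar> < e"
proof -
  interpret function_ring_on tensors "UNIV :: ('a \<times> 'a) set"
  proof
    show "compact (UNIV :: ('a \<times> 'a) set)"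
      using compact_Times[OF compact_UNIV compact_UNIV] by simp
    show "(\<lambda>_. c) \<in> tensors" for c
      using tensors.tensor[of "\<lambda>_. c" "\<lambda>_. 1"] by simp
    fix z w :: "'a \<times> 'a" assume "z \<noteq> w"
    have sep: "\<exists>f. continuous_on UNIV f \<and> f x \<noteq> (f y :: real)" if xy: "x \<noteq> y" for x y :: 'a
    proof -
      have "{x} \<inter> {y} = {}" using xy by simp
      with ex_Urysohn[of "{x}" "{y}"] show ?thesis by (metis closed_singleton singletonI zero_neq_one)
    qed
    show "\<exists>f\<in>tensors. f z \<noteq> f w"
    proof (cases "fst z = fst w")
      case False
      then obtain f where "continuous_on UNIV f" "f (fst z) \<noteq> (f (fst w) :: real)" using sep by blast
      then show ?thesis
        using tensors.tensor[of f "\<lambda>_. 1"] by (intro bexI[of _ "\<lambda>z. f (fst z) * 1"]) auto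
    next
      case True
      then have "snd z \<noteq> snd w" using \<open>z \<noteq> w\<close> by (simp add: prod_eq_iff)
      then obtain f where "continuous_on UNIV f" "f (snd z) \<noteq> (f (snd w) :: real)" using sep by blast
      then show ?thesis
        using tensors.tensor[of "\<lambda>_. 1" f] by (intro bexI[of _ "\<lambda>z. 1 * f (snd z)"]) auto
    qed
  qed (auto intro: tensors_continuous tensors_mult tensors.tensor_add)
  show ?thesis
    using Stone_Weierstrass_basic[OF F \<open>e > 0\<close>] that by auto
qed

lemma continuous_on_of_uniform_approx:
  fixes f :: "'a \<Rightarrow> 'b::metric_space"
  assumes "\<And>e. e > 0 \<Longrightarrow> \<exists>g. continuous_on UNIV g \<and> (\<forall>x. dist (f x) (g x) \<le> e)"
  shows "continuous_on UNIV f"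
proof -
  have "\<exists>g. continuous_on UNIV g \<and> (\<forall>x. dist (f x) (g x) \<le> inverse (real (Suc n)))" for n
    using assms[of "inverse (real (Suc n))"] by simp
  then obtain g where g: "\<And>n. continuous_on UNIV (g n)"
    "\<And>n x. dist (f x) (g n x) \<le> inverse (real (Suc n))"
    by metis
  have "uniform_limit UNIV g f sequentially"
  proof (rule uniform_limitI)
    fix e :: real assume "e > 0"
    then obtain N where N: "inverse (real (Suc N)) < e" using reals_Archimedean by blast
    show "\<forall>\<^sub>F n in sequentially. \<forall>x\<in>UNIV. dist (g n x) (f x) < e"
    proof (rule eventually_sequentiallyI[of N], rule ballI)
      fix n x assume "N \<le> n"
      then have "inverse (real (Suc n)) \<le> inverse (real (Suc N))" by (simp add: field_simps)
      with g(2)[of x n] N have "dist (f x) (g n x) < e" by linarith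
      then show "dist (g n x) (f x) < e" by (simp add: dist_commute)
    qed
  qed
  then show ?thesis
    by (rule uniform_limit_theorem[rotated]) (auto simp: g)
qed

lemma integral_diff_le:
  fixes f g :: "'a \<Rightarrow> 'b::{banach, second_countable_topology}"
  assumes "continuous_on UNIV f" "continuous_on UNIV g" "\<And>x. dist (f x) (g x) \<le> e"
  shows "dist (\<integral>x. f x \<partial>\<mu>) (\<integral>x. g x \<partial>\<mu>) \<le> e"
proof -
  have "(\<integral>x. f x \<partial>\<mu>) - (\<integral>x. g x \<partial>\<mu>) = (\<integral>x. f x - g x \<partial>\<mu>)"
    using assms by (simp add: integrable_continuous)
  then show ?thesis
    using norm_integral_le[of "\<lambda>x. f x - g x" e] assms by (simp add: dist_norm continuous_on_diff)
qed

lemma real_integral_slice: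
  fixes F :: "'a \<times> 'a \<Rightarrow> real"
  assumes F: "continuous_on UNIV F"
  shows "continuous_on UNIV (\<lambda>x. \<integral>y. F (x, y) \<partial>\<mu>)" "continuous_on UNIV (\<lambda>y. \<integral>x. F (x, y) \<partial>\<mu>)"
    "(\<integral>x. \<integral>y. F (x, y) \<partial>\<mu> \<partial>\<mu>) = (\<integral>y. \<integral>x. F (x, y) \<partial>\<mu> \<partial>\<mu>)"
proof -
  have approx: "\<exists>G\<in>tensors. (\<forall>x. dist (\<integral>y. F (x, y) \<partial>\<mu>) (\<integral>y. G (x, y) \<partial>\<mu>) \<le> e) \<and>
      (\<forall>y. dist (\<integral>x. F (x, y) \<partial>\<mu>) (\<integral>x. G (x, y) \<partial>\<mu>) \<le> e)" if e: "e > 0" for e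
  proof -
    obtain G where G: "G \<in> tensors" "\<And>z. \<bar>F z - G z\<bar> < e"
      using tensors_dense[OF F e] by blast
    have "dist (F z) (G z) \<le> e" for z using G(2)[of z] by (simp add: dist_real_def)
    then show ?thesis
      using G(1) F tensors_continuous[OF G(1)]
      by (intro bexI[of _ G] conjI allI integral_diff_le continuous_slices) auto
  qed
  show c1: "continuous_on UNIV (\<lambda>x. \<integral>y. F (x, y) \<partial>\<mu>)"
    by (rule continuous_on_of_uniform_approx) (use approx tensors_integral in blast)
  show c2: "continuous_on UNIV (\<lambda>y. \<integral>x. F (x, y) \<partial>\<mu>)"
    by (rule continuous_on_of_uniform_approx) (use approx tensors_integral in blast)
  let ?L = "\<integral>x. \<integral>y. F (x, y) \<partial>\<mu> \<partial>\<mu>" and ?R = "\<integral>y. \<integral>x. F (x, y) \<partial>\<mu> \<partial>\<mu>"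
  have "dist ?L ?R \<le> e" if e: "e > 0" for e
  proof -
    obtain G where G: "G \<in> tensors" "\<forall>x. dist (\<integral>y. F (x, y) \<partial>\<mu>) (\<integral>y. G (x, y) \<partial>\<mu>) \<le> e / 2"
      "\<forall>y. dist (\<integral>x. F (x, y) \<partial>\<mu>) (\<integral>x. G (x, y) \<partial>\<mu>) \<le> e / 2"
      using approx[of "e / 2"] e by auto
    note t = tensors_integral[OF G(1)]
    have "dist ?L (\<integral>x. \<integral>y. G (x, y) \<partial>\<mu> \<partial>\<mu>) \<le> e / 2"
      by (rule integral_diff_le[OF c1]) (use t G(2) in auto)
    moreover have "dist ?R (\<integral>y. \<integral>x. G (x, y) \<partial>\<mu> \<partial>\<mu>) \<le> e / 2"
      by (rule integral_diff_le[OF c2]) (use t G(3) in auto)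
    ultimately show ?thesis
      using dist_triangle2[of ?L ?R "\<integral>x. \<integral>y. G (x, y) \<partial>\<mu> \<partial>\<mu>"]
      by (simp only: conjunct2[OF conjunct2[OF t]])
  qed
  then have "dist ?L ?R \<le> 0" by (rule field_le_epsilon) simp
  then show "?L = ?R" by simp
qed

lemma complex_integral_slice:
  fixes F :: "'a \<times> 'a \<Rightarrow> complex"
  assumes F: "continuous_on UNIV F"
  shows "continuous_on UNIV (\<lambda>x. \<integral>y. F (x, y) \<partial>\<mu>)"
    "(\<integral>x. \<integral>y. F (x, y) \<partial>\<mu> \<partial>\<mu>) = (\<integral>y. \<integral>x. F (x, y) \<partial>\<mu> \<partial>\<mu>)"
proof -
  have split: "(\<integral>x. f x \<partial>\<mu>) = of_real (\<integral>x. Re (f x) \<partial>\<mu>) + \<i> * of_real (\<integral>x. Im (f x) \<partial>\<mu>)"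
    if "continuous_on UNIV f" for f
    using integrable_continuous[OF that] by (simp add: integral_Re integral_Im complex_eq_iff)
  have cR: "continuous_on UNIV (\<lambda>z. Re (F z))" and cI: "continuous_on UNIV (\<lambda>z. Im (F z))"
    using F by (auto intro: continuous_intros)
  note s = continuous_slices[OF F] and R = real_integral_slice[OF cR] and I = real_integral_slice[OF cI]
  have 1: "(\<lambda>x. \<integral>y. F (x, y) \<partial>\<mu>) = (\<lambda>x. of_real (\<integral>y. Re (F (x, y)) \<partial>\<mu>) + \<i> * of_real (\<integral>y. Im (F (x, y)) \<partial>\<mu>))"
    by (intro ext split s)
  have 2: "(\<lambda>y. \<integral>x. F (x, y) \<partial>\<mu>) = (\<lambda>y. of_real (\<integral>x. Re (F (x, y)) \<partial>\<mu>) + \<i> * of_real (\<integral>x. Im (F (x, y)) \<partial>\<mu>))"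
    by (intro ext split s)
  have c1: "continuous_on UNIV (\<lambda>x. of_real (\<integral>y. Re (F (x, y)) \<partial>\<mu>) + \<i> * of_real (\<integral>y. Im (F (x, y)) \<partial>\<mu>) :: complex)"
    using R I by (intro continuous_intros)
  have c2: "continuous_on UNIV (\<lambda>y. of_real (\<integral>x. Re (F (x, y)) \<partial>\<mu>) + \<i> * of_real (\<integral>x. Im (F (x, y)) \<partial>\<mu>) :: complex)"
    using R I by (intro continuous_intros)
  show "continuous_on UNIV (\<lambda>x. \<integral>y. F (x, y) \<partial>\<mu>)" unfolding 1 by (rule c1)
  show "(\<integral>x. \<integral>y. F (x, y) \<partial>\<mu> \<partial>\<mu>) = (\<integral>y. \<integral>x. F (x, y) \<partial>\<mu> \<partial>\<mu>)"
    unfolding 1 2 split[OF c1] split[OF c2] using R(3) I(3) by simp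
qed

text \<open>The double integral of \<open>f (y - x)\<close> gives the left-hand side when
  \<open>x\<close> is integrated first and the right-hand side when \<open>y\<close> is, by
  translation invariance.\<close>

lemma integral_uminus:
  fixes f :: "'a \<Rightarrow> complex"
  assumes f: "continuous_on UNIV f"
  shows "(\<integral>x. f (- x) \<partial>\<mu>) = (\<integral>x. f x \<partial>\<mu>)"
proof -
  have c: "continuous_on UNIV (\<lambda>z::'a \<times> 'a. f (snd z - fst z))"
    by (rule continuous_on_compose2[OF f]) (auto intro!: continuous_intros)
  have m: "continuous_on UNIV (\<lambda>x. f (- x))"
    by (rule continuous_on_compose2[OF f]) (auto intro!: continuous_intros)
  have "(\<integral>x. f (- x) \<partial>\<mu>) = (\<integral>y. \<integral>x. f (- x) \<partial>\<mu> \<partial>\<mu>)"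
    using prob_space by simp
  also have "\<dots> = (\<integral>y. \<integral>x. f (y - x) \<partial>\<mu> \<partial>\<mu>)"
    using integral_translate[OF m, of "- y" for y] by (simp add: algebra_simps)
  also have "\<dots> = (\<integral>x. \<integral>y. f (y - x) \<partial>\<mu> \<partial>\<mu>)"
    using complex_integral_slice(2)[OF c] by simp
  also have "\<dots> = (\<integral>x. \<integral>y. f y \<partial>\<mu> \<partial>\<mu>)"
    using integral_translate[OF f, of "- x" for x] by simp
  also have "\<dots> = (\<integral>x. f x \<partial>\<mu>)"
    using prob_space by simp
  finally show ?thesis .
qed

section \<open>Convolution and characters\<close>

definition conv :: "('a \<Rightarrow> complex) \<Rightarrow> ('a \<Rightarrow> complex) \<Rightarrow> 'a \<Rightarrow> complex" where
  "conv f g = (\<lambda>x. \<integral>y. f (x - y) * g y \<partial>\<mu>)"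

definition star :: "('a \<Rightarrow> complex) \<Rightarrow> 'a \<Rightarrow> complex" where
  "star f = (\<lambda>x. cnj (f (- x)))"

definition sqnorm :: "('a \<Rightarrow> complex) \<Rightarrow> real" where
  "sqnorm f = (\<integral>x. (norm (f x))\<^sup>2 \<partial>\<mu>)"

abbreviation cts :: "('a \<Rightarrow> complex) \<Rightarrow> bool" where
  "cts f \<equiv> continuous_on UNIV f"

lemma cts_reflect: "cts f \<Longrightarrow> cts (\<lambda>y. f (x - y))"
  by (rule continuous_on_compose2) (auto intro!: continuous_intros)

lemma cts_conv_integrand: "cts f \<Longrightarrow> cts g \<Longrightarrow> cts (\<lambda>y. f (x - y) * g y)"
  by (intro continuous_on_mult cts_reflect)

lemma integral_reflect:
  assumes "cts f"
  shows "(\<integral>y. f (x - y) \<partial>\<mu>) = (\<integral>y. f y \<partial>\<mu>)"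
  using integral_uminus[OF continuous_translate[OF assms], of x] integral_translate[OF assms, of x]
  by simp

lemma conv_integrand_continuous:
  assumes "cts f" "cts g"
  shows "continuous_on UNIV (\<lambda>z. f (fst z - snd z) * g (snd z))"
proof -
  have "continuous_on UNIV (\<lambda>z::'a \<times> 'a. f (fst z - snd z))"
    by (rule continuous_on_compose2[OF assms(1)]) (auto intro!: continuous_intros)
  moreover have "continuous_on UNIV (\<lambda>z::'a \<times> 'a. g (snd z))"
    by (rule continuous_on_compose2[OF assms(2)]) (auto intro: continuous_on_snd)
  ultimately show ?thesis by (rule continuous_on_mult)
qed

lemma cts_conv: "cts f \<Longrightarrow> cts g \<Longrightarrow> cts (conv f g)"
  using complex_integral_slice(1)[OF conv_integrand_continuous] by (simp add: conv_def)

lemma conv_commute: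
  assumes "cts f" "cts g"
  shows "conv f g = conv g f"
proof
  fix x
  show "conv f g x = conv g f x"
    using integral_reflect[OF cts_conv_integrand[OF assms], of x x]
    by (simp add: conv_def mult.commute)
qed

lemma conv_assoc:
  assumes "cts f" "cts g" "cts h"
  shows "conv (conv f g) h = conv f (conv g h)"
proof
  fix x
  have cg: "cts (\<lambda>y. f (x - y) * g (y - z))" for z
    using continuous_translate[OF assms(2), of "- z"] cts_reflect[OF assms(1)]
    by (intro continuous_on_mult) auto
  have F: "continuous_on UNIV (\<lambda>p. f (x - snd p) * g (snd p - fst p) * h (fst p))"
    using assms by (intro continuous_on_mult continuous_on_compose2[OF assms(1)]
        continuous_on_compose2[OF assms(2)] continuous_on_compose2[OF assms(3)])
      (auto intro!: continuous_intros)
  have "conv (conv f g) h x = (\<integral>z. (\<integral>y. f (x - z - y) * g y \<partial>\<mu>) * h z \<partial>\<mu>)"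
    by (simp add: conv_def)
  also have "\<dots> = (\<integral>z. (\<integral>y. f (x - y) * g (y - z) \<partial>\<mu>) * h z \<partial>\<mu>)"
    using integral_translate[OF cg, of z z for z] by (simp add: algebra_simps)
  also have "\<dots> = (\<integral>z. \<integral>y. f (x - y) * g (y - z) * h z \<partial>\<mu> \<partial>\<mu>)"
    by simp
  also have "\<dots> = (\<integral>y. \<integral>z. f (x - y) * g (y - z) * h z \<partial>\<mu> \<partial>\<mu>)"
    using complex_integral_slice(2)[OF F] by simp
  also have "\<dots> = (\<integral>y. f (x - y) * (\<integral>z. g (y - z) * h z \<partial>\<mu>) \<partial>\<mu>)"
    by (simp add: mult.assoc)
  also have "\<dots> = conv f (conv g h) x"
    by (simp add: conv_def)
  finally show "conv (conv f g) h x = conv f (conv g h) x" .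
qed

lemma conv_add_right:
  assumes "cts f" "cts g" "cts h"
  shows "conv f (\<lambda>x. g x + h x) = (\<lambda>x. conv f g x + conv f h x)"
  using assms integrable_continuous[OF cts_conv_integrand] by (auto simp: conv_def distrib_left)

lemma conv_diff_right:
  assumes "cts f" "cts g" "cts h"
  shows "conv f (\<lambda>x. g x - h x) = (\<lambda>x. conv f g x - conv f h x)"
  using assms integrable_continuous[OF cts_conv_integrand] by (auto simp: conv_def right_diff_distrib)

lemma conv_scale_right: "conv f (\<lambda>x. c * g x) = (\<lambda>x. c * conv f g x)"
  unfolding conv_def by (subst integral_mult_right_zero[symmetric]) (simp add: mult_ac)

lemma conv_scale_left: "conv (\<lambda>x. c * f x) g = (\<lambda>x. c * conv f g x)"
  unfolding conv_def by (subst integral_mult_right_zero[symmetric]) (simp add: mult_ac)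

lemma conv_add_left:
  assumes "cts f" "cts g" "cts h"
  shows "conv (\<lambda>x. f x + g x) h = (\<lambda>x. conv f h x + conv g h x)"
  using assms integrable_continuous[OF cts_conv_integrand] by (auto simp: conv_def distrib_right)

lemma conv_diff_left:
  assumes "cts f" "cts g" "cts h"
  shows "conv (\<lambda>x. f x - g x) h = (\<lambda>x. conv f h x - conv g h x)"
  using assms integrable_continuous[OF cts_conv_integrand] by (auto simp: conv_def left_diff_distrib)

lemma conv_zero_left [simp]: "conv (\<lambda>x. 0) g = (\<lambda>x. 0)"
  by (simp add: conv_def)

lemma conv_translate_left: "conv (\<lambda>x. f (x + a)) g = (\<lambda>x. conv f g (x + a))"
  by (simp add: conv_def algebra_simps)

lemma cts_star: "cts f \<Longrightarrow> cts (star f)"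
  using cts_reflect[of f 0] by (auto simp: star_def intro!: continuous_intros)

lemma star_conv:
  assumes "cts f" "cts g"
  shows "star (conv f g) = conv (star f) (star g)"
proof
  fix x
  have c: "cts (\<lambda>y. cnj (f (- x - y) * g y))"
    using cts_conv_integrand[OF assms, of "- x"] by (intro continuous_on_cnj)
  have "star (conv f g) x = (\<integral>y. cnj (f (- x - y) * g y) \<partial>\<mu>)"
    unfolding star_def conv_def by (rule Bochner_Integration.integral_cnj[symmetric])
  also have "\<dots> = (\<integral>y. cnj (f (- x + y) * g (- y)) \<partial>\<mu>)"
    using integral_uminus[OF c] by simp
  also have "\<dots> = conv (star f) (star g) x"
    by (simp add: star_def conv_def algebra_simps)
  finally show "star (conv f g) x = conv (star f) (star g) x" .
qed

lemma star_star [simp]: "star (star f) = f"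
  by (simp add: star_def)

lemma cts_sqnorm_integrand: "cts f \<Longrightarrow> continuous_on UNIV (\<lambda>x. (norm (f x))\<^sup>2)"
  by (intro continuous_intros)

lemma sqnorm_nonneg [simp]: "sqnorm f \<ge> 0"
  by (simp add: sqnorm_def)

lemma sqnorm_pos: "cts f \<Longrightarrow> f x \<noteq> 0 \<Longrightarrow> sqnorm f > 0"
  unfolding sqnorm_def by (rule integral_pos[OF cts_sqnorm_integrand, where x=x]) auto

lemma sqnorm_le:
  assumes "cts f" "\<And>x. norm (f x) \<le> B"
  shows "sqnorm f \<le> B\<^sup>2"
proof -
  have "norm (\<integral>x. (norm (f x))\<^sup>2 \<partial>\<mu>) \<le> B\<^sup>2"
    using assms by (intro norm_integral_le cts_sqnorm_integrand) (auto intro: power_mono)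
  then show ?thesis by (simp add: sqnorm_def)
qed

lemma sqnorm_reflect:
  assumes "cts f"
  shows "sqnorm (\<lambda>y. f (x - y)) = sqnorm f"
proof -
  have "complex_of_real (sqnorm f) = (\<integral>y. complex_of_real ((norm (f y))\<^sup>2) \<partial>\<mu>)" if "cts f" for f
    by (simp add: sqnorm_def del: of_real_power)
  moreover have "cts (\<lambda>y. complex_of_real ((norm (f y))\<^sup>2))"
    using cts_sqnorm_integrand[OF assms] by (intro continuous_on_of_real)
  ultimately have "complex_of_real (sqnorm (\<lambda>y. f (x - y))) = complex_of_real (sqnorm f)"
    using integral_reflect[of "\<lambda>y. complex_of_real ((norm (f y))\<^sup>2)" x] assms cts_reflect[OF assms, of x]
    by simp
  then show ?thesis by simp
qed

lemma conv_star_self_zero: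
  assumes "cts f"
  shows "conv f (star f) 0 = complex_of_real (sqnorm f)"
proof -
  have "conv f (star f) 0 = (\<integral>y. complex_of_real ((norm (f (0 - y)))\<^sup>2) \<partial>\<mu>)"
    by (simp only: conv_def star_def complex_norm_square) simp
  also have "\<dots> = complex_of_real (sqnorm (\<lambda>y. f (0 - y)))"
    by (simp add: sqnorm_def del: of_real_power)
  finally show ?thesis using sqnorm_reflect[OF assms, of 0] by simp
qed

lemma Cauchy_Schwarz_integral:
  assumes f: "cts f" and g: "cts g"
  shows "(norm (\<integral>x. f x * g x \<partial>\<mu>))\<^sup>2 \<le> sqnorm f * sqnorm g"
proof (cases "\<forall>x. g x = 0")
  case True
  then show ?thesis by simp
next
  case False
  then have B: "sqnorm g > 0" using sqnorm_pos[OF g] by auto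
  let ?C = "\<integral>x. norm (f x) * norm (g x) \<partial>\<mu>"
  \<comment> \<open>The minimizer of the quadratic polynomial in \<open>t\<close> given by the
    integral of \<open>(norm (f x) - t * norm (g x))\<^sup>2\<close>.\<close>
  define t where "t = ?C / sqnorm g"
  have c: "continuous_on UNIV (\<lambda>x. (norm (f x))\<^sup>2)" "continuous_on UNIV (\<lambda>x. (norm (g x))\<^sup>2)"
    "continuous_on UNIV (\<lambda>x. norm (f x) * norm (g x))"
    using f g by (auto intro!: continuous_intros)
  note i = integrable_continuous[OF c(1)] integrable_continuous[OF c(2)] integrable_continuous[OF c(3)]
  have "0 \<le> (\<integral>x. (norm (f x) - t * norm (g x))\<^sup>2 \<partial>\<mu>)"
    by simp
  also have "(\<integral>x. (norm (f x) - t * norm (g x))\<^sup>2 \<partial>\<mu>) =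
    (\<integral>x. (norm (f x))\<^sup>2 + ((- 2 * t) * (norm (f x) * norm (g x)) + t\<^sup>2 * (norm (g x))\<^sup>2) \<partial>\<mu>)"
    by (rule Bochner_Integration.integral_cong) (auto simp: power2_eq_square algebra_simps)
  also have "\<dots> = (\<integral>x. (norm (f x))\<^sup>2 \<partial>\<mu>) + ((- 2 * t) * ?C + t\<^sup>2 * (\<integral>x. (norm (g x))\<^sup>2 \<partial>\<mu>))"
    using i by (subst Bochner_Integration.integral_add; simp)+
  also have "\<dots> = sqnorm f - ?C\<^sup>2 / sqnorm g"
    using B by (simp add: t_def sqnorm_def power2_eq_square field_simps)
  finally have "?C\<^sup>2 \<le> sqnorm f * sqnorm g"
    using B by (simp add: field_simps)
  moreover have "norm (\<integral>x. f x * g x \<partial>\<mu>) \<le> ?C"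
    using integral_norm_bound[of \<mu> "\<lambda>x. f x * g x"] by (simp add: norm_mult)
  ultimately show ?thesis
    by (meson norm_ge_zero order_trans power_mono)
qed

text \<open>A pointwise bound by mean-square norms: convolution with a fixed continuous kernel turns
  mean-square convergence into uniform convergence.\<close>

lemma norm_conv_le: "cts f \<Longrightarrow> cts g \<Longrightarrow> (norm (conv f g x))\<^sup>2 \<le> sqnorm f * sqnorm g"
  using Cauchy_Schwarz_integral[OF cts_reflect, of f g x] by (simp add: conv_def sqnorm_reflect)

lemma conv_tendsto:
  assumes f: "cts f" and g: "\<And>n. cts (g n)" "uniform_limit UNIV g D sequentially" and D: "cts D"
  shows "(\<lambda>n. conv f (g n) x) \<longlonglongrightarrow> conv f D x"
proof (rule tendstoI)
  fix e :: real assume "e > 0"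
  obtain B where B: "B \<ge> 0" "\<And>x. norm (f x) \<le> B" using continuous_bounded[OF f] by blast
  have "e / (B + 1) > 0" using \<open>e > 0\<close> B(1) by simp
  from uniform_limitD[OF g(2) this]
  show "\<forall>\<^sub>F n in sequentially. dist (conv f (g n) x) (conv f D x) < e"
  proof eventually_elim
    fix n assume n: "\<forall>x\<in>UNIV. dist (g n x) (D x) < e / (B + 1)"
    have "norm (f (x - y) * (g n y - D y)) \<le> B * (e / (B + 1))" for y
      unfolding norm_mult using B n[rule_format, of y] by (intro mult_mono) (auto simp: dist_norm)
    then have "norm (\<integral>y. f (x - y) * (g n y - D y) \<partial>\<mu>) \<le> B * (e / (B + 1))"
      using f g(1) D by (intro norm_integral_le cts_conv_integrand continuous_on_diff)
    moreover have "(\<integral>y. f (x - y) * (g n y - D y) \<partial>\<mu>) = conv f (g n) x - conv f D x"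
      using fun_cong[OF conv_diff_right[OF f g(1)[of n] D], of x] by (simp add: conv_def)
    moreover have "B * (e / (B + 1)) < e" using \<open>e > 0\<close> B(1) by (simp add: field_simps)
    ultimately show "dist (conv f (g n) x) (conv f D x) < e" by (simp add: dist_norm)
  qed
qed

end

text \<open>To be applied to the squared norms of the convolution powers of a kernel, where index
  \<open>n\<close> stands for \<open>n + 1\<close> factors; hence the shifts by \<open>Suc\<close>.
  Log-convexity makes the ratios of consecutive terms increase, submultiplicativity bounds them by
  \<open>A 0\<close>, and \<open>l\<close> is their limit: the top eigenvalue of convolution with
  the square of the kernel.\<close>

lemma ratio_limit:
  fixes A :: "nat \<Rightarrow> real"
  assumes pos: "\<And>n. A n > 0"
    and sub: "\<And>m n. A (Suc (m + n)) \<le> A m * A n"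
    and conv: "\<And>n. (A (Suc n))\<^sup>2 \<le> A n * A (Suc (Suc n))"
  obtains l where "l > 0" "\<And>n. l ^ Suc n \<le> A n" "convergent (\<lambda>n. A n / l ^ Suc n)"
proof -
  define \<rho> where "\<rho> n = A (Suc n) / A n" for n
  have \<rho>_pos: "\<rho> n > 0" for n using pos by (simp add: \<rho>_def)
  have "\<rho> n \<le> \<rho> (Suc n)" for n
    using conv[of n] pos[of n] pos[of "Suc n"] by (simp add: \<rho>_def field_simps power2_eq_square)
  then have inc: "incseq \<rho>" by (rule incseq_SucI)
  have bd: "\<rho> n \<le> A 0" for n
    using sub[of n 0] pos[of n] by (simp add: \<rho>_def field_simps)
  obtain l where l: "\<rho> \<longlonglongrightarrow> l" "\<And>n. \<rho> n \<le> l"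
    using incseq_convergent[OF inc, of "A 0"] bd by auto
  have "l > 0" using l(2)[of 0] \<rho>_pos[of 0] by linarith
  have iter: "A n * \<rho> n ^ k \<le> A (n + k)" for n k
  proof (induction k)
    case (Suc k)
    have "\<rho> n \<le> \<rho> (n + k)" using inc by (simp add: incseqD)
    then have "A n * \<rho> n ^ k * \<rho> n \<le> A (n + k) * \<rho> (n + k)"
      using Suc pos \<rho>_pos by (intro mult_mono) (auto intro: less_imp_le)
    also have "\<dots> = A (n + Suc k)" using pos[of "n + k"] by (simp add: \<rho>_def)
    finally show ?case by (simp add: mult_ac)
  qed simp
  \<comment> \<open>Growth from index \<open>n\<close> on at the rate \<open>\<rho> n\<close> gives
    \<open>A n * \<rho> n ^ Suc m \<le> A (Suc (n + m)) \<le> A n * A m\<close>; cancel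
    \<open>A n\<close> and let \<open>n\<close> tend to infinity.\<close>
  have lower: "l ^ Suc m \<le> A m" for m
  proof (rule LIMSEQ_le_const2)
    show "(\<lambda>n. \<rho> n ^ Suc m) \<longlonglongrightarrow> l ^ Suc m" by (intro tendsto_power l)
    have "\<rho> n ^ Suc m \<le> A m" for n
    proof -
      have "A n * \<rho> n ^ Suc m \<le> A n * A m"
        using iter[of n "Suc m"] sub[of n m] by simp
      then show ?thesis using pos[of n] by simp
    qed
    then show "\<exists>N. \<forall>n\<ge>N. \<rho> n ^ Suc m \<le> A m" by blast
  qed
  have dec: "decseq (\<lambda>n. A n / l ^ Suc n)"
  proof (rule decseq_SucI)
    fix n
    have "A (Suc n) \<le> l * A n" using l(2)[of n] pos[of n] by (simp add: \<rho>_def field_simps)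
    then show "A (Suc n) / l ^ Suc (Suc n) \<le> A n / l ^ Suc n"
      using \<open>l > 0\<close> by (simp add: field_simps)
  qed
  have nonneg: "0 \<le> A n / l ^ Suc n" for n
    using pos[of n] \<open>l > 0\<close> by (simp add: less_imp_le)
  obtain L where "(\<lambda>n. A n / l ^ Suc n) \<longlonglongrightarrow> L"
    by (rule decseq_convergent[OF dec, of 0]) (use nonneg in auto)
  then have "convergent (\<lambda>n. A n / l ^ Suc n)" by (rule convergentI)
  with \<open>l > 0\<close> lower show ?thesis using that by blast
qed

section \<open>Convolution powers of hermitian kernels\<close>

context compact_haar_group
begin

definition hermitian :: "('a \<Rightarrow> complex) \<Rightarrow> bool" where
  "hermitian f \<longleftrightarrow> cts f \<and> star f = f"

lemma hermitian_cts: "hermitian f \<Longrightarrow> cts f"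
  by (simp add: hermitian_def)

lemma hermitian_conv: "hermitian f \<Longrightarrow> hermitian g \<Longrightarrow> hermitian (conv f g)"
  by (simp add: hermitian_def cts_conv star_conv)

lemma hermitian_conv_self_zero: "hermitian f \<Longrightarrow> conv f f 0 = complex_of_real (sqnorm f)"
  using conv_star_self_zero[of f] by (simp add: hermitian_def)

text \<open>The power with \<open>n + 1\<close> factors: in general convolution has no continuous
  unit that could serve as the empty power.\<close>

definition conv_pow :: "('a \<Rightarrow> complex) \<Rightarrow> nat \<Rightarrow> 'a \<Rightarrow> complex" where
  "conv_pow h n = (conv h ^^ n) h"

lemma conv_pow_0 [simp]: "conv_pow h 0 = h"
  by (simp add: conv_pow_def)

lemma conv_pow_Suc: "conv_pow h (Suc n) = conv h (conv_pow h n)"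
  by (simp add: conv_pow_def)

lemma hermitian_conv_pow: "hermitian h \<Longrightarrow> hermitian (conv_pow h n)"
  by (induction n) (auto simp: conv_pow_Suc hermitian_conv)

lemma conv_conv_pow:
  assumes "hermitian h"
  shows "conv (conv_pow h m) (conv_pow h n) = conv_pow h (Suc (m + n))"
proof (induction m)
  case (Suc m)
  have c: "cts h" "cts (conv_pow h k)" for k
    using hermitian_conv_pow[OF assms] assms by (auto simp: hermitian_cts)
  have "conv (conv_pow h (Suc m)) (conv_pow h n) = conv h (conv (conv_pow h m) (conv_pow h n))"
    unfolding conv_pow_Suc by (rule conv_assoc[OF c(1) c(2) c(2)])
  then show ?case by (simp add: Suc conv_pow_Suc)
qed (simp add: conv_pow_Suc)

lemma sqnorm_conv_pow:
  assumes "hermitian h"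
  shows "conv_pow h (Suc (2 * n)) 0 = complex_of_real (sqnorm (conv_pow h n))"
  using hermitian_conv_self_zero[OF hermitian_conv_pow[OF assms, of n]] conv_conv_pow[OF assms, of n n]
  by (simp add: mult_2)

text \<open>A power with an even number of factors takes at \<open>0\<close> the squared norm of the
  power with half as many. The strong induction thus goes from \<open>n div 2\<close> to
  \<open>n\<close>; if the number of factors is odd, one more factor \<open>h\<close> is convolved
  on first.\<close>

lemma conv_pow_sqnorm_pos:
  assumes h: "hermitian h" and "h \<noteq> (\<lambda>x. 0)"
  shows "sqnorm (conv_pow h n) > 0"
proof -
  have pos: "sqnorm f > 0" if "hermitian f" "f \<noteq> (\<lambda>x. 0)" for f
    using sqnorm_pos[OF hermitian_cts[OF that(1)]] that(2) by (auto simp: fun_eq_iff)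
  have "conv_pow h n \<noteq> (\<lambda>x. 0)"
  proof (induction n rule: less_induct)
    case (less n)
    show ?case
    proof (cases n)
      case 0
      then show ?thesis using assms by simp
    next
      case (Suc m)
      define k where "k = n div 2"
      have "k < n" "m = 2 * k \<or> Suc m = 2 * k" using Suc by (auto simp: k_def)
      have "sqnorm (conv_pow h k) > 0"
        using pos[OF hermitian_conv_pow[OF h] less[OF \<open>k < n\<close>]] .
      then have nz: "conv_pow h (Suc (2 * k)) \<noteq> (\<lambda>x. 0)"
        using sqnorm_conv_pow[OF h, of k] by (metis of_real_eq_0_iff order_less_irrefl)
      show ?thesis
      proof (cases "m = 2 * k")
        case True
        with nz Suc show ?thesis by simp
      next
        case False
        then have "n = 2 * k" using \<open>m = 2 * k \<or> Suc m = 2 * k\<close> Suc by simp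
        show ?thesis
        proof
          assume "conv_pow h n = (\<lambda>x. 0)"
          then have "conv_pow h (Suc (2 * k)) = (\<lambda>x. 0)"
            using \<open>n = 2 * k\<close> by (simp add: conv_pow_Suc conv_def)
          with nz show False by simp
        qed
      qed
    qed
  qed
  then show ?thesis using pos[OF hermitian_conv_pow[OF h]] by blast
qed

lemma sqnorm_conv_pow_submult:
  assumes "hermitian h"
  shows "sqnorm (conv_pow h (Suc (m + n))) \<le> sqnorm (conv_pow h m) * sqnorm (conv_pow h n)"
proof -
  have c: "cts (conv_pow h k)" for k
    using hermitian_conv_pow[OF assms] by (rule hermitian_cts)
  let ?B = "sqnorm (conv_pow h m) * sqnorm (conv_pow h n)"
  have "sqnorm (conv_pow h (Suc (m + n))) \<le> (sqrt ?B)\<^sup>2"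
  proof (rule sqnorm_le[OF c])
    fix x
    show "norm (conv_pow h (Suc (m + n)) x) \<le> sqrt ?B"
      using norm_conv_le[OF c c, of m n x] conv_conv_pow[OF assms, of m n] by (simp add: real_le_rsqrt)
  qed
  then show ?thesis by simp
qed

text \<open>The middle squared norm is the value at \<open>0\<close> of the convolution of the two
  outer powers, so this is Cauchy-Schwarz.\<close>

lemma sqnorm_conv_pow_logconvex:
  assumes "hermitian h"
  shows "(sqnorm (conv_pow h (Suc n)))\<^sup>2 \<le> sqnorm (conv_pow h n) * sqnorm (conv_pow h (Suc (Suc n)))"
proof -
  have c: "cts (conv_pow h k)" for k
    using hermitian_conv_pow[OF assms] by (rule hermitian_cts)
  have "conv (conv_pow h n) (conv_pow h (Suc (Suc n))) 0 = complex_of_real (sqnorm (conv_pow h (Suc n)))"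
    unfolding conv_conv_pow[OF assms] using sqnorm_conv_pow[OF assms, of "Suc n"] by (simp add: mult_2)
  then show ?thesis
    using norm_conv_le[OF c c, of n "Suc (Suc n)" 0] by simp
qed

text \<open>Power iteration: the normalized convolution powers of \<open>h * h\<close> converge uniformly to the
  kernel of the orthogonal projection onto the top eigenspace of convolution with \<open>h * h\<close>.\<close>

lemma power_iteration:
  assumes h: "hermitian h" and nz: "h \<noteq> (\<lambda>x. 0)"
  obtains D l where "l > 0" "hermitian D" "D \<noteq> (\<lambda>x. 0)" "conv D D = D"
    "conv (conv h h) D = (\<lambda>x. complex_of_real l * D x)"
    "\<And>E. cts E \<Longrightarrow> conv h E = h \<Longrightarrow> conv D E = D"
proof -
  define A where "A n = sqnorm (conv_pow h n)" for n
  obtain l where l: "l > 0" "\<And>n. l ^ Suc n \<le> A n" "convergent (\<lambda>n. A n / l ^ Suc n)"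
    using ratio_limit[of A] conv_pow_sqnorm_pos[OF h nz] sqnorm_conv_pow_submult[OF h]
      sqnorm_conv_pow_logconvex[OF h] unfolding A_def by blast
  define b where "b n = A n / l ^ Suc n" for n
  \<comment> \<open>The power of \<open>k = conv h h\<close> with \<open>n + 1\<close> factors,
    divided by \<open>l ^ Suc n\<close>: the part belonging to the eigenvalue \<open>l\<close> is
    preserved and the rest decays.\<close>
  define g where "g n x = conv_pow h (Suc (2 * n)) x / complex_of_real l ^ Suc n" for n x
  define k where "k = conv h h"
  have k: "hermitian k" "cts k" using h hermitian_conv hermitian_cts unfolding k_def by blast+
  have ch: "cts (conv_pow h n)" for n using hermitian_conv_pow[OF h] by (rule hermitian_cts)
  have g_alt: "g n = (\<lambda>x. inverse (complex_of_real l ^ Suc n) * conv_pow h (Suc (2 * n)) x)" for n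
    by (simp add: g_def fun_eq_iff divide_inverse mult.commute)
  have cg: "cts (g n)" for n
    unfolding g_alt using ch by (intro continuous_intros)
  have star_g: "star (g n) = g n" for n
    using hermitian_conv_pow[OF h, of "Suc (2 * n)"]
    by (auto simp: star_def g_def hermitian_def fun_eq_iff)
  have g0: "g n 0 = complex_of_real (b n)" for n
    by (simp add: g_def b_def A_def sqnorm_conv_pow[OF h])
  have gg: "conv (g m) (g n) 0 = complex_of_real (b (Suc (m + n)))" for m n
  proof -
    have "conv (g m) (g n) 0 =
      inverse (complex_of_real l ^ Suc n) * (inverse (complex_of_real l ^ Suc m) * conv_pow h (Suc (2 * Suc (m + n))) 0)"
      unfolding g_alt conv_scale_left conv_scale_right conv_conv_pow[OF h] by (simp add: mult_2 add_ac)
    also have "\<dots> = complex_of_real (b (Suc (m + n)))"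
      unfolding sqnorm_conv_pow[OF h] b_def A_def using l(1) by (simp add: field_simps power_add)
    finally show ?thesis .
  qed
  have kg: "conv k (g n) = (\<lambda>x. complex_of_real l * g (Suc n) x)" for n
  proof -
    have "k = conv_pow h (Suc 0)" by (simp add: k_def conv_pow_Suc)
    then have "conv k (g n) = (\<lambda>x. inverse (complex_of_real l ^ Suc n) * conv_pow h (Suc (2 * Suc n)) x)"
      unfolding g_alt conv_scale_right using conv_conv_pow[OF h, of "Suc 0" "Suc (2 * n)"] by simp
    then show ?thesis using l(1) by (simp add: g_def fun_eq_iff field_simps)
  qed
  have herm_diff: "hermitian (\<lambda>x. g m x - g n x)" for m n
    using star_g[of m] star_g[of n] cg
    by (auto simp: hermitian_def star_def fun_eq_iff intro!: continuous_intros)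
  \<comment> \<open>All mean-square distances are combinations of values of the one convergent
    sequence \<open>b\<close>, so \<open>g\<close> is Cauchy in mean square.\<close>
  have sq: "sqnorm (\<lambda>x. g m x - g n x) = b (Suc (m + m)) - 2 * b (Suc (m + n)) + b (Suc (n + n))" for m n
  proof -
    have "complex_of_real (sqnorm (\<lambda>x. g m x - g n x)) = conv (\<lambda>x. g m x - g n x) (\<lambda>x. g m x - g n x) 0"
      by (rule hermitian_conv_self_zero[OF herm_diff, symmetric])
    also have "\<dots> = (conv (g m) (g m) 0 - conv (g n) (g m) 0) - (conv (g m) (g n) 0 - conv (g n) (g n) 0)"
      using cg by (simp add: conv_diff_right conv_diff_left continuous_on_diff)
    also have "\<dots> = complex_of_real (b (Suc (m + m)) - 2 * b (Suc (m + n)) + b (Suc (n + n)))"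
      unfolding gg by (simp add: add.commute)
    finally show ?thesis using of_real_eq_iff by blast
  qed
  obtain \<beta> where \<beta>: "b \<longlonglongrightarrow> \<beta>" using l(3) unfolding b_def convergent_def by blast
  have cauchy: "\<exists>N. \<forall>m\<ge>N. \<forall>n\<ge>N. sqnorm (\<lambda>x. g m x - g n x) < e" if e: "e > 0" for e
  proof -
    have "e / 4 > 0" using e by simp
    then obtain N where N: "\<And>n. n \<ge> N \<Longrightarrow> \<bar>b n - \<beta>\<bar> < e / 4"
      using LIMSEQ_D[OF \<beta>] by (metis real_norm_def)
    have "sqnorm (\<lambda>x. g m x - g n x) < e" if "m \<ge> N" "n \<ge> N" for m n
      using N[of "Suc (m + m)"] N[of "Suc (m + n)"] N[of "Suc (n + n)"] that unfolding sq
      by linarith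
    then show ?thesis by blast
  qed
  \<comment> \<open>One further convolution with \<open>k\<close> upgrades mean-square Cauchy to
    uniformly Cauchy, at the price of the index shift \<open>Suc n\<close>.\<close>
  have "uniformly_Cauchy_on UNIV (\<lambda>n. g (Suc n))"
  proof (rule uniformly_Cauchy_onI)
    fix e :: real assume "e > 0"
    have kp: "sqnorm k + 1 > 0" using sqnorm_nonneg[of k] by linarith
    have "(l * e)\<^sup>2 / (sqnorm k + 1) > 0" using \<open>e > 0\<close> l(1) kp by simp
    from cauchy[OF this] obtain N where
      N: "\<And>m n. m \<ge> N \<Longrightarrow> n \<ge> N \<Longrightarrow> sqnorm (\<lambda>x. g m x - g n x) < (l * e)\<^sup>2 / (sqnorm k + 1)"
      by blast
    have "dist (g (Suc m) x) (g (Suc n) x) < e" if "m \<ge> N" "n \<ge> N" for m n x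
    proof -
      have "conv k (\<lambda>x. g m x - g n x) x = complex_of_real l * (g (Suc m) x - g (Suc n) x)"
        using cg k by (simp add: conv_diff_right kg algebra_simps)
      then have "(l * norm (g (Suc m) x - g (Suc n) x))\<^sup>2 \<le> sqnorm k * sqnorm (\<lambda>x. g m x - g n x)"
        using norm_conv_le[OF k(2), of "\<lambda>x. g m x - g n x" x] cg l(1)
        by (simp add: norm_mult continuous_on_diff)
      also have "\<dots> \<le> sqnorm k * ((l * e)\<^sup>2 / (sqnorm k + 1))"
        using N[OF that] by (intro mult_left_mono) auto
      also have "\<dots> < (l * e)\<^sup>2"
        using kp \<open>e > 0\<close> l(1) by (simp add: field_simps)
      finally have "l * norm (g (Suc m) x - g (Suc n) x) < l * e"
        by (rule power_less_imp_less_base) (use \<open>e > 0\<close> l(1) in auto)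
      then show ?thesis using l(1) by (simp add: dist_norm)
    qed
    then show "\<exists>M. \<forall>x\<in>UNIV. \<forall>m\<ge>M. \<forall>n\<ge>M. dist (g (Suc m) x) (g (Suc n) x) < e" by blast
  qed
  then obtain D where D: "uniform_limit UNIV (\<lambda>n. g (Suc n)) D sequentially"
    using Cauchy_uniformly_convergent unfolding uniformly_convergent_on_def by blast
  have cD: "cts D"
    by (rule uniform_limit_theorem[OF _ D]) (auto simp: cg)
  have lim: "(\<lambda>n. g (Suc n) x) \<longlonglongrightarrow> D x" for x
    by (rule tendsto_uniform_limitI[OF D]) simp
  have conv_lim: "(\<lambda>n. conv f (g (Suc n)) x) \<longlonglongrightarrow> conv f D x" if "cts f" for f x
    by (rule conv_tendsto[OF that cg D cD])
  have "star D x = D x" for x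
  proof (rule LIMSEQ_unique[OF _ lim])
    have "(\<lambda>n. cnj (g (Suc n) (- x))) \<longlonglongrightarrow> star D x"
      unfolding star_def by (intro tendsto_cnj lim)
    moreover have "cnj (g (Suc n) (- x)) = g (Suc n) x" for n
      using fun_cong[OF star_g[of "Suc n"], of x] by (simp add: star_def)
    ultimately show "(\<lambda>n. g (Suc n) x) \<longlonglongrightarrow> star D x" by simp
  qed
  then have hD: "hermitian D" using cD by (auto simp: hermitian_def)
  have D0: "D 0 = complex_of_real \<beta>"
  proof (rule LIMSEQ_unique[OF lim])
    show "(\<lambda>n. g (Suc n) 0) \<longlonglongrightarrow> complex_of_real \<beta>"
      unfolding g0 using LIMSEQ_Suc[OF \<beta>] by (rule tendsto_of_real)
  qed
  \<comment> \<open>The lower bound \<open>l ^ Suc n \<le> A n\<close> keeps the limit away from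
    zero: \<open>D 0 = \<beta>\<close> shows that the projection is not trivial.\<close>
  have "1 \<le> \<beta>"
  proof (rule LIMSEQ_le_const[OF \<beta>])
    have "1 \<le> b n" for n using l(1) l(2)[of n] by (simp add: b_def)
    then show "\<exists>N. \<forall>n\<ge>N. 1 \<le> b n" by blast
  qed
  then have "D 0 \<noteq> 0" unfolding D0 by simp
  then have D_nz: "D \<noteq> (\<lambda>x. 0)" by metis
  have kD: "conv k D = (\<lambda>x. complex_of_real l * D x)"
  proof
    fix x
    have "(\<lambda>n. complex_of_real l * g (Suc (Suc n)) x) \<longlonglongrightarrow> complex_of_real l * D x"
      by (rule tendsto_mult[OF tendsto_const LIMSEQ_Suc[OF lim]])
    then show "conv k D x = complex_of_real l * D x"
      using LIMSEQ_unique[OF conv_lim[OF k(2)]] by (simp add: kg)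
  qed
  have powD: "conv (conv_pow h (Suc (2 * n))) D = (\<lambda>x. complex_of_real l ^ Suc n * D x)" for n
  proof (induction n)
    case 0
    then show ?case using kD by (simp add: conv_pow_Suc k_def)
  next
    case (Suc n)
    have "conv_pow h (Suc (2 * Suc n)) = conv k (conv_pow h (Suc (2 * n)))"
      using conv_conv_pow[OF h, of "Suc 0" "Suc (2 * n)"] by (simp add: conv_pow_Suc k_def)
    then have *: "conv (conv_pow h (Suc (2 * Suc n))) D = conv k (conv (conv_pow h (Suc (2 * n))) D)"
      using conv_assoc[OF k(2) ch cD] by simp
    show ?case unfolding * Suc.IH conv_scale_right kD by (simp add: mult_ac)
  qed
  have gD: "conv (g n) D = D" for n
    unfolding g_alt conv_scale_left powD using l(1) by (simp add: fun_eq_iff field_simps)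
  have DD: "conv D D = D"
  proof
    fix x
    have "conv D (g (Suc n)) = D" for n
      using conv_commute[OF cD cg] gD by simp
    then have "(\<lambda>n. D x) \<longlonglongrightarrow> conv D D x" using conv_lim[OF cD, of x] by simp
    then show "conv D D x = D x" by (simp add: LIMSEQ_const_iff)
  qed
  \<comment> \<open>If \<open>E\<close> acts as a unit on \<open>h\<close>, it does so on all its
    powers and on their limit. This keeps the projection obtained from \<open>h\<close> below a
    given idempotent.\<close>
  have "conv D E = D" if E: "cts E" "conv h E = h" for E
  proof
    fix x
    have "conv (conv_pow h n) E = conv_pow h n" for n
    proof (induction n)
      case (Suc n)
      then show ?case
        unfolding conv_pow_Suc using conv_assoc[OF hermitian_cts[OF h] ch E(1)] by simp
    qed (simp add: E)
    then have "conv (g n) E = g n" for n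
      unfolding g_alt conv_scale_left by simp
    then have "conv E (g n) = g n" for n using conv_commute[OF cg E(1)] by metis
    then have "(\<lambda>n. g (Suc n) x) \<longlonglongrightarrow> conv E D x" using conv_lim[OF E(1), of x] by simp
    then have "conv E D x = D x" using LIMSEQ_unique lim by blast
    then show "conv D E x = D x" using conv_commute[OF cD E(1)] by simp
  qed
  with l(1) hD D_nz DD kD[unfolded k_def] show ?thesis using that by blast
qed

section \<open>Minimal idempotents and the characters they define\<close>

definition idem :: "('a \<Rightarrow> complex) \<Rightarrow> bool" where
  "idem E \<longleftrightarrow> hermitian E \<and> conv E E = E \<and> E \<noteq> (\<lambda>x. 0)"

text \<open>With \<open>s = sqnorm E\<close>, idempotence and Cauchy-Schwarz bound
  \<open>norm (E x)\<close> by \<open>s\<close>, and integrating the square gives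
  \<open>s \<le> s\<^sup>2\<close>. In Fourier terms \<open>E\<close> is a sum of finitely many
  distinct characters and \<open>s\<close> is their number, which explains its use as a
  rank.\<close>

lemma idem_zero:
  assumes "idem E"
  shows "E 0 = complex_of_real (sqnorm E)" "sqnorm E \<ge> 1"
proof -
  have h: "hermitian E" "conv E E = E" and c: "cts E" and nz: "E \<noteq> (\<lambda>x. 0)"
    using assms by (auto simp: idem_def hermitian_def)
  show "E 0 = complex_of_real (sqnorm E)"
    using hermitian_conv_self_zero[OF h(1)] h(2) by simp
  have "norm (E x) \<le> sqnorm E" for x
    using norm_conv_le[OF c c, of x] h(2) by (simp add: power2_eq_square[symmetric] power2_le_iff_abs_le)
  then have "sqnorm E \<le> (sqnorm E)\<^sup>2" by (rule sqnorm_le[OF c])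
  moreover have "sqnorm E > 0" using sqnorm_pos[OF c] nz by (auto simp: fun_eq_iff)
  ultimately show "sqnorm E \<ge> 1" by (simp add: power2_eq_square)
qed

text \<open>If \<open>F\<close> lies strictly below \<open>E\<close>, then \<open>E - F\<close> is
  again idempotent. Values at \<open>0\<close> show that \<open>sqnorm\<close> is additive, and the
  difference has \<open>sqnorm\<close> at least \<open>1\<close>; hence the integer part of
  \<open>sqnorm\<close> drops, and minimizing it suffices although \<open>sqnorm\<close> is not yet
  known to be an integer.\<close>

lemma ex_minimal_idem:
  assumes "idem D"
  obtains E where "idem E" "conv E D = E" "\<And>F. idem F \<Longrightarrow> conv F E = F \<Longrightarrow> F = E"
proof -
  define S where "S = {E. idem E \<and> conv E D = E}"
  have "D \<in> S" using assms by (simp add: S_def idem_def)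
  then obtain E where E: "E \<in> S" "\<And>F. F \<in> S \<Longrightarrow> nat \<lfloor>sqnorm E\<rfloor> \<le> nat \<lfloor>sqnorm F\<rfloor>"
    using ex_has_least_nat[of "\<lambda>E. E \<in> S" D "\<lambda>E. nat \<lfloor>sqnorm E\<rfloor>"] by blast
  have cD: "cts D" using assms by (simp add: idem_def hermitian_def)
  have "F = E" if F: "idem F" "conv F E = F" for F
  proof (rule ccontr)
    assume "F \<noteq> E"
    have iE: "idem E" "conv E D = E" using E(1) by (auto simp: S_def)
    have c: "cts E" "cts F" using iE F by (auto simp: idem_def hermitian_def)
    have "conv F D = F" using conv_assoc[OF c(2,1) cD] iE F by simp
    then have "F \<in> S" using F by (simp add: S_def)
    have FE: "conv E F = F" using conv_commute[OF c] F by simp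
    define G where "G = (\<lambda>x. E x - F x)"
    have "conv G G = G"
      unfolding G_def using c iE F FE by (simp add: conv_diff_left conv_diff_right continuous_on_diff idem_def)
    moreover have "hermitian G"
      using iE F by (auto simp: G_def hermitian_def idem_def star_def fun_eq_iff intro!: continuous_intros)
    moreover have "G \<noteq> (\<lambda>x. 0)" using \<open>F \<noteq> E\<close> unfolding G_def by (metis eq_iff_diff_eq_0 ext)
    ultimately have "idem G" by (simp add: idem_def)
    then have "sqnorm G \<ge> 1" by (rule idem_zero)
    have "complex_of_real (sqnorm G) = complex_of_real (sqnorm E - sqnorm F)"
      using idem_zero(1)[OF iE(1)] idem_zero(1)[OF F(1)] idem_zero(1)[OF \<open>idem G\<close>]
      by (simp add: G_def)
    then have "sqnorm G = sqnorm E - sqnorm F" by (simp only: of_real_eq_iff)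
    then have "sqnorm F \<le> sqnorm E - 1" using \<open>sqnorm G \<ge> 1\<close> by linarith
    moreover have "sqnorm F \<ge> 1" by (rule idem_zero[OF F(1)])
    ultimately have "nat \<lfloor>sqnorm F\<rfloor> < nat \<lfloor>sqnorm E\<rfloor>" by linarith
    with E(2)[OF \<open>F \<in> S\<close>] show False by simp
  qed
  moreover have "idem E" "conv E D = E" using E(1) by (auto simp: S_def)
  ultimately show ?thesis using that by blast
qed

text \<open>Says that the ideal generated by a minimal idempotent is one-dimensional. For hermitian
  \<open>h\<close> in it, power iteration yields an idempotent below \<open>E\<close>, hence
  \<open>E\<close> itself, so the convolution square of \<open>h\<close> is a multiple of
  \<open>E\<close>; the general case follows by polarization and by splitting into hermitian
  parts.\<close>

lemma minimal_idem_eigen: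
  assumes E: "idem E" and min: "\<And>F. idem F \<Longrightarrow> conv F E = F \<Longrightarrow> F = E"
    and f: "cts f" "conv f E = f"
  shows "\<exists>c. f = (\<lambda>x. c * E x)"
proof -
  have cE: "cts E" and EE: "conv E E = E" and hE: "hermitian E"
    using E by (auto simp: idem_def hermitian_def)
  have square: "\<exists>c. conv h h = (\<lambda>x. c * E x)" if h: "hermitian h" "conv h E = h" for h
  proof (cases "h = (\<lambda>x. 0)")
    case True
    then show ?thesis by (intro exI[of _ 0]) simp
  next
    case False
    have ch: "cts h" using h by (simp add: hermitian_def)
    obtain D l where D: "hermitian D" "D \<noteq> (\<lambda>x. 0)" "conv D D = D"
      "conv (conv h h) D = (\<lambda>x. complex_of_real l * D x)" "conv D E = D"
      using power_iteration[OF h(1) False] cE h(2) by metis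
    then have "D = E" using min[of D] by (simp add: idem_def)
    moreover have "conv (conv h h) E = conv h h"
      using conv_assoc[OF ch ch cE] h(2) by simp
    ultimately show ?thesis using D(4) by auto
  qed
  have herm: "\<exists>c. h = (\<lambda>x. c * E x)" if h: "hermitian h" "conv h E = h" for h
  proof -
    have ch: "cts h" using h by (simp add: hermitian_def)
    have Eh: "conv E h = h" using conv_commute[OF ch cE] h by simp
    obtain c where c: "conv h h = (\<lambda>x. c * E x)" using square[OF h] by blast
    \<comment> \<open>Polarization against the unit \<open>E\<close>: in the square of
      \<open>h + E\<close> the mixed terms are \<open>2 h\<close>, while all other terms are
      multiples of \<open>E\<close>.\<close>
    have "hermitian (\<lambda>x. h x + E x)"
      using h hE by (auto simp: hermitian_def star_def fun_eq_iff intro!: continuous_intros)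
    moreover have "conv (\<lambda>x. h x + E x) E = (\<lambda>x. h x + E x)"
      using ch cE h EE by (simp add: conv_add_left)
    ultimately obtain d where d: "conv (\<lambda>x. h x + E x) (\<lambda>x. h x + E x) = (\<lambda>x. d * E x)"
      using square by blast
    have "conv (\<lambda>x. h x + E x) (\<lambda>x. h x + E x) = (\<lambda>x. c * E x + 2 * h x + E x)"
      using ch cE h EE Eh c by (simp add: conv_add_left conv_add_right continuous_on_add fun_eq_iff)
    then have "\<forall>x. c * E x + 2 * h x + E x = d * E x" using d by (simp add: fun_eq_iff)
    then have "d * E x = c * E x + 2 * h x + E x" for x by simp
    then have "(d - c - 1) * E x = 2 * h x" for x by (simp add: left_diff_distrib)
    then have "h x = ((d - c - 1) / 2) * E x" for x by simp
    then show ?thesis by (intro exI[of _ "(d - c - 1) / 2"]) auto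
  qed
  \<comment> \<open>Both parts are hermitian, and \<open>f = (h1 - \<i> h2) / 2\<close>.\<close>
  define h1 where "h1 = (\<lambda>x. f x + star f x)"
  define h2 where "h2 = (\<lambda>x. \<i> * (f x - star f x))"
  have sf: "cts (star f)" "conv (star f) E = star f"
    using cts_star[OF f(1)] star_conv[OF f(1) cE] f(2) hE by (auto simp: hermitian_def)
  have "hermitian h1" "hermitian h2"
    using f(1) sf(1) by (auto simp: h1_def h2_def hermitian_def star_def fun_eq_iff algebra_simps
        intro!: continuous_intros)
  moreover have "conv h1 E = h1"
    unfolding h1_def using f sf cE by (simp add: conv_add_left)
  moreover have "conv h2 E = h2"
    unfolding h2_def conv_scale_left using f sf cE by (simp add: conv_diff_left)
  ultimately obtain a b where "h1 = (\<lambda>x. a * E x)" "h2 = (\<lambda>x. b * E x)"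
    using herm by meson
  then have ab: "a * E x = f x + star f x" "b * E x = \<i> * (f x - star f x)" for x
    by (auto simp: h1_def h2_def fun_eq_iff)
  have "f x = ((a - \<i> * b) / 2) * E x" for x
  proof -
    have "(a - \<i> * b) * E x = a * E x - \<i> * (b * E x)" by (simp add: left_diff_distrib)
    also have "\<dots> = 2 * f x" unfolding ab by (simp flip: mult.assoc)
    finally show ?thesis by simp
  qed
  then have "f = (\<lambda>x. ((a - \<i> * b) / 2) * E x)" by (rule ext)
  then show ?thesis by blast
qed

definition character :: "('a \<Rightarrow> complex) \<Rightarrow> bool" where
  "character \<phi> \<longleftrightarrow> cts \<phi> \<and> (\<forall>x y. \<phi> (x + y) = \<phi> x * \<phi> y) \<and> (\<forall>x. norm (\<phi> x) = 1)"

text \<open>Every translate of \<open>E\<close> stays in the ideal of \<open>E\<close>, so it is a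
  multiple of \<open>E\<close>; comparing values at \<open>0\<close> gives the multiplicative
  functional equation. Hermitian symmetry then forces absolute value \<open>1\<close>.\<close>

lemma character_of_minimal_idem:
  assumes E: "idem E" and min: "\<And>F. idem F \<Longrightarrow> conv F E = F \<Longrightarrow> F = E"
  shows "character (\<lambda>x. E x / E 0)"
proof -
  have cE: "cts E" and EE: "conv E E = E" and hE: "hermitian E"
    using E by (auto simp: idem_def hermitian_def)
  have E0: "E 0 \<noteq> 0" using idem_zero[OF E] by auto
  have mult: "E (x + a) = (E a / E 0) * E x" for x a
  proof -
    have "cts (\<lambda>x. E (x + a))"
      using continuous_translate[OF cE, of a] by (simp add: add.commute)
    moreover have "conv (\<lambda>x. E (x + a)) E = (\<lambda>x. E (x + a))"
      unfolding conv_translate_left EE ..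
    ultimately obtain c where c: "(\<lambda>x. E (x + a)) = (\<lambda>x. c * E x)"
      using minimal_idem_eigen[OF E min] by blast
    then have "E a = c * E 0" by (metis add.left_neutral)
    with fun_cong[OF c, of x] show ?thesis using E0 by simp
  qed
  let ?\<phi> = "\<lambda>x. E x / E 0"
  have hom: "?\<phi> (x + y) = ?\<phi> x * ?\<phi> y" for x y
    using E0 mult[of x y] by (simp add: field_simps)
  have "norm (?\<phi> x) = 1" for x
  proof -
    have "E (- x) = cnj (E x)"
      using hE by (simp add: hermitian_def star_def fun_eq_iff) (metis complex_cnj_cnj)
    moreover have "cnj (E 0) = E 0" using idem_zero(1)[OF E] by simp
    ultimately have "?\<phi> x * cnj (?\<phi> x) = 1"
      using hom[of x "- x"] E0 by simp
    then show ?thesis by (metis complex_mod_sqrt_Re_mult_cnj one_complex.sel(1) real_sqrt_one)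
  qed
  moreover have "cts ?\<phi>" using cE E0 by (intro continuous_intros) auto
  ultimately show ?thesis using hom by (simp add: character_def)
qed

text \<open>The kernel is built from \<open>f\<close>, the difference of a function and its
  translate by \<open>x0\<close>. A character trivial at \<open>x0\<close> is invariant under this
  translation and hence annihilates \<open>f\<close>, whereas the character found lies in an
  eigenspace of \<open>conv h h\<close> with eigenvalue \<open>l > 0\<close>.\<close>

theorem characters_separate:
  assumes "x0 \<noteq> 0"
  obtains \<phi> where "character \<phi>" "\<phi> x0 \<noteq> 1"
proof -
  have "{0} \<inter> {x0} = {}" using assms by auto
  then obtain u :: "'a \<Rightarrow> real" where u: "continuous_on UNIV u" "u 0 = 0" "u x0 = 1"
    using ex_Urysohn[of "{0}" "{x0}"] by (metis closed_singleton singletonI)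
  define g where "g = (\<lambda>x. complex_of_real (u x))"
  define f where "f = (\<lambda>x. g (x0 + x) - g x)"
  have cg: "cts g" unfolding g_def using u(1) by (intro continuous_intros)
  have cg': "cts (\<lambda>x. g (x0 + x))" by (rule continuous_translate[OF cg])
  have cf: "cts f" unfolding f_def using cg cg' by (intro continuous_on_diff)
  have "f 0 \<noteq> 0" using u by (simp add: f_def g_def)
  define h where "h = conv f (star f)"
  have sf: "cts (star f)" by (rule cts_star[OF cf])
  have ch: "cts h" unfolding h_def by (rule cts_conv[OF cf sf])
  have h: "hermitian h"
    using ch star_conv[OF cf sf] conv_commute[OF cf sf] by (simp add: hermitian_def h_def)
  have "h 0 \<noteq> 0"
    using conv_star_self_zero[OF cf] sqnorm_pos[OF cf \<open>f 0 \<noteq> 0\<close>] by (simp add: h_def)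
  then have "h \<noteq> (\<lambda>x. 0)" by auto
  with power_iteration[OF h] obtain D l where D: "l > 0" "hermitian D" "D \<noteq> (\<lambda>x. 0)" "conv D D = D"
    "conv (conv h h) D = (\<lambda>x. complex_of_real l * D x)"
    by metis
  then have "idem D" by (simp add: idem_def)
  obtain E where E: "idem E" "conv E D = E" "\<And>F. idem F \<Longrightarrow> conv F E = F \<Longrightarrow> F = E"
    using ex_minimal_idem[OF \<open>idem D\<close>] by blast
  define \<phi> where "\<phi> = (\<lambda>x. E x / E 0)"
  have \<phi>: "character \<phi>" unfolding \<phi>_def using character_of_minimal_idem[OF E(1,3)] .
  have c: "cts D" "cts E" "cts (conv h h)"
    using D(2) E(1) ch by (auto simp: hermitian_def idem_def cts_conv)
  \<comment> \<open>\<open>E\<close> lies below \<open>D\<close>, so it inherits the eigenvalue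
    \<open>l\<close> from \<open>D\<close>.\<close>
  have hE: "conv (conv h h) E = (\<lambda>x. complex_of_real l * E x)"
  proof -
    have "conv (conv h h) E = conv (conv h h) (conv D E)"
      using E(2) conv_commute[OF c(2,1)] by simp
    also have "\<dots> = conv (conv (conv h h) D) E" using conv_assoc[OF c(3,1,2)] by simp
    also have "\<dots> = (\<lambda>x. complex_of_real l * conv D E x)" unfolding D(5) conv_scale_left ..
    finally show ?thesis using E(2) conv_commute[OF c(2,1)] by simp
  qed
  have E0: "E 0 \<noteq> 0" using idem_zero[OF E(1)] by auto
  have "\<phi> x0 \<noteq> 1"
  proof
    assume 1: "\<phi> x0 = 1"
    have inv: "E (x - (x0 + y)) = E (x - y)" for x y
    proof -
      have "\<phi> (x - y) = \<phi> (x0 + (x - (x0 + y)))" by simp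
      also have "\<dots> = \<phi> x0 * \<phi> (x - (x0 + y))"
        using \<phi> unfolding character_def by blast
      finally show ?thesis using E0 1 by (simp add: \<phi>_def)
    qed
    have "conv E f = (\<lambda>x. 0)"
    proof
      fix x
      have i: "integrable \<mu> (\<lambda>y. E (x - y) * g y)" "integrable \<mu> (\<lambda>y. E (x - y) * g (x0 + y))"
        using cts_conv_integrand c(2) cg cg' by (auto intro!: integrable_continuous)
      have "conv E f x = (\<integral>y. E (x - y) * g (x0 + y) \<partial>\<mu>) - (\<integral>y. E (x - y) * g y \<partial>\<mu>)"
        unfolding conv_def f_def right_diff_distrib by (rule Bochner_Integration.integral_diff[OF i(2,1)])
      also have "(\<integral>y. E (x - y) * g (x0 + y) \<partial>\<mu>) = (\<integral>y. E (x - (x0 + y)) * g (x0 + y) \<partial>\<mu>)"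
        by (simp only: inv)
      also have "\<dots> = (\<integral>y. E (x - y) * g y \<partial>\<mu>)"
        by (rule integral_translate[OF cts_conv_integrand[OF c(2) cg]])
      finally show "conv E f x = 0" by simp
    qed
    then have "conv E h = (\<lambda>x. 0)"
      unfolding h_def using conv_assoc[OF c(2) cf sf] by simp
    then have "conv E (conv h h) = (\<lambda>x. 0)"
      using conv_assoc[OF c(2) ch ch] by simp
    then have "complex_of_real l * E 0 = 0"
      using hE conv_commute[OF c(2,3)] by (metis (no_types, lifting))
    with D(1) E0 show False by simp
  qed
  with \<phi> show ?thesis using that by blast
qed

end

section \<open>Independent characters and covering dimension\<close>

lemma norm_eq_1_imp_cnj_eq_inverse: "norm (z::complex) = 1 \<Longrightarrow> cnj z = inverse z"
  by (metis complex_norm_square inverse_unique of_real_1 one_power2)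

text \<open>The equality case of the triangle inequality; the extra summand \<open>1\<close> fixes
  the common direction of the unit numbers.\<close>

lemma norm_one_plus_sum_eq_imp:
  fixes z :: "nat \<Rightarrow> complex"
  assumes z: "\<And>i. i < n \<Longrightarrow> norm (z i) = 1" and eq: "norm (1 + (\<Sum>i<n. z i)) = real n + 1"
    and "j < n"
  shows "z j = 1"
proof -
  have split: "1 + (\<Sum>i<n. z i) = (1 + z j) + (\<Sum>i\<in>{..<n} - {j}. z i)"
    using \<open>j < n\<close> by (subst sum.remove[of _ j]) (auto simp: add.assoc)
  have "norm (\<Sum>i\<in>{..<n} - {j}. z i) \<le> (\<Sum>i\<in>{..<n} - {j}. 1)"
    using z by (intro sum_norm_le) auto
  also have "\<dots> = real n - 1" using \<open>j < n\<close> by (simp add: of_nat_diff)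
  finally have "real n + 1 \<le> norm (1 + z j) + (real n - 1)"
    using eq split norm_triangle_ineq[of "1 + z j" "\<Sum>i\<in>{..<n} - {j}. z i"] by simp
  then have "2 \<le> norm (1 + z j)" by simp
  then have "2\<^sup>2 \<le> (norm (1 + z j))\<^sup>2" by (intro power_mono) auto
  moreover have "(Re (z j))\<^sup>2 + (Im (z j))\<^sup>2 = 1"
    using z[OF \<open>j < n\<close>] cmod_power2[of "z j"] by simp
  moreover have "(norm (1 + z j))\<^sup>2 = 1 + 2 * Re (z j) + ((Re (z j))\<^sup>2 + (Im (z j))\<^sup>2)"
    unfolding cmod_power2 by (simp add: power2_eq_square algebra_simps)
  ultimately have "Re (z j) \<ge> 1" by simp
  moreover have "Re (z j) \<le> 1"
    using complex_Re_le_cmod[of "z j"] z[OF \<open>j < n\<close>] by simp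
  ultimately have "Re (z j) = 1" by simp
  with \<open>(Re (z j))\<^sup>2 + (Im (z j))\<^sup>2 = 1\<close> show ?thesis by (simp add: complex_eq_iff)
qed

context compact_haar_group
begin

lemma character_cts: "character \<phi> \<Longrightarrow> cts \<phi>"
  and character_add: "character \<phi> \<Longrightarrow> \<phi> (x + y) = \<phi> x * \<phi> y"
  and character_norm: "character \<phi> \<Longrightarrow> norm (\<phi> x) = 1"
  by (auto simp: character_def)

lemma character_nonzero: "character \<phi> \<Longrightarrow> \<phi> x \<noteq> 0"
  using character_norm[of \<phi> x] by auto

lemma character_0: "character \<phi> \<Longrightarrow> \<phi> 0 = 1"
  using character_add[of \<phi> 0 0] character_nonzero[of \<phi> 0] by simp

lemma character_minus: "character \<phi> \<Longrightarrow> \<phi> (- x) = inverse (\<phi> x)"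
  using character_add[of \<phi> x "- x"] character_0[of \<phi>] by (simp add: inverse_unique)

lemma character_diff: "character \<phi> \<Longrightarrow> \<phi> (x - y) = \<phi> x / \<phi> y"
  using character_add[of \<phi> x "- y"] by (simp add: character_minus divide_inverse)

lemma character_sum: "character \<phi> \<Longrightarrow> \<phi> (\<Sum>i\<in>A. f i) = (\<Prod>i\<in>A. \<phi> (f i))"
  by (induction A rule: infinite_finite_induct) (auto simp: character_0 character_add)

lemma character_one: "character (\<lambda>x. 1)"
  by (simp add: character_def)

lemma character_mult: "character \<phi> \<Longrightarrow> character \<psi> \<Longrightarrow> character (\<lambda>x. \<phi> x * \<psi> x)"
  by (auto simp: character_def norm_mult intro!: continuous_intros)

lemma character_powi: "character \<phi> \<Longrightarrow> character (\<lambda>x. \<phi> x powi k)"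
  using character_nonzero[of \<phi>]
  by (auto simp: character_def norm_power_int power_int_mult_distrib intro!: continuous_intros)

lemma character_prod:
  "(\<And>i. i \<in> A \<Longrightarrow> character (\<phi> i)) \<Longrightarrow> character (\<lambda>x. \<Prod>i\<in>A. \<phi> i x)"
  by (induction A rule: infinite_finite_induct) (auto simp: character_one character_mult)

lemma character_cnj: "character \<phi> \<Longrightarrow> character (\<lambda>x. cnj (\<phi> x))"
  by (auto simp: character_def intro!: continuous_intros)

lemma character_comp:
  assumes "character \<phi>" "continuous_on UNIV T" "Modules.additive T"
  shows "character (\<lambda>x. \<phi> (T x))"
  using assms continuous_on_compose2[OF character_cts[OF assms(1)] assms(2)]
  by (auto simp: character_def additive.add)

lemma integral_character:
  assumes "character \<phi>" "\<phi> a \<noteq> 1"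
  shows "(\<integral>x. \<phi> x \<partial>\<mu>) = 0"
proof -
  have "(\<integral>x. \<phi> x \<partial>\<mu>) = \<phi> a * (\<integral>x. \<phi> x \<partial>\<mu>)"
    using integral_translate[OF character_cts[OF assms(1)], of a] by (simp add: character_add[OF assms(1)])
  then show ?thesis using assms(2) by simp
qed

section \<open>Independent characters take arbitrary unit values simultaneously\<close>

definition char_prod :: "(nat \<Rightarrow> 'a \<Rightarrow> complex) \<Rightarrow> nat \<Rightarrow> (nat \<Rightarrow> int) \<Rightarrow> 'a \<Rightarrow> complex" where
  "char_prod X n k x = (\<Prod>i<n. X i x powi k i)"

text \<open>Linear independence over the integers in the dual group, which is written
  multiplicatively here.\<close>

definition char_indep :: "(nat \<Rightarrow> 'a \<Rightarrow> complex) \<Rightarrow> nat \<Rightarrow> bool" where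
  "char_indep X n \<longleftrightarrow> (\<forall>i<n. character (X i)) \<and>
    (\<forall>k. (\<forall>x. char_prod X n k x = 1) \<longrightarrow> (\<forall>i<n. k i = 0))"

lemma character_char_prod: "(\<And>i. i < n \<Longrightarrow> character (X i)) \<Longrightarrow> character (char_prod X n k)"
  unfolding char_prod_def by (intro character_prod character_powi) auto

lemma char_prod_add:
  assumes "\<And>i. i < n \<Longrightarrow> character (X i)"
  shows "char_prod X n (\<lambda>i. k i + l i) x = char_prod X n k x * char_prod X n l x"
  unfolding char_prod_def prod.distrib[symmetric]
  by (intro prod.cong refl power_int_add) (use assms character_nonzero in auto)

lemma char_prod_scale: "char_prod X n (\<lambda>i. c * k i) x = char_prod X n k x powi c"
proof -
  have "(\<Prod>i\<in>A. f i powi c) = (\<Prod>i\<in>A. f i) powi c" for A :: "nat set" and f :: "nat \<Rightarrow> complex"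
    by (induction A rule: infinite_finite_induct) (auto simp: power_int_mult_distrib)
  then show ?thesis by (simp add: char_prod_def power_int_mult mult.commute[of c])
qed

text \<open>Trigonometric polynomials in characters \<open>X i\<close> twisted by the unit numbers \<open>cis (\<theta> i)\<close>.
  For independent characters the integral only sees the constant term, so it ignores the twist.\<close>

inductive_set twisted :: "(nat \<Rightarrow> 'a \<Rightarrow> complex) \<Rightarrow> nat \<Rightarrow> ((nat \<Rightarrow> real) \<Rightarrow> 'a \<Rightarrow> complex) set"
  for X n where
  monom: "(\<lambda>\<theta> x. c * (\<Prod>i<n. (X i x * cis (\<theta> i)) powi k i)) \<in> twisted X n"
| add: "F \<in> twisted X n \<Longrightarrow> G \<in> twisted X n \<Longrightarrow> (\<lambda>\<theta> x. F \<theta> x + G \<theta> x) \<in> twisted X n"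

lemma twisted_const: "(\<lambda>\<theta> x. c) \<in> twisted X n"
  using twisted.monom[where c=c and X=X and n=n and k="\<lambda>i. 0"] by simp

lemma twisted_single:
  assumes "j < n"
  shows "(\<lambda>\<theta> x. (X j x * cis (\<theta> j)) powi m) \<in> twisted X n"
proof -
  have "(\<Prod>i<n. f i powi (if i = j then m else 0)) = f j powi m" for f :: "nat \<Rightarrow> complex"
    using assms by (simp add: if_distrib[of "\<lambda>e. _ powi e"] cong: if_cong)
  then show ?thesis
    using twisted.monom[where c=1 and X=X and n=n and k="\<lambda>i. if i = j then m else 0"] by simp
qed

lemma twisted_sum:
  "finite A \<Longrightarrow> (\<And>j. j \<in> A \<Longrightarrow> F j \<in> twisted X n) \<Longrightarrow> (\<lambda>\<theta> x. \<Sum>j\<in>A. F j \<theta> x) \<in> twisted X n"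
  by (induction A rule: finite_induct) (auto intro: twisted.add simp: twisted_const)

lemma twisted_mult:
  assumes X: "\<And>i. i < n \<Longrightarrow> character (X i)"
  assumes "F \<in> twisted X n" "G \<in> twisted X n"
  shows "(\<lambda>\<theta> x. F \<theta> x * G \<theta> x) \<in> twisted X n"
  using assms(2,3)
proof (induction arbitrary: G)
  case (monom c k)
  from monom show ?case
  proof (induction)
    case (monom c' k')
    have "(\<Prod>i<n. (X i x * cis (\<theta> i)) powi (k i + k' i)) =
        (\<Prod>i<n. (X i x * cis (\<theta> i)) powi k i) * (\<Prod>i<n. (X i x * cis (\<theta> i)) powi k' i)" for \<theta> x
      unfolding prod.distrib[symmetric]
      by (intro prod.cong refl power_int_add) (use X character_nonzero in auto)
    then show ?case
      using twisted.monom[where c="c * c'" and X=X and n=n and k="\<lambda>i. k i + k' i"] by (simp add: mult_ac)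
  next
    case (add F G)
    then show ?case by (simp add: distrib_left twisted.add)
  qed
next
  case (add F F')
  then show ?case by (simp add: distrib_right twisted.add)
qed

lemma twisted_power:
  assumes "\<And>i. i < n \<Longrightarrow> character (X i)" "F \<in> twisted X n"
  shows "(\<lambda>\<theta> x. F \<theta> x ^ m) \<in> twisted X n"
proof (induction m)
  case 0
  then show ?case by (simp add: twisted_const)
next
  case (Suc m)
  then show ?case using twisted_mult[OF assms(1) assms(2) Suc] by simp
qed

lemma twisted_integral:
  assumes X: "char_indep X n" and "F \<in> twisted X n"
  shows "(\<forall>\<theta>. cts (F \<theta>)) \<and> (\<forall>\<theta> \<theta>'. (\<integral>x. F \<theta> x \<partial>\<mu>) = (\<integral>x. F \<theta>' x \<partial>\<mu>))"
  using assms(2)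
proof (induction)
  case (monom c k)
  have ch: "\<And>i. i < n \<Longrightarrow> character (X i)" using X by (simp add: char_indep_def)
  have split: "c * (\<Prod>i<n. (X i x * cis (\<theta> i)) powi k i) = c * (\<Prod>i<n. cis (\<theta> i) powi k i) * char_prod X n k x" for \<theta> x
    by (simp add: char_prod_def power_int_mult_distrib prod.distrib)
  have cp: "character (char_prod X n k)" by (intro character_char_prod ch)
  then have "cts (char_prod X n k)" by (rule character_cts)
  then have 1: "cts (\<lambda>x. c * (\<Prod>i<n. (X i x * cis (\<theta> i)) powi k i))" for \<theta>
    unfolding split by (intro continuous_on_mult continuous_on_const)
  have 2: "(\<integral>x. c * (\<Prod>i<n. (X i x * cis (\<theta> i)) powi k i) \<partial>\<mu>) = (if \<forall>x. char_prod X n k x = 1 then c else 0)" for \<theta>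
  proof (cases "\<forall>x. char_prod X n k x = 1")
    case True
    then have "\<forall>i<n. k i = 0" using X by (simp add: char_indep_def)
    then show ?thesis using True prob_space unfolding split by simp
  next
    case False
    then obtain a where "char_prod X n k a \<noteq> 1" by blast
    from integral_character[OF cp this] show ?thesis unfolding split if_not_P[OF False] by simp
  qed
  show ?case using 1 2 by simp
next
  case (add F G)
  then show ?case
    by (auto simp: integrable_continuous intro: continuous_on_add intro!: arg_cong2[where f="(+)"])
qed

text \<open>For \<open>R \<theta>\<close>, the squared modulus of \<open>1\<close> plus the sum of
  the twisted characters, no power moment depends on the twist. The moments determine the maximum,
  so twisting by \<open>- \<theta>\<close> gives the same maximum as no twist, namely
  \<open>(n + 1)\<^sup>2\<close>. At a point where it is attained all twisted characters equal
  \<open>1\<close>.\<close>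

theorem char_indep_surj:
  assumes X: "char_indep X n"
  obtains x where "\<And>j. j < n \<Longrightarrow> X j x = cis (\<theta> j)"
proof -
  have ch: "\<And>i. i < n \<Longrightarrow> character (X i)" using X by (simp add: char_indep_def)
  define z where "z = (\<lambda>\<theta> x i. X i x * cis (\<theta> i))"
  define R where "R = (\<lambda>\<theta> x. (norm (1 + (\<Sum>i<n. z \<theta> x i)))\<^sup>2)"
  have nz: "norm (z \<theta> x i) = 1" if "i < n" for \<theta> x i
    using character_norm[OF ch[OF that], of x] by (simp add: z_def norm_mult)
  have R_alt: "complex_of_real (R \<theta> x) = (1 + (\<Sum>i<n. z \<theta> x i powi 1)) * (1 + (\<Sum>i<n. z \<theta> x i powi (-1)))" for \<theta> x
    unfolding R_def complex_norm_square
    using nz norm_eq_1_imp_cnj_eq_inverse by (simp add: power_int_minus)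
  have tw_sum: "(\<lambda>\<theta> x. \<Sum>i<n. z \<theta> x i powi m) \<in> twisted X n" for m
    unfolding z_def by (intro twisted_sum twisted_single) auto
  have tw: "(\<lambda>\<theta> x. complex_of_real (R \<theta> x) ^ N) \<in> twisted X n" for N
    unfolding R_alt
    by (intro twisted_power twisted_mult ch twisted.add twisted_const tw_sum)
  have cR: "continuous_on UNIV (R \<theta>)" for \<theta>
  proof -
    have "cts (\<lambda>x. complex_of_real (R \<theta> x) ^ 1)" using twisted_integral[OF X tw[of 1]] by blast
    then have "continuous_on UNIV (\<lambda>x. Re (complex_of_real (R \<theta> x) ^ 1))" by (intro continuous_on_Re)
    then show ?thesis by simp
  qed
  have int_eq: "(\<integral>x. R \<theta> x ^ N \<partial>\<mu>) = (\<integral>x. R \<theta>' x ^ N \<partial>\<mu>)" for \<theta> \<theta>' N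
  proof -
    have "complex_of_real (\<integral>x. R \<theta> x ^ N \<partial>\<mu>) = (\<integral>x. complex_of_real (R \<theta> x) ^ N \<partial>\<mu>)" for \<theta>
      by (simp flip: of_real_power)
    then show ?thesis using twisted_integral[OF X tw[of N]] by (metis of_real_eq_iff)
  qed
  have R_nonneg: "R \<theta> x \<ge> 0" for \<theta> x by (simp add: R_def)
  define S where "S = (real n + 1)\<^sup>2"
  have R_le: "R \<theta> x \<le> S" for \<theta> x
  proof -
    have "norm (\<Sum>i<n. z \<theta> x i) \<le> (\<Sum>i<n. 1)" using nz by (intro sum_norm_le) auto
    then have "norm (1 + (\<Sum>i<n. z \<theta> x i)) \<le> real n + 1"
      using norm_triangle_ineq[of 1 "\<Sum>i<n. z \<theta> x i"] by simp
    then show ?thesis unfolding R_def S_def by (intro power_mono) auto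
  qed
  define \<theta>' where "\<theta>' = (\<lambda>i. - \<theta> i)"
  obtain x where x: "\<And>y. R \<theta>' y \<le> R \<theta>' x"
    using continuous_attains_sup[OF compact_UNIV _ cR[of \<theta>']] by auto
  have "R \<theta>' x = S"
  proof (rule ccontr)
    assume "R \<theta>' x \<noteq> S"
    define s where "s = R \<theta>' x"
    define t where "t = (s + S) / 2"
    have st: "0 \<le> s" "s < t" "t < S"
      using R_nonneg[of \<theta>' x] R_le[of \<theta>' x] \<open>R \<theta>' x \<noteq> S\<close> by (auto simp: s_def t_def)
    define U where "U = R (\<lambda>i. 0) -` {t<..}"
    have "open U" unfolding U_def by (rule open_vimage[OF open_greaterThan cR])
    have "R (\<lambda>i. 0) 0 = S"
    proof -
      have "(\<Sum>i<n. z (\<lambda>i. 0) 0 i) = of_nat n" by (simp add: z_def character_0[OF ch])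
      then have "1 + (\<Sum>i<n. z (\<lambda>i. 0) 0 i) = complex_of_real (real n + 1)" by simp
      then show ?thesis unfolding R_def S_def by (simp only: norm_of_real)
    qed
    then have "0 \<in> U" using st by (simp add: U_def)
    have mU: "measure \<mu> U > 0" by (rule measure_open_pos[OF \<open>open U\<close> \<open>0 \<in> U\<close>])
    \<comment> \<open>If the maximum \<open>s\<close> for the twist were below \<open>S\<close>,
      then for \<open>t\<close> strictly between them the common moments would be at least
      \<open>t ^ N * measure \<mu> U\<close> and at most \<open>s ^ N\<close>, which is impossible
      for large \<open>N\<close>.\<close>
    have le: "t ^ N * measure \<mu> U \<le> s ^ N" for N
    proof -
      have "t ^ N * measure \<mu> U = (\<integral>y. t ^ N * indicator U y \<partial>\<mu>)"
        using \<open>open U\<close> by (simp add: space_eq sets_eq)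
      also have "\<dots> \<le> (\<integral>y. R (\<lambda>i. 0) y ^ N \<partial>\<mu>)"
      proof (rule integral_mono)
        show "integrable \<mu> (\<lambda>y. t ^ N * indicator U y)"
          using \<open>open U\<close> by (intro integrable_mult_right integrable_real_indicator)
            (auto simp: sets_eq less_top[symmetric])
        show "integrable \<mu> (\<lambda>y. R (\<lambda>i. 0) y ^ N)"
          by (intro integrable_continuous continuous_on_power cR)
        show "t ^ N * indicator U y \<le> R (\<lambda>i. 0) y ^ N" for y
          using st R_nonneg[of "\<lambda>i. 0" y] by (auto simp: U_def indicator_def intro!: power_mono)
      qed
      also have "\<dots> = (\<integral>y. R \<theta>' y ^ N \<partial>\<mu>)" by (rule int_eq)
      also have "\<dots> \<le> s ^ N"
      proof -
        have "norm (\<integral>y. R \<theta>' y ^ N \<partial>\<mu>) \<le> s ^ N"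
          using x R_nonneg unfolding s_def
          by (intro norm_integral_le continuous_on_power cR) (auto intro!: power_mono)
        then show ?thesis by simp
      qed
      finally show ?thesis .
    qed
    have "measure \<mu> U \<le> (s / t) ^ N" for N
      using le[of N] st by (simp add: power_divide field_simps)
    moreover have "(\<lambda>N. (s / t) ^ N) \<longlonglongrightarrow> 0"
      using st by (intro LIMSEQ_power_zero) auto
    ultimately have "measure \<mu> U \<le> 0" by (intro LIMSEQ_le_const) auto
    with mU show False by simp
  qed
  then have "norm (1 + (\<Sum>i<n. z \<theta>' x i)) = real n + 1"
    unfolding R_def S_def by (simp add: power2_eq_iff_nonneg)
  then have "z \<theta>' x j = 1" if "j < n" for j
    using norm_one_plus_sum_eq_imp[of n "z \<theta>' x" j] nz that by blast
  then have "X j x = cis (\<theta> j)" if "j < n" for j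
    using that by (fastforce simp: z_def \<theta>'_def cis_mult field_simps simp flip: cis_inverse)
  then show ?thesis using that by blast
qed

end

lemma ex_open_add_diff:
  fixes x :: "'a::topological_ab_group_add"
  assumes "open V" "x \<in> V"
  obtains A B where "open A" "open B" "0 \<in> A" "0 \<in> B" "\<And>a b. a \<in> A \<Longrightarrow> b \<in> B \<Longrightarrow> x + a - b \<in> V"
proof -
  have "continuous_on UNIV (\<lambda>p::'a \<times> 'a. x + fst p - snd p)" by (intro continuous_intros)
  then have "open ((\<lambda>p. x + fst p - snd p) -` V)" by (rule open_vimage[OF assms(1)])
  moreover have "(0, 0) \<in> (\<lambda>p. x + fst p - snd p) -` V" using assms(2) by simp
  ultimately obtain A B where "open A" "open B" "(0, 0) \<in> A \<times> B" "A \<times> B \<subseteq> (\<lambda>p. x + fst p - snd p) -` V"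
    by (rule open_prod_elim)
  then show ?thesis using that by fastforce
qed

text \<open>The Lebesgue number of a cover, with a neighbourhood \<open>W\<close> of
  \<open>0\<close> in place of a distance.\<close>

lemma Lebesgue_neighbourhood:
  fixes \<V> :: "'a::topological_ab_group_add set set"
  assumes "compact (UNIV :: 'a set)" "\<And>V. V \<in> \<V> \<Longrightarrow> open V" "\<Union>\<V> = UNIV"
  obtains W where "open W" "0 \<in> W" "\<And>x. \<exists>V\<in>\<V>. \<forall>w\<in>W. x - w \<in> V"
proof -
  have "\<exists>V A B. V \<in> \<V> \<and> open A \<and> open B \<and> 0 \<in> A \<and> 0 \<in> B \<and> (\<forall>a\<in>A. \<forall>b\<in>B. x + a - b \<in> V)" for x
  proof -
    obtain V where "V \<in> \<V>" "x \<in> V" using assms(3) by blast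
    with ex_open_add_diff[OF assms(2)[OF \<open>V \<in> \<V>\<close>] \<open>x \<in> V\<close>] show ?thesis by metis
  qed
  then obtain V A B where VAB: "\<And>x. V x \<in> \<V>" "\<And>x. open (A x)" "\<And>x. open (B x)" "\<And>x. 0 \<in> A x" "\<And>x. 0 \<in> B x"
    "\<And>x a b. a \<in> A x \<Longrightarrow> b \<in> B x \<Longrightarrow> x + a - b \<in> V x"
    by metis
  have op: "open ((\<lambda>y. y - x) -` A x)" for x
    by (rule open_vimage[OF VAB(2)]) (intro continuous_intros)
  obtain F where F: "finite F" "UNIV \<subseteq> (\<Union>x\<in>F. (\<lambda>y. y - x) -` A x)"
    by (rule compactE_image[OF assms(1), of UNIV "\<lambda>x. (\<lambda>y. y - x) -` A x"]) (use op VAB(4) in auto)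
  have "\<exists>V\<in>\<V>. \<forall>w\<in>(\<Inter>x\<in>F. B x). y - w \<in> V" for y
  proof -
    obtain x where x: "x \<in> F" "y - x \<in> A x" using F(2) by blast
    have "y - w \<in> V x" if "w \<in> (\<Inter>x\<in>F. B x)" for w
      using VAB(6)[OF x(2), of w] that x(1) by simp
    then show ?thesis using VAB(1) by blast
  qed
  moreover have "open (\<Inter>x\<in>F. B x)" using F(1) VAB(3) by (intro open_INT) auto
  ultimately show ?thesis using that VAB(5) by blast
qed

text \<open>The vertices of a grid simplex differ from its base by sums of distinct grid steps;
  steps taken in \<open>W'\<close> keep all these differences in \<open>W\<close>.\<close>

lemma ex_small_sums:
  fixes W :: "'a::topological_ab_group_add set" and n :: nat
  assumes "open W" "0 \<in> W"
  shows "\<exists>W'. open W' \<and> 0 \<in> W' \<and> (\<forall>J f. J \<subseteq> {..<n} \<and> (\<forall>j<n. f j \<in> W') \<longrightarrow> (\<Sum>j\<in>J. f j) \<in> W)"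
  using assms
proof (induction n arbitrary: W)
  case 0
  then show ?case by (intro exI[of _ W]) auto
next
  case (Suc n)
  obtain A B where AB: "open A" "open B" "0 \<in> A" "0 \<in> B" "\<And>a b. a \<in> A \<Longrightarrow> b \<in> B \<Longrightarrow> 0 + a - b \<in> W"
    using ex_open_add_diff[OF Suc.prems] by metis
  have "open (uminus -` B)" using AB(2) by (rule open_vimage) (intro continuous_intros)
  moreover have "0 \<in> uminus -` B" using AB(4) by simp
  ultimately obtain C where C: "open C" "0 \<in> C"
    "\<And>J f. J \<subseteq> {..<n} \<Longrightarrow> (\<forall>j<n. f j \<in> C) \<Longrightarrow> (\<Sum>j\<in>J. f j) \<in> uminus -` B"
    using Suc.IH by meson
  have "(\<Sum>j\<in>J. f j) \<in> W" if J: "J \<subseteq> {..<Suc n}" and f: "\<forall>j<Suc n. f j \<in> A \<inter> C" for J f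
  proof -
    have fin: "finite J" using J finite_subset by blast
    have "(\<Sum>j\<in>J. f j) = (if n \<in> J then f n else 0) + (\<Sum>j\<in>J - {n}. f j)"
      using fin by (simp add: sum.remove)
    moreover have "(if n \<in> J then f n else 0) \<in> A" using f AB(3) by simp
    moreover have "(\<Sum>j\<in>J - {n}. f j) \<in> uminus -` B"
      using J f by (intro C(3)) (auto simp: less_Suc_eq)
    ultimately show ?thesis
      using AB(5)[of "if n \<in> J then f n else 0" "- (\<Sum>j\<in>J - {n}. f j)"] by simp
  qed
  then show ?case using AB(1,3) C(1,2) by (intro exI[of _ "A \<inter> C"]) auto
qed

context compact_haar_group
begin

text \<open>Openness at \<open>0\<close> of the homomorphism into the torus given by the characters.
  Off \<open>K + W\<close>, where \<open>K\<close> is its kernel, compactness keeps the values away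
  from the identity; a lift of a value close to the identity therefore lies in \<open>K + W\<close>
  and can be corrected by an element of \<open>K\<close>.\<close>

lemma char_indep_lift_small:
  assumes X: "char_indep X n" and W: "open W" "0 \<in> W"
  obtains \<delta> where "\<delta> > 0"
    "\<And>\<theta>. (\<And>j. j < n \<Longrightarrow> norm (cis (\<theta> j) - 1) < \<delta>) \<Longrightarrow> \<exists>w\<in>W. \<forall>j<n. X j w = cis (\<theta> j)"
proof -
  have ch: "\<And>i. i < n \<Longrightarrow> character (X i)" using X by (simp add: char_indep_def)
  define K where "K = {k. \<forall>j<n. X j k = 1}"
  define C where "C = - (\<Union>k\<in>K. (\<lambda>x. x - k) -` W)"
  have "open ((\<lambda>x. x - k) -` W)" for k
    by (rule open_vimage[OF W(1)]) (intro continuous_intros)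
  then have "closed C" unfolding C_def by (intro closed_Compl open_UN) auto
  then have C: "compact C" using compact_Int_closed[OF compact_UNIV] by simp
  define g where "g x = (\<Sum>j<n. norm (X j x - 1))" for x
  have cg: "continuous_on UNIV g"
    unfolding g_def by (intro continuous_intros character_cts[OF ch]) auto
  have pos: "g x > 0" if "x \<in> C" for x
  proof (rule ccontr)
    assume "\<not> g x > 0"
    moreover have "g x \<ge> 0" unfolding g_def by (intro sum_nonneg) auto
    ultimately have "g x = 0" by simp
    then have "x \<in> K" unfolding g_def K_def by (simp add: sum_nonneg_eq_0_iff)
    then have "x \<notin> C" using W(2) unfolding C_def by (auto intro!: bexI[of _ x])
    with that show False by simp
  qed
  obtain e where e: "e > 0" "\<And>x. x \<in> C \<Longrightarrow> e \<le> g x"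
  proof (cases "C = {}")
    case True
    then show ?thesis using that[of 1] by simp
  next
    case False
    then obtain x where "x \<in> C" "\<forall>y\<in>C. g x \<le> g y"
      using continuous_attains_inf[OF C False continuous_on_subset[OF cg]] by auto
    then show ?thesis using that[of "g x"] pos by simp
  qed
  define \<delta> where "\<delta> = e / (real n + 1)"
  have "\<delta> > 0" using e(1) by (simp add: \<delta>_def)
  have "\<exists>w\<in>W. \<forall>j<n. X j w = cis (\<theta> j)" if small: "\<And>j. j < n \<Longrightarrow> norm (cis (\<theta> j) - 1) < \<delta>" for \<theta>
  proof -
    obtain x where x: "\<And>j. j < n \<Longrightarrow> X j x = cis (\<theta> j)" using char_indep_surj[OF X] by blast
    have "g x \<le> (\<Sum>j<n. \<delta>)" unfolding g_def using x small by (intro sum_mono) (simp add: less_imp_le)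
    also have "\<dots> < e" using e(1) by (simp add: \<delta>_def field_simps)
    finally have "x \<notin> C" using e(2) by fastforce
    then obtain k where k: "k \<in> K" "x - k \<in> W" unfolding C_def by auto
    have "X j (x - k) = cis (\<theta> j)" if "j < n" for j
      using character_diff[OF ch[OF that], of x k] x[OF that] k(1) that by (simp add: K_def)
    with k(2) show ?thesis by blast
  qed
  with \<open>\<delta> > 0\<close> show ?thesis using that by blast
qed

text \<open>Lebesgue's covering argument with the cube replaced by a fine grid in the group: the grid is
  spanned by small elements lifted through \<open>(X 0, ..., X (n - 1))\<close>, the faces of the cube are
  the sets where a character is \<open>1\<close> or \<open>\<i>\<close>, and Kuhn's lemma yields \<open>n + 1\<close> members of the
  refinement with a common point.\<close>

theorem char_indep_le_dim:
  assumes dim: "covering_dim_le (euclidean :: 'a topology) d" and X: "char_indep X n"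
  shows "n \<le> d"
proof -
  have ch: "\<And>i. i < n \<Longrightarrow> character (X i)" using X by (simp add: char_indep_def)
  \<comment> \<open>In every coordinate \<open>j\<close>, a member of this cover avoids one of the
    two opposite faces: the one with value \<open>1\<close> if \<open>j \<in> P\<close>, the one
    with value \<open>\<i>\<close> otherwise.\<close>
  define U where "U P = (\<Inter>j\<in>{..<n}. X j -` (- {if j \<in> P then 1 else \<i>}))" for P
  define \<U> where "\<U> = U ` Pow {..<n}"
  have "finite \<U>" by (simp add: \<U>_def)
  moreover have "open (U P)" for P
    unfolding U_def by (intro open_INT ballI open_vimage character_cts ch) auto
  then have "\<forall>V\<in>\<U>. openin euclidean V" by (simp add: \<U>_def)
  moreover have "\<Union>\<U> = topspace euclidean"
  proof -
    have 1: "x \<in> U {j\<in>{..<n}. X j x \<noteq> 1}" for x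
      by (auto simp: U_def)
    have 2: "U {j\<in>{..<n}. X j x \<noteq> 1} \<in> \<U>" for x by (auto simp: \<U>_def)
    have "x \<in> \<Union>\<U>" for x by (rule UnionI[OF 2 1])
    then have "\<Union>\<U> = UNIV" by (intro UNIV_eq_I[symmetric])
    then show ?thesis by simp
  qed
  ultimately have H: "finite \<U> \<and> (\<forall>U\<in>\<U>. openin euclidean U) \<and> \<Union>\<U> = topspace euclidean"
    by (intro conjI)
  from dim[unfolded covering_dim_le_def, THEN spec, THEN mp, OF H] obtain \<V> where "finite \<V>" "\<forall>V\<in>\<V>. openin euclidean V" "\<Union>\<V> = topspace euclidean"
    "\<forall>V\<in>\<V>. \<exists>U\<in>\<U>. V \<subseteq> U" "\<forall>x\<in>topspace euclidean. card {V \<in> \<V>. x \<in> V} \<le> d + 1"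
    by (elim exE conjE)
  then have \<V>: "finite \<V>" "\<forall>V\<in>\<V>. open V" "\<Union>\<V> = UNIV" "\<forall>V\<in>\<V>. \<exists>U\<in>\<U>. V \<subseteq> U"
    "\<forall>x. card {V \<in> \<V>. x \<in> V} \<le> d + 1"
    by simp_all
  obtain W where W: "open W" "0 \<in> W" "\<And>x. \<exists>V\<in>\<V>. \<forall>w\<in>W. x - w \<in> V"
    using Lebesgue_neighbourhood[OF compact_UNIV, of \<V>] \<V>(2,3) by blast
  obtain v where v: "\<And>x. v x \<in> \<V>" "\<And>x w. w \<in> W \<Longrightarrow> x - w \<in> v x" using W(3) by metis
  have v_self: "x \<in> v x" for x using v(2)[OF W(2), of x] by simp
  from ex_small_sums[OF W(1,2), of n] obtain W' where W': "open W'" "0 \<in> W'"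
    "\<forall>J f. J \<subseteq> {..<n} \<and> (\<forall>j<n. f j \<in> W') \<longrightarrow> (\<Sum>j\<in>J. f j) \<in> W"
    by (elim exE conjE)
  obtain \<delta> where \<delta>: "\<delta> > 0"
    "\<And>\<theta>. (\<And>j. j < n \<Longrightarrow> norm (cis (\<theta> j) - 1) < \<delta>) \<Longrightarrow> \<exists>w\<in>W'. \<forall>j<n. X j w = cis (\<theta> j)"
    using char_indep_lift_small[OF X W'(1,2)] by blast
  have "((\<lambda>p. cis (pi / (2 * real (Suc p)))) \<longlongrightarrow> cis 0) sequentially"
  proof (intro isCont_tendsto_compose[of 0 cis])
    show "isCont cis 0"
      using continuous_on_cis[of UNIV "\<lambda>x. x"] by (simp add: continuous_on_eq_continuous_at)
    show "(\<lambda>p. pi / (2 * real (Suc p))) \<longlonglongrightarrow> 0"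
      using LIMSEQ_Suc[OF lim_const_over_n[of "pi / 2"]] by (simp add: field_simps)
  qed
  from tendstoD[OF this \<delta>(1)] obtain p0 where "dist (cis (pi / (2 * real (Suc p0)))) (cis 0) < \<delta>"
    unfolding eventually_sequentially by blast
  \<comment> \<open>The grid has \<open>p\<close> steps per direction, each turning one character by
    \<open>pi / (2 p)\<close>; after \<open>p\<close> steps a quarter circle has led from the face
    \<open>1\<close> to the face \<open>\<i>\<close>.\<close>
  then obtain p where p: "p > 0" "norm (cis (pi / (2 * real p)) - 1) < \<delta>"
    by (intro that[of "Suc p0"]) (auto simp: dist_norm)
  have "\<exists>w\<in>W'. \<forall>i<n. X i w = cis (if i = j then pi / (2 * real p) else 0)" for j
    by (rule \<delta>(2)) (use p(2) \<delta>(1) in auto)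
  then obtain y where y: "\<And>j. y j \<in> W'" "\<And>i j. i < n \<Longrightarrow> X i (y j) = cis (if i = j then pi / (2 * real p) else 0)"
    by metis
  define g where "g q = (\<Sum>j<n. \<Sum>k<q j. y j)" for q :: "nat \<Rightarrow> nat"
  have X_g: "X i (g q) = cis (real (q i) * (pi / (2 * real p)))" if "i < n" for i q
  proof -
    have "X i (g q) = (\<Prod>j<n. X i (y j) ^ q j)"
      by (simp add: g_def character_sum[OF ch[OF that]])
    also have "\<dots> = (\<Prod>j<n. if i = j then cis (pi / (2 * real p)) ^ q j else 1)"
      by (intro prod.cong) (auto simp: y(2)[OF that])
    also have "\<dots> = cis (pi / (2 * real p)) ^ q i" using that by simp
    finally show ?thesis by (simp only: Complex.DeMoivre)
  qed
  \<comment> \<open>The label tells whether the chosen member meets the face \<open>1\<close> in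
    direction \<open>j\<close>. A grid point on that face gets \<open>0\<close>; for a point on the
    face \<open>\<i>\<close> the member must avoid the face \<open>1\<close>, which gives
    \<open>1\<close>. These are Kuhn's boundary conditions.\<close>
  define lab where "lab V j = (if \<exists>x\<in>V. X j x = 1 then 0 else (1::nat))" for V j
  have "odd (card {s. ksimplex p n s \<and> (reduced n \<circ> (\<lambda>q. lab (v (g q)))) ` s = {..n}})"
  proof (rule kuhn_combinatorial[OF p(1)]; intro allI impI; elim conjE)
    fix q :: "nat \<Rightarrow> nat" and j assume "j < n"
    {
      assume "q j = 0"
      then have "X j (g q) = 1" using X_g[OF \<open>j < n\<close>] by simp
      then show "lab (v (g q)) j = 0" using v_self unfolding lab_def by auto
    next
      assume "q j = p"
      then have "real (q j) * (pi / (2 * real p)) = pi / 2" using p(1) by simp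
      then have i: "X j (g q) = \<i>" by (simp only: X_g[OF \<open>j < n\<close>] cis_pi_half)
      obtain P where "v (g q) \<subseteq> U P" using \<V>(4) v(1) unfolding \<U>_def by blast
      then have "X j x \<noteq> (if j \<in> P then 1 else \<i>)" if "x \<in> v (g q)" for x
        using that \<open>j < n\<close> unfolding U_def by blast
      then show "lab (v (g q)) j = 1"
        using v_self[of "g q"] i unfolding lab_def by metis
    }
  qed
  then have "{s. ksimplex p n s \<and> (reduced n \<circ> (\<lambda>q. lab (v (g q)))) ` s = {..n}} \<noteq> {}"
    by (rule odd_card_imp_not_empty)
  then obtain s base upd where s: "kuhn_simplex p n base upd s" "(reduced n \<circ> (\<lambda>q. lab (v (g q)))) ` s = {..n}"
    by (auto elim: ksimplex.cases)
  interpret kuhn_simplex p n base upd s by (rule s(1))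
  have mem: "g base \<in> v (g q)" if q: "q \<in> s" for q
  proof -
    obtain i where i: "q = enum i" using q s_eq by auto
    define J where "J = {j\<in>{..<n}. j \<in> upd ` {..<i}}"
    have "g q = (\<Sum>j<n. (\<Sum>k<base j. y j) + (if j \<in> J then y j else 0))"
      unfolding g_def i enum_def J_def by (intro sum.cong) auto
    also have "\<dots> = g base + (\<Sum>j<n. if j \<in> J then y j else 0)"
      by (simp add: g_def sum.distrib)
    also have "(\<Sum>j<n. if j \<in> J then y j else 0) = (\<Sum>j\<in>J. y j)"
      by (simp add: sum.inter_restrict[symmetric] J_def Int_def)
    finally have "g base = g q - (\<Sum>j\<in>J. y j)" by simp
    moreover have "(\<Sum>j\<in>J. y j) \<in> W" using y(1) by (intro W'(3)[rule_format]) (auto simp: J_def)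
    ultimately show ?thesis using v(2) by simp
  qed
  let ?A = "(\<lambda>q. v (g q)) ` s" and ?B = "{V \<in> \<V>. g base \<in> V}"
  have fin: "finite ?B" using \<V>(1) by simp
  have sub: "?A \<subseteq> ?B" using mem v(1) by auto
  \<comment> \<open>The reduced label depends on the member alone, so \<open>n + 1\<close> different
    labels require at least \<open>n + 1\<close> different members.\<close>
  have "{..n} = (\<lambda>V. reduced n (lab V)) ` ?A"
    using s(2) by (simp add: image_image o_def)
  then have "Suc n = card ((\<lambda>V. reduced n (lab V)) ` ?A)" by (metis card_atMost)
  also have "\<dots> \<le> card ?A" by (rule card_image_le[OF finite_subset[OF sub fin]])
  also have "\<dots> \<le> card ?B" by (rule card_mono[OF fin sub])
  also have "\<dots> \<le> d + 1" using \<V>(5) by blast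
  finally show ?thesis by simp
qed

end

section \<open>Endomorphisms of the dual group\<close>

lemma epimorphism_id: "epimorphism (\<lambda>x. x)"
  by (simp add: epimorphism_def Modules.additive_def)

lemma epimorphism_comp:
  assumes "epimorphism S" "epimorphism T"
  shows "epimorphism (S \<circ> T)"
proof -
  have "continuous_on UNIV (S \<circ> T)"
    using assms by (intro continuous_on_compose) (auto simp: epimorphism_def intro: continuous_on_subset)
  moreover have "surj (S \<circ> T)" using assms by (intro comp_surj) (auto simp: epimorphism_def)
  ultimately show ?thesis using assms by (simp add: epimorphism_def Modules.additive_def)
qed

lemma epimorphism_funpow: "epimorphism T \<Longrightarrow> epimorphism (T ^^ n)"
  by (induction n) (auto simp: id_def epimorphism_id intro: epimorphism_comp)

text \<open>Row-vector convention: \<open>a j\<close> is the image of the \<open>j\<close>-th unit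
  vector, that is, the exponent vector of the image of the \<open>j\<close>-th basis
  character.\<close>

definition int_matrix :: "nat \<Rightarrow> (nat \<Rightarrow> nat \<Rightarrow> int) \<Rightarrow> (nat \<Rightarrow> int) \<Rightarrow> nat \<Rightarrow> int" where
  "int_matrix r a v = (\<lambda>i. \<Sum>j<r. v j * a j i)"

lemma int_linear_matrix: "int_linear (int_matrix r a)"
  by (simp add: int_linear_def int_matrix_def distrib_right sum.distrib sum_distrib_left mult.assoc)

lemma supported_matrix: "(\<And>j. j < r \<Longrightarrow> a j \<in> supported r) \<Longrightarrow> int_matrix r a v \<in> supported r"
  by (auto simp: supported_def int_matrix_def)

context compact_haar_group
begin

lemma character_comp_epimorphism: "character \<phi> \<Longrightarrow> epimorphism T \<Longrightarrow> character (\<lambda>x. \<phi> (T x))"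
  by (auto simp: epimorphism_def intro: character_comp)

lemma char_prod_truncate: "char_prod X r (\<lambda>i. if i < r then k i else 0) = char_prod X r k"
  by (auto simp: char_prod_def intro!: prod.cong)

lemma char_prod_matrix:
  assumes "\<And>i. i < r \<Longrightarrow> character (X i)"
  shows "char_prod X r (int_matrix s a v) x = (\<Prod>j<s. char_prod X r (a j) x powi v j)"
proof (induction s)
  case 0
  then show ?case by (simp add: int_matrix_def char_prod_def)
next
  case (Suc s)
  have "char_prod X r (int_matrix (Suc s) a v) x
      = char_prod X r (\<lambda>i. int_matrix s a v i + v s * a s i) x"
    by (simp add: int_matrix_def)
  also have "\<dots> = char_prod X r (int_matrix s a v) x * char_prod X r (\<lambda>i. v s * a s i) x"
    by (rule char_prod_add[OF assms])
  finally show ?case by (simp add: Suc char_prod_scale)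
qed

lemma char_prod_inj:
  assumes X: "char_indep X r" and "u \<in> supported r" "w \<in> supported r"
    and eq: "\<And>x. char_prod X r u x = char_prod X r w x"
  shows "u = w"
proof
  fix i
  have ch: "\<And>i. i < r \<Longrightarrow> character (X i)" using X by (simp add: char_indep_def)
  have nz: "char_prod X r w x \<noteq> 0" for x by (intro character_nonzero character_char_prod ch)
  have "char_prod X r (\<lambda>i. u i + (- 1) * w i) x = 1" for x
    using nz[of x] by (simp only: char_prod_add[OF ch] char_prod_scale eq) (simp add: power_int_minus)
  then have "i < r \<Longrightarrow> u i + (- 1) * w i = 0"
    using X unfolding char_indep_def by blast
  then show "u i = w i" using assms(2,3) by (cases "i < r") (auto simp: supported_def)
qed

text \<open>Surjectivity of \<open>T\<close> makes composition with \<open>T\<close> injective on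
  characters.\<close>

lemma char_indep_comp:
  assumes "char_indep X r" "epimorphism T"
  shows "char_indep (\<lambda>j x. X j (T x)) r"
proof -
  have "surj T" using assms(2) by (simp add: epimorphism_def)
  have "char_prod (\<lambda>j x. X j (T x)) r k x = char_prod X r k (T x)" for k x
    by (simp add: char_prod_def)
  moreover have "(\<forall>x. char_prod X r k (T x) = 1) \<longleftrightarrow> (\<forall>x. char_prod X r k x = 1)" for k
    using \<open>surj T\<close> by (metis surjD)
  ultimately show ?thesis
    using assms by (simp add: char_indep_def character_comp_epimorphism)
qed

text \<open>Adding \<open>\<phi>\<close> at index \<open>r\<close> forces a nontrivial relation.
  Independence of \<open>Y\<close> makes the exponent of \<open>\<phi>\<close> in it nonzero, so a
  positive power of \<open>\<phi>\<close> is a product of powers of the \<open>Y i\<close>.\<close>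

lemma char_indep_maximal:
  assumes Y: "char_indep Y r" and max: "\<And>Z. \<not> char_indep Z (Suc r)" and \<phi>: "character \<phi>"
  shows "\<exists>N>0. \<exists>k\<in>supported r. \<forall>x. \<phi> x ^ N = char_prod Y r k x"
proof -
  have ch: "\<And>i. i < r \<Longrightarrow> character (Y i)" using Y by (simp add: char_indep_def)
  define Z where "Z = Y(r := \<phi>)"
  have "\<forall>i<Suc r. character (Z i)" using ch \<phi> by (auto simp: Z_def less_Suc_eq)
  then obtain k where k: "\<And>x. char_prod Z (Suc r) k x = 1" "\<exists>i<Suc r. k i \<noteq> 0"
    using max[of Z] unfolding char_indep_def by blast
  have eq: "char_prod Y r k x * \<phi> x powi k r = 1" for x
  proof -
    have "char_prod Z (Suc r) k x = char_prod Y r k x * \<phi> x powi k r"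
      by (auto simp: char_prod_def Z_def intro!: prod.cong)
    then show ?thesis using k(1) by simp
  qed
  have "k r \<noteq> 0"
  proof
    assume "k r = 0"
    then have "\<forall>i<r. k i = 0" using eq Y unfolding char_indep_def by simp
    with \<open>k r = 0\<close> k(2) show False by (auto simp: less_Suc_eq)
  qed
  \<comment> \<open>The minus sign moves the other factors to the right-hand side; the sign of
    \<open>k r\<close> makes the exponent of \<open>\<phi>\<close> positive.\<close>
  define c where "c = - sgn (k r)"
  have "\<phi> x ^ nat \<bar>k r\<bar> = char_prod Y r (\<lambda>i. c * k i) x" for x
  proof -
    have "\<phi> x powi k r = inverse (char_prod Y r k x)" using eq[of x] by (metis inverse_unique)
    then have "(\<phi> x powi k r) powi (- c) = char_prod Y r k x powi c"
      by (simp add: power_int_minus power_int_inverse)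
    moreover have "(\<phi> x powi k r) powi (- c) = \<phi> x ^ nat \<bar>k r\<bar>"
      by (simp add: c_def power_int_mult[symmetric] abs_sgn[symmetric] del: power_int_of_nat)
        (simp add: power_int_def)
    ultimately show ?thesis by (simp add: char_prod_scale)
  qed
  then have "\<forall>x. \<phi> x ^ nat \<bar>k r\<bar> = char_prod Y r (\<lambda>i. if i < r then c * k i else 0) x"
    by (simp only: char_prod_truncate) simp
  moreover have "(\<lambda>i. if i < r then c * k i else 0) \<in> supported r" by (simp add: supported_def)
  moreover have "nat \<bar>k r\<bar> > 0" using \<open>k r \<noteq> 0\<close> by simp
  ultimately show ?thesis by blast
qed

lemma char_indep_common_multiple:
  assumes Y: "char_indep Y r" and max: "\<And>Z. \<not> char_indep Z (Suc r)"
    and "finite \<Phi>" "\<And>\<phi>. \<phi> \<in> \<Phi> \<Longrightarrow> character \<phi>"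
  shows "\<exists>N>0. \<forall>\<phi>\<in>\<Phi>. \<exists>k\<in>supported r. \<forall>x. \<phi> x ^ N = char_prod Y r k x"
  using assms(3,4)
proof (induction \<Phi> rule: finite_induct)
  case empty
  then show ?case by auto
next
  case (insert \<phi> \<Phi>)
  then obtain N where N: "N > 0" "\<And>\<psi>. \<psi> \<in> \<Phi> \<Longrightarrow> \<exists>k\<in>supported r. \<forall>x. \<psi> x ^ N = char_prod Y r k x"
    by auto
  obtain M where M: "M > 0" "\<exists>k\<in>supported r. \<forall>x. \<phi> x ^ M = char_prod Y r k x"
    using char_indep_maximal[OF Y max] insert.prems by blast
  have scale: "\<exists>k\<in>supported r. \<forall>x. \<psi> x ^ (a * b) = char_prod Y r k x"
    if k: "\<exists>k\<in>supported r. \<forall>x. \<psi> x ^ a = char_prod Y r k x" for \<psi> :: "'a \<Rightarrow> complex" and a b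
  proof -
    obtain k where "k \<in> supported r" "\<forall>x. \<psi> x ^ a = char_prod Y r k x" using k by blast
    then show ?thesis
      by (intro bexI[of _ "\<lambda>i. int b * k i"]) (auto simp: power_mult char_prod_scale supported_def)
  qed
  show ?case
  proof (intro exI[of _ "N * M"] conjI ballI)
    fix \<psi> assume "\<psi> \<in> insert \<phi> \<Phi>"
    then consider "\<psi> = \<phi>" | "\<psi> \<in> \<Phi>" by blast
    then show "\<exists>k\<in>supported r. \<forall>x. \<psi> x ^ (N * M) = char_prod Y r k x"
    proof cases
      case 1
      then show ?thesis using scale[OF M(2), of N] by (simp add: mult.commute)
    next
      case 2
      then show ?thesis using scale[OF N(2), of \<psi> M] by simp
    qed
  qed (use N M in simp)
qed

text \<open>\<open>M\<close> is \<open>N\<close> times the dual map. The characters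
  \<open>X j\<close> composed with \<open>T\<close> again form an independent system of maximal
  size, so suitable multiples of the \<open>X j\<close> are expressible in it; this gives
  \<open>M'\<close>, an inverse of the dual map up to the factor \<open>D\<close>, and
  \<open>d = N * D\<close>.\<close>

lemma ex_matrix_of_epimorphism:
  assumes X: "char_indep X r" and max: "\<And>Z. \<not> char_indep Z (Suc r)" and T: "epimorphism T"
    and N: "N > 0" "\<And>j. j < r \<Longrightarrow> \<exists>k\<in>supported r. \<forall>x. X j (T x) ^ N = char_prod X r k x"
  obtains M M' and d :: int where "int_linear M" "\<And>v. M v \<in> supported r" "int_linear M'" "d \<noteq> 0"
    "\<And>v. v \<in> supported r \<Longrightarrow> M' (M v) = (\<lambda>i. d * v i)"
    "\<And>v x. char_prod X r (M v) x = char_prod X r v (T x) ^ N"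
proof -
  have ch: "\<And>i. i < r \<Longrightarrow> character (X i)" using X by (simp add: char_indep_def)
  note Y = char_indep_comp[OF X T]
  have Y_prod: "char_prod (\<lambda>j x. X j (T x)) r k x = char_prod X r k (T x)" for k x
    by (simp add: char_prod_def)
  have "\<exists>D>0. \<forall>\<phi>\<in>X ` {..<r}. \<exists>k\<in>supported r. \<forall>x. \<phi> x ^ D = char_prod (\<lambda>j x. X j (T x)) r k x"
    by (rule char_indep_common_multiple[OF Y max]) (use ch in auto)
  then obtain D where D: "D > 0" "\<And>j. j < r \<Longrightarrow> \<exists>k\<in>supported r. \<forall>x. X j x ^ D = char_prod X r k (T x)"
    by (auto simp: Y_prod)
  obtain a where a: "\<And>j. j < r \<Longrightarrow> a j \<in> supported r" "\<And>j x. j < r \<Longrightarrow> X j (T x) ^ N = char_prod X r (a j) x"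
    using N(2) by metis
  obtain b where b: "\<And>j. j < r \<Longrightarrow> b j \<in> supported r" "\<And>j x. j < r \<Longrightarrow> X j x ^ D = char_prod X r (b j) (T x)"
    using D(2) by metis
  have swap: "(\<Prod>j<r. (f j ^ n) powi v j) = (\<Prod>j<r. f j powi v j) ^ n" for f :: "nat \<Rightarrow> complex" and n v
    by (simp add: prod_power_distrib power_int_power power_int_power' mult.commute)
  have matrix: "char_prod X r (int_matrix r c v) x = (\<Prod>j<r. char_prod X r (c j) x powi v j)" for c v x
    by (rule char_prod_matrix) (rule ch)
  have M: "char_prod X r (int_matrix r a v) x = char_prod X r v (T x) ^ N" for v x
    unfolding matrix char_prod_def[of X r v] swap[symmetric]
    by (intro prod.cong refl arg_cong2[where f="(powi)"]) (simp_all add: a(2))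
  have M': "char_prod X r (int_matrix r b v) (T x) = char_prod X r v x ^ D" for v x
    unfolding matrix char_prod_def[of X r v] swap[symmetric]
    by (intro prod.cong refl arg_cong2[where f="(powi)"]) (simp_all add: b(2))
  have inv: "int_matrix r b (int_matrix r a v) = (\<lambda>i. int (N * D) * v i)" if v: "v \<in> supported r" for v
  proof (rule char_prod_inj[OF X])
    show "int_matrix r b (int_matrix r a v) \<in> supported r" by (rule supported_matrix[OF b(1)])
    show "(\<lambda>i. int (N * D) * v i) \<in> supported r" using v by (auto simp: supported_def)
    fix y
    obtain x where "y = T x" using T unfolding epimorphism_def by (metis surjD)
    then show "char_prod X r (int_matrix r b (int_matrix r a v)) y = char_prod X r (\<lambda>i. int (N * D) * v i) y"
      by (simp only: M' M char_prod_scale power_int_of_nat power_mult)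
  qed
  show ?thesis
    by (rule that[OF int_linear_matrix supported_matrix[OF a(1)] int_linear_matrix _ inv M]) (use N(1) D(1) in auto)
qed

text \<open>Every application of \<open>M\<close> costs one factor \<open>N\<close>, so the exponent
  \<open>N ^ n\<close> depends only on the number of steps and is shared by all maps treated with
  the same \<open>N\<close>.\<close>

lemma char_prod_funpow:
  assumes "\<And>v x. char_prod X r (M v) x = char_prod X r v (T x) ^ N"
  shows "char_prod X r ((M ^^ n) v) x = char_prod X r v ((T ^^ n) x) ^ (N ^ n)"
proof (induction n arbitrary: x)
  case (Suc n)
  have "char_prod X r ((M ^^ Suc n) v) x = (char_prod X r v ((T ^^ n) (T x)) ^ (N ^ n)) ^ N"
    by (simp add: assms Suc)
  also have "\<dots> = char_prod X r v ((T ^^ n) (T x)) ^ (N ^ Suc n)"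
    by (simp only: power_mult[symmetric]) (simp add: mult.commute)
  finally show ?case by (simp add: funpow_swap1)
qed simp

end

section \<open>The connected finite-dimensional case\<close>

locale finite_dim_haar_group = compact_haar_group \<mu> for \<mu> :: "'a::{topological_ab_group_add, t2_space} measure" +
  assumes connected_UNIV: "connected (UNIV :: 'a set)"
    and finite_dim: "\<exists>d. covering_dim_le (euclidean :: 'a topology) d"
begin

text \<open>The values are roots of unity of a fixed order, hence finitely many, and a continuous
  function with finite range on a connected space is constant.\<close>

lemma character_torsion_free:
  assumes \<phi>: "character \<phi>" and "N > 0" and pow: "\<And>x. \<phi> x ^ N = 1"
  shows "\<phi> x = 1"
proof -
  have "finite (\<phi> ` UNIV)"
    by (rule finite_subset[OF _ finite_nth_roots[OF \<open>N > 0\<close>, of 1]]) (use pow in auto)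
  then have "\<phi> constant_on UNIV"
    by (rule continuous_finite_range_constant[OF connected_UNIV character_cts[OF \<phi>]])
  then show ?thesis using character_0[OF \<phi>] unfolding constant_on_def by (metis UNIV_I)
qed

lemma ex_maximal_char_indep:
  obtains X r where "char_indep X r" "\<And>Z. \<not> char_indep Z (Suc r)"
proof -
  obtain d where d: "covering_dim_le (euclidean :: 'a topology) d" using finite_dim by blast
  define P where "P n \<longleftrightarrow> (\<exists>X. char_indep X n)" for n
  have "P 0" by (auto simp: P_def char_indep_def)
  moreover have "\<And>n. P n \<Longrightarrow> n \<le> d" using char_indep_le_dim[OF d] by (auto simp: P_def)
  ultimately have "P (Greatest P)" "\<not> P (Suc (Greatest P))"
    using GreatestI_nat[of P 0 d] Greatest_le_nat[of P "Suc (Greatest P)" d] by auto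
  then show ?thesis using that by (auto simp: P_def)
qed

theorem ex_common_character:
  assumes T1: "epimorphism T1" and T2: "epimorphism T2"
    and \<phi>1: "character \<phi>1" and \<phi>2: "character \<phi>2" and nontriv: "\<phi>1 z \<noteq> 1"
    and inf: "infinite {n. \<forall>x. \<phi>1 ((T1 ^^ n) x) = \<phi>2 ((T2 ^^ n) x)}"
  obtains l \<phi> y where "l \<ge> 1" "character \<phi>" "\<phi> y \<noteq> 1"
    "\<And>m x. \<phi> ((T1 ^^ (l * m)) x) = \<phi> ((T2 ^^ (l * m)) x)"
proof -
  obtain X r where X: "char_indep X r" and max: "\<And>Z. \<not> char_indep Z (Suc r)"
    using ex_maximal_char_indep by blast
  have ch: "\<And>i. i < r \<Longrightarrow> character (X i)" using X by (simp add: char_indep_def)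
  \<comment> \<open>Taking \<open>\<phi>1\<close>, \<open>\<phi>2\<close> and the images of the
    basis under both maps together yields a single \<open>N\<close>, so that the two orbits carry
    the same exponent \<open>N * N ^ n\<close> in \<open>p1\<close> and \<open>p2\<close>.\<close>
  define \<Phi> where "\<Phi> = {\<phi>1, \<phi>2} \<union> (\<lambda>j x. X j (T1 x)) ` {..<r} \<union> (\<lambda>j x. X j (T2 x)) ` {..<r}"
  have "\<exists>N>0. \<forall>\<phi>\<in>\<Phi>. \<exists>k\<in>supported r. \<forall>x. \<phi> x ^ N = char_prod X r k x"
    by (rule char_indep_common_multiple[OF X max])
      (use \<phi>1 \<phi>2 T1 T2 ch in \<open>auto simp: \<Phi>_def intro: character_comp_epimorphism\<close>)
  then obtain N where N: "N > 0" "\<And>\<phi>. \<phi> \<in> \<Phi> \<Longrightarrow> \<exists>k\<in>supported r. \<forall>x. \<phi> x ^ N = char_prod X r k x"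
    by blast
  obtain k1 where k1: "k1 \<in> supported r" "\<And>x. \<phi>1 x ^ N = char_prod X r k1 x"
    using N(2)[of \<phi>1] by (auto simp: \<Phi>_def)
  obtain k2 where k2: "k2 \<in> supported r" "\<And>x. \<phi>2 x ^ N = char_prod X r k2 x"
    using N(2)[of \<phi>2] by (auto simp: \<Phi>_def)
  have N1: "\<exists>k\<in>supported r. \<forall>x. X j (T1 x) ^ N = char_prod X r k x" if "j < r" for j
    using N(2)[of "\<lambda>x. X j (T1 x)"] that by (auto simp: \<Phi>_def)
  have N2: "\<exists>k\<in>supported r. \<forall>x. X j (T2 x) ^ N = char_prod X r k x" if "j < r" for j
    using N(2)[of "\<lambda>x. X j (T2 x)"] that by (auto simp: \<Phi>_def)
  obtain M1 M1' d1 where M1: "int_linear M1" "\<And>v. M1 v \<in> supported r" "int_linear M1'" "d1 \<noteq> 0"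
    "\<And>v. v \<in> supported r \<Longrightarrow> M1' (M1 v) = (\<lambda>i. d1 * v i)"
    "\<And>v x. char_prod X r (M1 v) x = char_prod X r v (T1 x) ^ N"
    using ex_matrix_of_epimorphism[OF X max T1 N(1) N1] by metis
  obtain M2 M2' d2 where M2: "int_linear M2" "\<And>v. M2 v \<in> supported r" "int_linear M2'" "d2 \<noteq> 0"
    "\<And>v. v \<in> supported r \<Longrightarrow> M2' (M2 v) = (\<lambda>i. d2 * v i)"
    "\<And>v x. char_prod X r (M2 v) x = char_prod X r v (T2 x) ^ N"
    using ex_matrix_of_epimorphism[OF X max T2 N(1) N2] by metis
  have p1: "char_prod X r ((M1 ^^ n) k1) x = \<phi>1 ((T1 ^^ n) x) ^ (N * N ^ n)" for n x
    unfolding char_prod_funpow[OF M1(6)] k1(2)[symmetric] by (simp add: power_mult)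
  have p2: "char_prod X r ((M2 ^^ n) k2) x = \<phi>2 ((T2 ^^ n) x) ^ (N * N ^ n)" for n x
    unfolding char_prod_funpow[OF M2(6)] k2(2)[symmetric] by (simp add: power_mult)
  have s1: "(M1 ^^ n) k1 \<in> supported r" for n using k1(1) M1(2) by (intro supported_funpow) auto
  have s2: "(M2 ^^ n) k2 \<in> supported r" for n using k2(1) M2(2) by (intro supported_funpow) auto
  have "(M1 ^^ n) k1 = (M2 ^^ n) k2" if "\<forall>x. \<phi>1 ((T1 ^^ n) x) = \<phi>2 ((T2 ^^ n) x)" for n
    by (rule char_prod_inj[OF X s1 s2]) (simp add: p1 p2 that)
  then have "infinite {n. (M1 ^^ n) k1 = (M2 ^^ n) k2}"
    using inf by (elim infinite_super[rotated]) auto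
  from skolem_mahler_lech_pair[OF M1(1,2,3,5,4) M2(1,2,3,5,4) k1(1) k2(1) this]
  obtain a l where l: "l \<ge> 1" "\<And>m. (M1 ^^ (a + l * m)) k1 = (M2 ^^ (a + l * m)) k2" by blast
  \<comment> \<open>The vector identity only says that the powers with exponent
    \<open>N * N ^ ?t\<close> agree; the quotient \<open>\<psi>\<close> is then a torsion character
    and hence trivial.\<close>
  have eq: "\<phi>1 ((T1 ^^ (a + l * m)) x) = \<phi>2 ((T2 ^^ (a + l * m)) x)" for m x
  proof -
    let ?t = "a + l * m"
    define \<psi> where "\<psi> x = \<phi>1 ((T1 ^^ ?t) x) * cnj (\<phi>2 ((T2 ^^ ?t) x))" for x
    have c1: "character (\<lambda>x. \<phi>1 ((T1 ^^ ?t) x))" and c2: "character (\<lambda>x. \<phi>2 ((T2 ^^ ?t) x))"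
      by (rule character_comp_epimorphism[OF \<phi>1 epimorphism_funpow[OF T1]],
          rule character_comp_epimorphism[OF \<phi>2 epimorphism_funpow[OF T2]])
    have cnj: "cnj (\<phi>2 ((T2 ^^ ?t) x)) = inverse (\<phi>2 ((T2 ^^ ?t) x))" for x
      by (rule norm_eq_1_imp_cnj_eq_inverse[OF character_norm[OF c2]])
    have "\<phi>1 ((T1 ^^ ?t) x) ^ (N * N ^ ?t) = \<phi>2 ((T2 ^^ ?t) x) ^ (N * N ^ ?t)" for x
      using p1[of ?t x] p2[of ?t x] l(2) by simp
    then have "\<psi> x ^ (N * N ^ ?t) = 1" for x
      unfolding \<psi>_def cnj using character_nonzero[OF c2, of x]
      by (simp only: power_mult_distrib power_inverse) simp
    moreover have "N * N ^ ?t > 0" using N(1) by simp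
    moreover have "character \<psi>" unfolding \<psi>_def by (intro character_mult character_cnj c1 c2)
    ultimately have "\<psi> x = 1" using character_torsion_free by blast
    then show ?thesis
      unfolding \<psi>_def cnj using character_nonzero[OF c2, of x] by (simp add: field_simps)
  qed
  \<comment> \<open>The case \<open>m = 0\<close> of \<open>eq\<close> identifies this character
    with \<open>\<phi>2\<close> after \<open>T2 ^^ a\<close>, so it can be read on either
    side.\<close>
  define \<phi> where "\<phi> x = \<phi>1 ((T1 ^^ a) x)" for x
  have "character \<phi>" unfolding \<phi>_def by (rule character_comp_epimorphism[OF \<phi>1 epimorphism_funpow[OF T1]])
  moreover obtain y where "(T1 ^^ a) y = z"
    using epimorphism_funpow[OF T1, of a] unfolding epimorphism_def by (metis surjD)
  then have "\<phi> y \<noteq> 1" using nontriv by (simp add: \<phi>_def)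
  moreover have "\<phi> ((T1 ^^ (l * m)) x) = \<phi> ((T2 ^^ (l * m)) x)" for m x
  proof -
    have "\<phi> ((T1 ^^ (l * m)) x) = \<phi>1 ((T1 ^^ (a + l * m)) x)" by (simp add: \<phi>_def funpow_add)
    also have "\<dots> = \<phi>2 ((T2 ^^ a) ((T2 ^^ (l * m)) x))" unfolding eq by (simp add: funpow_add)
    also have "\<dots> = \<phi> ((T2 ^^ (l * m)) x)" using eq[of 0] by (simp add: \<phi>_def)
    finally show ?thesis .
  qed
  ultimately show ?thesis using l(1) that by blast
qed

end

section \<open>Mixing\<close>

context compact_haar_group
begin

inductive_set trig :: "('a \<Rightarrow> complex) set" where
  char: "character \<phi> \<Longrightarrow> (\<lambda>x. c * \<phi> x) \<in> trig"
| add: "f \<in> trig \<Longrightarrow> g \<in> trig \<Longrightarrow> (\<lambda>x. f x + g x) \<in> trig"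

lemma trig_const: "(\<lambda>x. c) \<in> trig"
  using trig.char[OF character_one, of c] by simp

lemma trig_mult:
  assumes "f \<in> trig" "g \<in> trig"
  shows "(\<lambda>x. f x * g x) \<in> trig"
  using assms
proof (induction arbitrary: g)
  case (char \<phi> c)
  from char(2,1) show ?case
  proof (induction)
    case (char \<psi> d)
    have "(\<lambda>x. (c * d) * (\<phi> x * \<psi> x)) \<in> trig"
      using char by (intro trig.char character_mult)
    then show ?case by (simp add: mult_ac)
  next
    case (add f g)
    then show ?case by (simp add: distrib_left trig.add)
  qed
next
  case (add f f')
  then show ?case by (simp add: distrib_right trig.add)
qed

lemma trig_cts: "f \<in> trig \<Longrightarrow> cts f"
  by (induction rule: trig.induct)
    (auto intro: continuous_on_mult continuous_on_add continuous_on_const dest: character_cts)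

definition real_trig :: "('a \<Rightarrow> real) set" where
  "real_trig = {f. (\<lambda>x. complex_of_real (f x)) \<in> trig}"

lemma real_trig_continuous: "f \<in> real_trig \<Longrightarrow> continuous_on UNIV f"
  using continuous_on_Re[OF trig_cts, of "\<lambda>x. complex_of_real (f x)"] by (simp add: real_trig_def)

lemma real_trig_Re_Im:
  assumes "character \<phi>"
  shows "(\<lambda>x. Re (\<phi> x)) \<in> real_trig" "(\<lambda>x. Im (\<phi> x)) \<in> real_trig"
proof -
  have "(\<lambda>x. (1/2) * \<phi> x + (1/2) * cnj (\<phi> x)) \<in> trig"
    and "(\<lambda>x. (- \<i>/2) * \<phi> x + (\<i>/2) * cnj (\<phi> x)) \<in> trig"
    by (rule trig.add[OF trig.char[OF assms] trig.char[OF character_cnj[OF assms]]])+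
  moreover have "(\<lambda>x. (1/2) * \<phi> x + (1/2) * cnj (\<phi> x)) = (\<lambda>x. complex_of_real (Re (\<phi> x)))"
    "(\<lambda>x. (- \<i>/2) * \<phi> x + (\<i>/2) * cnj (\<phi> x)) = (\<lambda>x. complex_of_real (Im (\<phi> x)))"
    by (auto simp: complex_eq_iff)
  ultimately show "(\<lambda>x. Re (\<phi> x)) \<in> real_trig" "(\<lambda>x. Im (\<phi> x)) \<in> real_trig"
    by (simp_all add: real_trig_def)
qed

lemma real_trig_dense:
  assumes f: "continuous_on UNIV f" and "e > 0"
  obtains g where "g \<in> real_trig" "\<And>x. \<bar>f x - g x\<bar> < e"
proof -
  interpret function_ring_on real_trig "UNIV :: 'a set"
  proof
    show "compact (UNIV :: 'a set)" by (rule compact_UNIV)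
    fix x y :: 'a assume "x \<noteq> y"
    then obtain \<phi> where \<phi>: "character \<phi>" "\<phi> (x - y) \<noteq> 1"
      using characters_separate[of "x - y"] by auto
    then have "\<phi> x \<noteq> \<phi> y" using character_nonzero[OF \<phi>(1), of y] by (simp add: character_diff)
    then have "Re (\<phi> x) \<noteq> Re (\<phi> y) \<or> Im (\<phi> x) \<noteq> Im (\<phi> y)" by (simp add: complex_eq_iff)
    then show "\<exists>f\<in>real_trig. f x \<noteq> f y"
      by (elim disjE; intro bexI) (rule real_trig_Re_Im[OF \<phi>(1)] | simp)+
  qed (auto simp: real_trig_def trig.add trig_mult trig_const intro: real_trig_continuous[unfolded real_trig_def])
  show ?thesis using Stone_Weierstrass_basic[OF f \<open>e > 0\<close>] that by auto
qed

section \<open>Epimorphisms preserve Haar measure\<close>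

lemma integral_trig_comp:
  assumes T: "epimorphism T" and "f \<in> trig"
  shows "(\<integral>x. f (T x) \<partial>\<mu>) = (\<integral>x. f x \<partial>\<mu>)"
  using assms(2)
proof (induction)
  case (char \<phi> c)
  show ?case
  proof (cases "\<forall>x. \<phi> x = 1")
    case False
    then obtain z where z: "\<phi> z \<noteq> 1" by blast
    obtain w where "T w = z" using T unfolding epimorphism_def by (metis surjD)
    then have "(\<integral>x. \<phi> (T x) \<partial>\<mu>) = 0"
      using z by (intro integral_character[OF character_comp_epimorphism[OF char T], of w]) simp
    then show ?thesis using integral_character[OF char z] by simp
  qed simp
next
  case (add f g)
  have "cts (\<lambda>x. f (T x))" "cts (\<lambda>x. g (T x))"
    using T add(1,2) trig_cts by (auto simp: epimorphism_def intro: continuous_on_compose2)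
  then show ?case using add trig_cts by (simp add: integrable_continuous)
qed

lemma continuous_comp_epimorphism:
  assumes "continuous_on UNIV f" "epimorphism T"
  shows "continuous_on UNIV (\<lambda>x. f (T x))"
  using assms by (intro continuous_on_compose2[OF assms(1)]) (auto simp: epimorphism_def)

lemma integral_continuous_comp:
  fixes f :: "'a \<Rightarrow> real"
  assumes T: "epimorphism T" and f: "continuous_on UNIV f"
  shows "(\<integral>x. f (T x) \<partial>\<mu>) = (\<integral>x. f x \<partial>\<mu>)"
proof -
  have "dist (\<integral>x. f (T x) \<partial>\<mu>) (\<integral>x. f x \<partial>\<mu>) \<le> e" if e: "e > 0" for e
  proof -
    have "e / 2 > 0" using e by simp
    then obtain g where g: "g \<in> real_trig" "\<And>x. \<bar>f x - g x\<bar> < e / 2"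
      using real_trig_dense[OF f] by blast
    have "complex_of_real (\<integral>x. g (T x) \<partial>\<mu>) = complex_of_real (\<integral>x. g x \<partial>\<mu>)"
      using integral_trig_comp[OF T, of "\<lambda>x. complex_of_real (g x)"] g(1) by (simp add: real_trig_def)
    then have eq: "(\<integral>x. g (T x) \<partial>\<mu>) = (\<integral>x. g x \<partial>\<mu>)" by (simp only: of_real_eq_iff)
    have le: "dist (f x) (g x) \<le> e / 2" for x using g(2)[of x] by (simp add: dist_real_def)
    have cg: "continuous_on UNIV g" by (rule real_trig_continuous[OF g(1)])
    have "dist (\<integral>x. f (T x) \<partial>\<mu>) (\<integral>x. g (T x) \<partial>\<mu>) \<le> e / 2"
      by (rule integral_diff_le[OF continuous_comp_epimorphism[OF f T] continuous_comp_epimorphism[OF cg T] le])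
    moreover have "dist (\<integral>x. f x \<partial>\<mu>) (\<integral>x. g x \<partial>\<mu>) \<le> e / 2"
      by (rule integral_diff_le[OF f cg le])
    ultimately show ?thesis
      unfolding eq using dist_triangle2[of "\<integral>x. f (T x) \<partial>\<mu>" "\<integral>x. f x \<partial>\<mu>" "\<integral>x. g x \<partial>\<mu>"] by simp
  qed
  then have "dist (\<integral>x. f (T x) \<partial>\<mu>) (\<integral>x. f x \<partial>\<mu>) \<le> 0" by (rule field_le_epsilon) simp
  then show ?thesis by simp
qed

lemma epimorphism_measurable: "epimorphism T \<Longrightarrow> T \<in> measurable \<mu> \<mu>"
  by (rule measurable_endo) (simp add: epimorphism_def)

lemma inner_regular: "open U \<Longrightarrow> emeasure \<mu> U = (SUP K\<in>{K. compact K \<and> K \<subseteq> U}. emeasure \<mu> K)"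
  using haar unfolding normalized_haar_measure_def by blast

lemma outer_regular:
  "B \<in> sets \<mu> \<Longrightarrow> emeasure \<mu> B = (INF U\<in>{U. open U \<and> B \<subseteq> U}. emeasure \<mu> U)"
  using haar unfolding normalized_haar_measure_def by blast

lemma measure_le_integral:
  fixes f :: "'a \<Rightarrow> real"
  assumes "K \<in> sets \<mu>" "continuous_on UNIV f" "\<And>x. 0 \<le> f x" "\<And>x. x \<in> K \<Longrightarrow> f x = 1"
  shows "measure \<mu> K \<le> (\<integral>x. f x \<partial>\<mu>)"
proof -
  have "measure \<mu> K = (\<integral>x. indicator K x \<partial>\<mu>)" using assms(1) by (simp add: space_eq)
  also have "\<dots> \<le> (\<integral>x. f x \<partial>\<mu>)"
    using assms by (intro integral_mono integrable_continuous integrable_real_indicator)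
      (auto simp: indicator_def less_top[symmetric])
  finally show ?thesis .
qed

lemma integral_le_measure:
  fixes f :: "'a \<Rightarrow> real"
  assumes "U \<in> sets \<mu>" "continuous_on UNIV f" "\<And>x. f x \<le> 1" "\<And>x. x \<notin> U \<Longrightarrow> f x \<le> 0"
  shows "(\<integral>x. f x \<partial>\<mu>) \<le> measure \<mu> U"
proof -
  have "(\<integral>x. f x \<partial>\<mu>) \<le> (\<integral>x. indicator U x \<partial>\<mu>)"
    using assms by (intro integral_mono integrable_continuous integrable_real_indicator)
      (auto simp: indicator_def less_top[symmetric])
  also have "\<dots> = measure \<mu> U" using assms(1) by (simp add: space_eq)
  finally show ?thesis .
qed

lemma closed_in_sets: "closed K \<Longrightarrow> K \<in> sets \<mu>" and open_in_sets: "open K \<Longrightarrow> K \<in> sets \<mu>"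
  by (simp_all add: sets_eq)

text \<open>Both inequalities use inner regularity: a compact subset of the one open set is
  separated by a Urysohn function whose integral, invariant under \<open>T\<close>, is bounded by
  the measure of the other set.\<close>

lemma emeasure_vimage_open:
  assumes T: "epimorphism T" and U: "open U"
  shows "emeasure \<mu> (T -` U) = emeasure \<mu> U"
proof (rule antisym)
  have cT: "continuous_on UNIV T" using T by (simp add: epimorphism_def)
  have TU: "open (T -` U)" by (rule open_vimage[OF U cT])
  have bump: "\<exists>f::'a \<Rightarrow> real. continuous_on UNIV f \<and> (\<forall>x. 0 \<le> f x \<and> f x \<le> 1) \<and>
      (\<forall>x\<in>K. f x = 1) \<and> (\<forall>x. x \<notin> U \<longrightarrow> f x = 0)" if K: "compact K" "K \<subseteq> U" for K
  proof -
    have "closed (- U)" "closed K" "(- U) \<inter> K = {}"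
      using U K compact_imp_closed by auto
    from ex_Urysohn[OF this] show ?thesis by (metis ComplI)
  qed
  have "emeasure \<mu> K \<le> emeasure \<mu> U" if K: "compact K" "K \<subseteq> T -` U" for K
  proof -
    have "compact (T ` K)" using compact_continuous_image continuous_on_subset[OF cT] K(1) by blast
    moreover have "T ` K \<subseteq> U" using K(2) by blast
    ultimately obtain f :: "'a \<Rightarrow> real" where f: "continuous_on UNIV f" "\<And>x. 0 \<le> f x" "\<And>x. f x \<le> 1"
      "\<And>x. x \<in> T ` K \<Longrightarrow> f x = 1" "\<And>x. x \<notin> U \<Longrightarrow> f x = 0"
      using bump by metis
    have "measure \<mu> K \<le> (\<integral>x. f (T x) \<partial>\<mu>)"
      by (rule measure_le_integral[OF closed_in_sets[OF compact_imp_closed[OF K(1)]]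
            continuous_comp_epimorphism[OF f(1) T]]) (use f in auto)
    also have "\<dots> = (\<integral>x. f x \<partial>\<mu>)" by (rule integral_continuous_comp[OF T f(1)])
    also have "\<dots> \<le> measure \<mu> U" using f U by (intro integral_le_measure open_in_sets) auto
    finally show ?thesis by (simp add: emeasure_eq_measure)
  qed
  then show "emeasure \<mu> (T -` U) \<le> emeasure \<mu> U"
    unfolding inner_regular[OF TU] by (intro SUP_least) auto
  have "emeasure \<mu> K \<le> emeasure \<mu> (T -` U)" if K: "compact K" "K \<subseteq> U" for K
  proof -
    obtain f :: "'a \<Rightarrow> real" where f: "continuous_on UNIV f" "\<And>x. 0 \<le> f x" "\<And>x. f x \<le> 1"
      "\<And>x. x \<in> K \<Longrightarrow> f x = 1" "\<And>x. x \<notin> U \<Longrightarrow> f x = 0"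
      using bump[OF K] by metis
    have "measure \<mu> K \<le> (\<integral>x. f x \<partial>\<mu>)"
      using K(1) f by (intro measure_le_integral closed_in_sets compact_imp_closed) auto
    also have "\<dots> = (\<integral>x. f (T x) \<partial>\<mu>)" by (rule integral_continuous_comp[OF T f(1), symmetric])
    also have "\<dots> \<le> measure \<mu> (T -` U)"
      by (rule integral_le_measure[OF open_in_sets[OF TU] continuous_comp_epimorphism[OF f(1) T]])
        (use f in auto)
    finally show ?thesis by (simp add: emeasure_eq_measure)
  qed
  then show "emeasure \<mu> U \<le> emeasure \<mu> (T -` U)"
    unfolding inner_regular[OF U] by (intro SUP_least) auto
qed

lemma distr_epimorphism:
  assumes T: "epimorphism T"
  shows "distr \<mu> \<mu> T = \<mu>"
proof (rule measure_eqI_generator_eq[where E="{S. open S}" and \<Omega>=UNIV and A="\<lambda>_. UNIV"])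
  note m = epimorphism_measurable[OF T]
  show "Int_stable {S::'a set. open S}" by (auto simp: Int_stable_def)
  show "sets \<mu> = sigma_sets UNIV {S. open S}" "sets (distr \<mu> \<mu> T) = sigma_sets UNIV {S. open S}"
    by (simp_all add: sets_eq sets_borel)
  show "emeasure (distr \<mu> \<mu> T) S = emeasure \<mu> S" if "S \<in> {S. open S}" for S
    using that emeasure_vimage_open[OF T] by (simp add: emeasure_distr[OF m] space_eq open_in_sets)
  show "emeasure (distr \<mu> \<mu> T) UNIV \<noteq> \<infinity>" for i :: nat
    using finite_measure.emeasure_finite[OF finite_measure_distr[OF m]] by simp
qed auto

lemma measure_vimage_epimorphism:
  assumes T: "epimorphism T" and "B \<in> sets \<mu>"
  shows "emeasure \<mu> (T -` B) = emeasure \<mu> B"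
  using emeasure_distr[OF epimorphism_measurable[OF T] assms(2)] distr_epimorphism[OF T]
  by (simp add: space_eq)

lemma integral_epimorphism:
  fixes f :: "'a \<Rightarrow> real"
  assumes T: "epimorphism T" and "f \<in> borel_measurable \<mu>"
  shows "(\<integral>x. f (T x) \<partial>\<mu>) = (\<integral>x. f x \<partial>\<mu>)"
  using integral_distr[OF epimorphism_measurable[OF T] assms(2)] distr_epimorphism[OF T] by simp

section \<open>Mixing: from characters to measurable sets\<close>

lemma indicator_approx:
  assumes B: "B \<in> sets \<mu>" and "e > 0"
  obtains h where "h \<in> real_trig" "\<And>x. \<bar>h x\<bar> \<le> 2" "(\<integral>x. \<bar>indicator B x - h x\<bar> \<partial>\<mu>) \<le> e"
proof -
  have "emeasure \<mu> B < ennreal (measure \<mu> B + e / 4)"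
    using \<open>e > 0\<close> by (simp add: emeasure_eq_measure ennreal_less_iff)
  then obtain U where U: "open U" "B \<subseteq> U" "measure \<mu> U < measure \<mu> B + e / 4"
    unfolding outer_regular[OF B] INF_less_iff
    by (auto simp: emeasure_eq_measure ennreal_less_iff)
  obtain K where K: "compact K" "K \<subseteq> U" "measure \<mu> U - e / 4 < measure \<mu> K"
  proof (cases "measure \<mu> U < e / 4")
    case True
    then show ?thesis using that[of "{}"] by simp
  next
    case False
    then have "ennreal (measure \<mu> U - e / 4) < emeasure \<mu> U"
      using \<open>e > 0\<close> by (simp add: emeasure_eq_measure ennreal_less_iff)
    then show ?thesis
      unfolding inner_regular[OF U(1)] less_SUP_iff using False that
      by (auto simp: emeasure_eq_measure ennreal_less_iff)
  qed
  have cl: "closed (- U)" "closed K" "(- U) \<inter> K = {}"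
    using U K compact_imp_closed by auto
  obtain f :: "'a \<Rightarrow> real" where f: "continuous_on UNIV f" "\<And>x. 0 \<le> f x" "\<And>x. f x \<le> 1"
    "\<And>x. x \<in> - U \<Longrightarrow> f x = 0" "\<And>x. x \<in> K \<Longrightarrow> f x = 1"
    using ex_Urysohn[OF cl] by metis
  \<comment> \<open>The error budget is \<open>e / 4\<close> for \<open>U\<close>,
    \<open>e / 4\<close> for \<open>K\<close> and \<open>e / 2\<close> for the uniform
    approximation. The cap \<open>1\<close> yields the bound \<open>2\<close> on \<open>h\<close>,
    since \<open>f\<close> takes values between \<open>0\<close> and \<open>1\<close>.\<close>
  have "min (e / 2) 1 > 0" using \<open>e > 0\<close> by simp
  then obtain h where h: "h \<in> real_trig" "\<And>x. \<bar>f x - h x\<bar> < min (e / 2) 1"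
    using real_trig_dense[OF f(1)] by blast
  have h': "\<bar>f x - h x\<bar> < e / 2" "\<bar>f x - h x\<bar> < 1" for x using h(2)[of x] by simp_all
  have "\<bar>h x\<bar> \<le> 2" for x using h'(2)[of x] f(2)[of x] f(3)[of x] by linarith
  moreover have "(\<integral>x. \<bar>indicator B x - h x\<bar> \<partial>\<mu>) \<le> e"
  proof -
    have s: "U \<in> sets \<mu>" "K \<in> sets \<mu>" using U(1) cl(2) by (simp_all add: sets_eq)
    have i: "integrable \<mu> (indicator A :: 'a \<Rightarrow> real)" if "A \<in> sets \<mu>" for A
      using that by (intro integrable_real_indicator) (auto simp: less_top[symmetric])
    have "(\<integral>x. \<bar>indicator B x - h x\<bar> \<partial>\<mu>) \<le> (\<integral>x. indicator (U - B) x + (indicator (U - K) x + e / 2) \<partial>\<mu>)"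
    proof (rule integral_mono)
      show "integrable \<mu> (\<lambda>x. \<bar>indicator B x - h x\<bar>)"
        using i[OF B] integrable_continuous[OF real_trig_continuous[OF h(1)]] by simp
      show "integrable \<mu> (\<lambda>x. indicator (U - B) x + (indicator (U - K) x + e / 2))"
        using i[of "U - B"] i[of "U - K"] s B by simp
      fix x
      have "\<bar>indicator B x - f x\<bar> \<le> indicator (U - B) x + (indicator (U - K) x :: real)"
        using f(2)[of x] f(3)[of x] f(4)[of x] f(5)[of x] U(2) K(2)
        by (cases "x \<in> B"; cases "x \<in> K"; cases "x \<in> U") auto
      then show "\<bar>indicator B x - h x\<bar> \<le> indicator (U - B) x + (indicator (U - K) x + e / 2)"
        using h'(1)[of x] by linarith
    qed
    also have "\<dots> = measure \<mu> (U - B) + (measure \<mu> (U - K) + e / 2)"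
      using i[of "U - B"] i[of "U - K"] s B prob_space by (simp add: space_eq)
    also have "\<dots> \<le> e"
      using finite_measure_Diff[OF s(1) B U(2)] finite_measure_Diff[OF s K(2)] U(3) K(3) by simp
    finally show ?thesis .
  qed
  ultimately show ?thesis using that h(1) by blast
qed

text \<open>For characters the integrand is itself a character, so its integral is \<open>0\<close>
  unless it is trivial, which the finiteness assumption excludes for all large \<open>n\<close>;
  bilinearity does the rest. If the first character is trivial, invariance of the integral under
  \<open>T2\<close> makes the sequence constant.\<close>

lemma trig_mixing:
  assumes T1: "epimorphism T1" and T2: "epimorphism T2"
    and fin: "\<And>\<phi>1 \<phi>2 z. character \<phi>1 \<Longrightarrow> character \<phi>2 \<Longrightarrow> \<phi>1 z \<noteq> 1 \<Longrightarrow>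
      finite {n. \<forall>x. \<phi>1 ((T1 ^^ n) x) = \<phi>2 ((T2 ^^ n) x)}"
    and "f \<in> trig" "g \<in> trig"
  shows "(\<lambda>n. \<integral>x. f ((T1 ^^ n) x) * g ((T2 ^^ n) x) \<partial>\<mu>) \<longlonglongrightarrow> (\<integral>x. f x \<partial>\<mu>) * (\<integral>x. g x \<partial>\<mu>)"
proof -
  have E1: "epimorphism (T1 ^^ n)" and E2: "epimorphism (T2 ^^ n)" for n
    by (rule epimorphism_funpow[OF T1], rule epimorphism_funpow[OF T2])
  have c1: "cts (\<lambda>x. f ((T1 ^^ n) x))" if "f \<in> trig" for f n
    by (rule continuous_comp_epimorphism[OF trig_cts[OF that] E1])
  have c2: "cts (\<lambda>x. f ((T2 ^^ n) x))" if "f \<in> trig" for f n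
    by (rule continuous_comp_epimorphism[OF trig_cts[OF that] E2])
  have chars: "(\<lambda>n. \<integral>x. \<phi> ((T1 ^^ n) x) * \<psi> ((T2 ^^ n) x) \<partial>\<mu>) \<longlonglongrightarrow> (\<integral>x. \<phi> x \<partial>\<mu>) * (\<integral>x. \<psi> x \<partial>\<mu>)"
    if \<phi>: "character \<phi>" and \<psi>: "character \<psi>" for \<phi> \<psi>
  proof (cases "\<forall>x. \<phi> x = 1")
    case True
    have "\<psi> \<in> trig" using trig.char[OF \<psi>, of 1] by simp
    then show ?thesis using True integral_trig_comp[OF E2] prob_space by simp
  next
    case False
    then obtain z where z: "\<phi> z \<noteq> 1" by blast
    \<comment> \<open>Triviality of the product means that the first factor is the inverse, that is
      the conjugate, of the second.\<close>
    have "finite {n. \<forall>x. \<phi> ((T1 ^^ n) x) = cnj (\<psi> ((T2 ^^ n) x))}"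
      by (rule fin[OF \<phi> character_cnj[OF \<psi>] z])
    then have "\<forall>\<^sub>F n in sequentially. \<not> (\<forall>x. \<phi> ((T1 ^^ n) x) = cnj (\<psi> ((T2 ^^ n) x)))"
      unfolding cofinite_eq_sequentially[symmetric] eventually_cofinite by simp
    then have "\<forall>\<^sub>F n in sequentially. (\<integral>x. \<phi> ((T1 ^^ n) x) * \<psi> ((T2 ^^ n) x) \<partial>\<mu>) = 0"
    proof eventually_elim
      case (elim n)
      then obtain x where x: "\<phi> ((T1 ^^ n) x) \<noteq> cnj (\<psi> ((T2 ^^ n) x))" by blast
      have ch: "character (\<lambda>x. \<phi> ((T1 ^^ n) x) * \<psi> ((T2 ^^ n) x))"
        by (intro character_mult character_comp_epimorphism[OF \<phi> E1] character_comp_epimorphism[OF \<psi> E2])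
      have "\<phi> ((T1 ^^ n) x) * \<psi> ((T2 ^^ n) x) \<noteq> 1"
      proof
        assume "\<phi> ((T1 ^^ n) x) * \<psi> ((T2 ^^ n) x) = 1"
        then have "\<phi> ((T1 ^^ n) x) = inverse (\<psi> ((T2 ^^ n) x))"
          by (metis inverse_unique mult.commute)
        then show False
          using x norm_eq_1_imp_cnj_eq_inverse[OF character_norm[OF \<psi>, of "(T2 ^^ n) x"]] by simp
      qed
      then show ?case by (rule integral_character[OF ch])
    qed
    then show ?thesis using integral_character[OF \<phi> z] by (simp add: tendsto_eventually)
  qed
  show ?thesis
    using \<open>f \<in> trig\<close>
  proof (induction)
    case (char \<phi> c)
    show ?case
      using \<open>g \<in> trig\<close>
    proof (induction)
      case (char \<psi> d)
      have "(\<lambda>n. (c * d) * (\<integral>x. \<phi> ((T1 ^^ n) x) * \<psi> ((T2 ^^ n) x) \<partial>\<mu>)) \<longlonglongrightarrow>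
          (c * d) * ((\<integral>x. \<phi> x \<partial>\<mu>) * (\<integral>x. \<psi> x \<partial>\<mu>))"
        by (intro tendsto_mult_left chars \<open>character \<phi>\<close> char)
      then show ?case by (simp flip: integral_mult_right_zero) (simp add: mult_ac)
    next
      case (add g g')
      have "(\<lambda>x. c * \<phi> x) \<in> trig" by (rule trig.char[OF \<open>character \<phi>\<close>])
      from c1[OF this] c2[OF add(1)] c2[OF add(2)] tendsto_add[OF add.IH] show ?case
        using add(1,2) by (simp add: distrib_left integrable_continuous trig_cts continuous_on_mult)
    qed
  next
    case (add f f')
    from c1[OF add(1)] c1[OF add(2)] c2[OF \<open>g \<in> trig\<close>] tendsto_add[OF add.IH] show ?case
      using add(1,2) by (simp add: distrib_right integrable_continuous trig_cts continuous_on_mult)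
  qed
qed

lemma measure_mixing:
  assumes T1: "epimorphism T1" and T2: "epimorphism T2"
    and fin: "\<And>\<phi>1 \<phi>2 z. character \<phi>1 \<Longrightarrow> character \<phi>2 \<Longrightarrow> \<phi>1 z \<noteq> 1 \<Longrightarrow>
      finite {n. \<forall>x. \<phi>1 ((T1 ^^ n) x) = \<phi>2 ((T2 ^^ n) x)}"
    and B: "B1 \<in> sets \<mu>" "B2 \<in> sets \<mu>"
  shows "(\<lambda>n. measure \<mu> ((T1 ^^ n) -` B1 \<inter> (T2 ^^ n) -` B2)) \<longlonglongrightarrow> measure \<mu> B1 * measure \<mu> B2"
proof (rule LIMSEQ_I)
  fix r :: real assume "r > 0"
  \<comment> \<open>The sum \<open>3 * e + e + 3 * e\<close>: replacing indicators at time
    \<open>n\<close>, convergence for the approximants, replacing them in the limit.\<close>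
  define e where "e = r / 7"
  have "e > 0" using \<open>r > 0\<close> by (simp add: e_def)
  obtain h1 where h1: "h1 \<in> real_trig" "\<And>x. \<bar>h1 x\<bar> \<le> 2" "(\<integral>x. \<bar>indicator B1 x - h1 x\<bar> \<partial>\<mu>) \<le> e"
    using indicator_approx[OF B(1) \<open>e > 0\<close>] by blast
  obtain h2 where h2: "h2 \<in> real_trig" "\<And>x. \<bar>h2 x\<bar> \<le> 2" "(\<integral>x. \<bar>indicator B2 x - h2 x\<bar> \<partial>\<mu>) \<le> e"
    using indicator_approx[OF B(2) \<open>e > 0\<close>] by blast
  let ?i1 = "indicator B1 :: 'a \<Rightarrow> real" and ?i2 = "indicator B2 :: 'a \<Rightarrow> real"
  have m: "?i1 \<in> borel_measurable \<mu>" "?i2 \<in> borel_measurable \<mu>"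
    "h1 \<in> borel_measurable \<mu>" "h2 \<in> borel_measurable \<mu>"
    using B measurable_continuous real_trig_continuous h1(1) h2(1) by auto
  have i: "integrable \<mu> f" if "f \<in> borel_measurable \<mu>" "\<And>x. \<bar>f x\<bar> \<le> c" for f :: "'a \<Rightarrow> real" and c
    using that by (intro integrable_const_bound[of _ c]) auto
  \<comment> \<open>The bound is uniform in the epimorphisms because they preserve the measure, so
    it holds at all times \<open>n\<close> at once. It is \<open>e\<close> for the first factor plus
    \<open>2 * e\<close> for the second, where \<open>h1\<close> is bounded by
    \<open>2\<close>.\<close>
  have compare: "\<bar>(\<integral>x. ?i1 (S1 x) * ?i2 (S2 x) \<partial>\<mu>) - (\<integral>x. h1 (S1 x) * h2 (S2 x) \<partial>\<mu>)\<bar> \<le> 3 * e"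
    if S: "epimorphism S1" "epimorphism S2" for S1 S2
  proof -
    note mS = epimorphism_measurable[OF S(1)] epimorphism_measurable[OF S(2)]
    note mm = measurable_compose[OF mS(1) m(1)] measurable_compose[OF mS(2) m(2)]
      measurable_compose[OF mS(1) m(3)] measurable_compose[OF mS(2) m(4)]
    have i1: "integrable \<mu> (\<lambda>x. ?i1 (S1 x) * ?i2 (S2 x))"
      by (rule i[of _ 1]) (use mm in \<open>auto simp: indicator_def\<close>)
    have i2: "integrable \<mu> (\<lambda>x. h1 (S1 x) * h2 (S2 x))"
    proof (rule i[of _ 4])
      show "\<bar>h1 (S1 x) * h2 (S2 x)\<bar> \<le> 4" for x
        using mult_mono[OF h1(2)[of "S1 x"] h2(2)[of "S2 x"]] by (simp add: abs_mult)
    qed (use mm in simp)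
    have bd: "\<bar>?i1 x - h1 x\<bar> \<le> 3" "\<bar>?i2 x - h2 x\<bar> \<le> 3" for x
      using h1(2)[of x] h2(2)[of x] by (auto simp: indicator_def)
    have i3: "integrable \<mu> (\<lambda>x. \<bar>?i1 (S1 x) - h1 (S1 x)\<bar>)"
      by (rule i[of _ 3]) (use mm bd in auto)
    have i4: "integrable \<mu> (\<lambda>x. \<bar>?i2 (S2 x) - h2 (S2 x)\<bar>)"
      by (rule i[of _ 3]) (use mm bd in auto)
    have pt: "\<bar>?i1 (S1 x) * ?i2 (S2 x) - h1 (S1 x) * h2 (S2 x)\<bar>
        \<le> \<bar>?i1 (S1 x) - h1 (S1 x)\<bar> + 2 * \<bar>?i2 (S2 x) - h2 (S2 x)\<bar>" for x
    proof -
      have "?i1 (S1 x) * ?i2 (S2 x) - h1 (S1 x) * h2 (S2 x) =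
          (?i1 (S1 x) - h1 (S1 x)) * ?i2 (S2 x) + h1 (S1 x) * (?i2 (S2 x) - h2 (S2 x))"
        by (simp add: algebra_simps)
      moreover have "\<bar>(?i1 (S1 x) - h1 (S1 x)) * ?i2 (S2 x)\<bar> \<le> \<bar>?i1 (S1 x) - h1 (S1 x)\<bar>"
        by (simp add: indicator_def)
      moreover have "\<bar>h1 (S1 x) * (?i2 (S2 x) - h2 (S2 x))\<bar> \<le> 2 * \<bar>?i2 (S2 x) - h2 (S2 x)\<bar>"
        unfolding abs_mult by (intro mult_right_mono h1(2)) auto
      ultimately show ?thesis by linarith
    qed
    have "\<bar>(\<integral>x. ?i1 (S1 x) * ?i2 (S2 x) \<partial>\<mu>) - (\<integral>x. h1 (S1 x) * h2 (S2 x) \<partial>\<mu>)\<bar>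
        = \<bar>\<integral>x. ?i1 (S1 x) * ?i2 (S2 x) - h1 (S1 x) * h2 (S2 x) \<partial>\<mu>\<bar>"
      using Bochner_Integration.integral_diff[OF i1 i2] by simp
    also have "\<dots> \<le> (\<integral>x. \<bar>?i1 (S1 x) * ?i2 (S2 x) - h1 (S1 x) * h2 (S2 x)\<bar> \<partial>\<mu>)"
      by (rule integral_abs_bound)
    also have "\<dots> \<le> (\<integral>x. \<bar>?i1 (S1 x) - h1 (S1 x)\<bar> + 2 * \<bar>?i2 (S2 x) - h2 (S2 x)\<bar> \<partial>\<mu>)"
      using i1 i2 i3 i4 pt by (intro integral_mono) auto
    also have "\<dots> = (\<integral>x. \<bar>?i1 (S1 x) - h1 (S1 x)\<bar> \<partial>\<mu>) + 2 * (\<integral>x. \<bar>?i2 (S2 x) - h2 (S2 x)\<bar> \<partial>\<mu>)"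
      using i3 i4 by simp
    also have "(\<integral>x. \<bar>?i1 (S1 x) - h1 (S1 x)\<bar> \<partial>\<mu>) = (\<integral>x. \<bar>?i1 x - h1 x\<bar> \<partial>\<mu>)"
      using m by (intro integral_epimorphism[OF S(1), of "\<lambda>x. \<bar>?i1 x - h1 x\<bar>"]) simp
    also have "(\<integral>x. \<bar>?i2 (S2 x) - h2 (S2 x)\<bar> \<partial>\<mu>) = (\<integral>x. \<bar>?i2 x - h2 x\<bar> \<partial>\<mu>)"
      using m by (intro integral_epimorphism[OF S(2), of "\<lambda>x. \<bar>?i2 x - h2 x\<bar>"]) simp
    finally show ?thesis using h1(3) h2(3) by linarith
  qed
  have prod_meas: "measure \<mu> ((T1 ^^ n) -` B1 \<inter> (T2 ^^ n) -` B2)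
      = (\<integral>x. ?i1 ((T1 ^^ n) x) * ?i2 ((T2 ^^ n) x) \<partial>\<mu>)" for n
  proof -
    have "(\<integral>x. ?i1 ((T1 ^^ n) x) * ?i2 ((T2 ^^ n) x) \<partial>\<mu>)
        = (\<integral>x. indicator ((T1 ^^ n) -` B1 \<inter> (T2 ^^ n) -` B2) x \<partial>\<mu>)"
      by (intro Bochner_Integration.integral_cong) (auto simp: indicator_def)
    then show ?thesis by (simp add: space_eq)
  qed
  have ih: "\<bar>(\<integral>x. ?i1 x \<partial>\<mu>) - (\<integral>x. h1 x \<partial>\<mu>)\<bar> \<le> e" "\<bar>(\<integral>x. ?i2 x \<partial>\<mu>) - (\<integral>x. h2 x \<partial>\<mu>)\<bar> \<le> e"
  proof -
    have j: "integrable \<mu> ?i1" "integrable \<mu> ?i2" "integrable \<mu> h1" "integrable \<mu> h2"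
      by (rule i[OF m(1), of 1], simp add: indicator_def, rule i[OF m(2), of 1], simp add: indicator_def,
          rule i[OF m(3) h1(2)], rule i[OF m(4) h2(2)])
    show "\<bar>(\<integral>x. ?i1 x \<partial>\<mu>) - (\<integral>x. h1 x \<partial>\<mu>)\<bar> \<le> e"
      using integral_abs_bound[of \<mu> "\<lambda>x. ?i1 x - h1 x"] Bochner_Integration.integral_diff[OF j(1,3)] h1(3) by linarith
    show "\<bar>(\<integral>x. ?i2 x \<partial>\<mu>) - (\<integral>x. h2 x \<partial>\<mu>)\<bar> \<le> e"
      using integral_abs_bound[of \<mu> "\<lambda>x. ?i2 x - h2 x"] Bochner_Integration.integral_diff[OF j(2,4)] h2(3) by linarith
  qed
  have prod_int: "\<bar>measure \<mu> B1 * measure \<mu> B2 - (\<integral>x. h1 x \<partial>\<mu>) * (\<integral>x. h2 x \<partial>\<mu>)\<bar> \<le> 3 * e"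
  proof -
    let ?a = "measure \<mu> B1" and ?b = "measure \<mu> B2" and ?c = "\<integral>x. h1 x \<partial>\<mu>" and ?d = "\<integral>x. h2 x \<partial>\<mu>"
    have "\<bar>?a - ?c\<bar> \<le> e" "\<bar>?b - ?d\<bar> \<le> e" using ih B by (simp_all add: space_eq)
    moreover have "\<bar>?c\<bar> \<le> 2"
      using norm_integral_le[OF real_trig_continuous[OF h1(1)], of 2] h1(2) by simp
    moreover have "\<bar>?b\<bar> \<le> 1" by simp
    ultimately have "\<bar>(?a - ?c) * ?b\<bar> \<le> e * 1" "\<bar>?c * (?b - ?d)\<bar> \<le> 2 * e"
      unfolding abs_mult using \<open>e > 0\<close> by (intro mult_mono; simp)+
    moreover have "?a * ?b - ?c * ?d = (?a - ?c) * ?b + ?c * (?b - ?d)" by (simp add: algebra_simps)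
    ultimately show ?thesis by linarith
  qed
  have t: "(\<lambda>x. complex_of_real (h1 x)) \<in> trig" "(\<lambda>x. complex_of_real (h2 x)) \<in> trig"
    using h1(1) h2(1) by (simp_all add: real_trig_def)
  have "(\<lambda>n. \<integral>x. complex_of_real (h1 ((T1 ^^ n) x)) * complex_of_real (h2 ((T2 ^^ n) x)) \<partial>\<mu>)
      \<longlonglongrightarrow> (\<integral>x. complex_of_real (h1 x) \<partial>\<mu>) * (\<integral>x. complex_of_real (h2 x) \<partial>\<mu>)"
    by (rule trig_mixing[OF T1 T2 _ t]) (rule fin)
  then have "(\<lambda>n. complex_of_real (\<integral>x. h1 ((T1 ^^ n) x) * h2 ((T2 ^^ n) x) \<partial>\<mu>))
      \<longlonglongrightarrow> complex_of_real ((\<integral>x. h1 x \<partial>\<mu>) * (\<integral>x. h2 x \<partial>\<mu>))"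
    by (simp flip: of_real_mult)
  then have lim: "(\<lambda>n. \<integral>x. h1 ((T1 ^^ n) x) * h2 ((T2 ^^ n) x) \<partial>\<mu>) \<longlonglongrightarrow> (\<integral>x. h1 x \<partial>\<mu>) * (\<integral>x. h2 x \<partial>\<mu>)"
    by (simp only: tendsto_of_real_iff)
  obtain n0 where n0: "\<And>n. n \<ge> n0 \<Longrightarrow>
      \<bar>(\<integral>x. h1 ((T1 ^^ n) x) * h2 ((T2 ^^ n) x) \<partial>\<mu>) - (\<integral>x. h1 x \<partial>\<mu>) * (\<integral>x. h2 x \<partial>\<mu>)\<bar> < e"
    using LIMSEQ_D[OF lim \<open>e > 0\<close>] by auto
  have "norm (measure \<mu> ((T1 ^^ n) -` B1 \<inter> (T2 ^^ n) -` B2) - measure \<mu> B1 * measure \<mu> B2) < r" if "n \<ge> n0" for n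
    using compare[OF epimorphism_funpow[OF T1, of n] epimorphism_funpow[OF T2, of n]] n0[OF that] prod_int
    unfolding prod_meas e_def real_norm_def by linarith
  then show "\<exists>n0. \<forall>n\<ge>n0. norm (measure \<mu> ((T1 ^^ n) -` B1 \<inter> (T2 ^^ n) -` B2) - measure \<mu> B1 * measure \<mu> B2) < r"
    by blast
qed

end

section \<open>Obstructing subgroups and the equivalence\<close>

lemma coset_eq_iff:
  fixes Y :: "'a::ab_group_add set"
  assumes "add_subgroup Y"
  shows "a +o Y = b +o Y \<longleftrightarrow> a - b \<in> Y"
proof
  assume "a +o Y = b +o Y"
  moreover have "a \<in> a +o Y" using assms by (simp add: add_subgroup_def flip: set_minus_plus)
  ultimately show "a - b \<in> Y" by (simp flip: set_minus_plus)
next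
  assume "a - b \<in> Y"
  from add_subgroup_coset_eq[OF assms this, of b] show "a +o Y = b +o Y" by simp
qed

lemma induced_maps_eq_iff:
  fixes Y :: "'a::ab_group_add set"
  assumes Y: "add_subgroup Y" and S: "Modules.additive S" "invariant_under S Y"
    and T: "Modules.additive T" "invariant_under T Y"
  shows "(\<forall>C\<in>cosets Y. induced_map S Y C = induced_map T Y C) \<longleftrightarrow> (\<forall>x. S x - T x \<in> Y)"
  by (simp add: cosets_def induced_map_coset[OF Y] S T coset_eq_iff[OF Y])

lemma funpow_diff_mem:
  fixes Y :: "'a::ab_group_add set"
  assumes Y: "add_subgroup Y" and S: "Modules.additive S" "invariant_under S Y"
    and diff: "\<And>x. S x - T x \<in> Y"
  shows "(S ^^ n) x - (T ^^ n) x \<in> Y"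
proof (induction n)
  case 0
  then show ?case using Y by (simp add: add_subgroup_def)
next
  case (Suc n)
  let ?p = "(S ^^ n) x" and ?q = "(T ^^ n) x"
  have "S (?p - ?q) \<in> Y" using Suc S(2) by (auto simp: invariant_under_def)
  then have "S ?p - S ?q \<in> Y" by (simp add: additive.diff[OF S(1)])
  then have "(S ?p - S ?q) + (S ?q - T ?q) \<in> Y" using Y diff unfolding add_subgroup_def by blast
  then show ?case by simp
qed

text \<open>The Hausdorff property of the quotient by \<open>Y\<close>, expressed in the group: the
  last clause says that \<open>U + Y\<close> and \<open>V + Y\<close> are disjoint, while
  \<open>U\<close> and \<open>V\<close> themselves need not be saturated.\<close>

lemma ex_separating_saturated_open:
  fixes Y :: "'a::topological_ab_group_add set"
  assumes Y: "add_subgroup Y" "closed Y" "Y \<noteq> UNIV"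
  obtains U V where "open U" "open V" "U \<noteq> {}" "V \<noteq> {}" "\<And>x y. x \<in> U \<Longrightarrow> y \<in> V \<Longrightarrow> x - y \<notin> Y"
proof -
  obtain x0 where x0: "x0 \<in> - Y" using Y(3) by blast
  obtain A B where AB: "open A" "open B" "0 \<in> A" "0 \<in> B" "\<And>a b. a \<in> A \<Longrightarrow> b \<in> B \<Longrightarrow> x0 + a - b \<in> - Y"
    using ex_open_add_diff[OF open_Compl[OF Y(2)] x0] by metis
  have "open ((\<lambda>x. x - x0) -` A)" by (rule open_vimage[OF AB(1)]) (intro continuous_intros)
  moreover have "x0 \<in> (\<lambda>x. x - x0) -` A" "0 \<in> B" using AB by auto
  moreover have "x - y \<notin> Y" if "x \<in> (\<lambda>x. x - x0) -` A" "y \<in> B" for x y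
    using AB(5)[of "x - x0" y] that by simp
  ultimately show ?thesis using AB(2) that[of "(\<lambda>x. x - x0) -` A" B] by blast
qed

context compact_haar_group
begin

lemma not_mixing_of_subgroup:
  assumes T1: "epimorphism T1" and T2: "epimorphism T2"
    and Y: "add_subgroup Y" "closed Y" "Y \<noteq> UNIV"
    and l: "l \<ge> 1" "invariant_under (T1 ^^ l) Y" "\<And>x. (T1 ^^ l) x - (T2 ^^ l) x \<in> Y"
  shows "\<not> mixing_pair (completion \<mu>) T1 T2"
proof
  assume mix: "mixing_pair (completion \<mu>) T1 T2"
  obtain U V where UV: "open U" "open V" "U \<noteq> {}" "V \<noteq> {}" "\<And>x y. x \<in> U \<Longrightarrow> y \<in> V \<Longrightarrow> x - y \<notin> Y"
    using ex_separating_saturated_open[OF Y] by metis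
  have add: "Modules.additive (T1 ^^ l)" using epimorphism_funpow[OF T1] by (simp add: epimorphism_def)
  have "(T1 ^^ (l * n)) -` U \<inter> (T2 ^^ (l * n)) -` V = {}" for n
  proof -
    have "(T1 ^^ (l * n)) x - (T2 ^^ (l * n)) x \<in> Y" for x
      using funpow_diff_mem[OF Y(1) add l(2,3), of n x] by (simp add: funpow_mult)
    then show ?thesis using UV(5) by fastforce
  qed
  then have zero: "measure (completion \<mu>) (((T1 ^^ (l * n)) -` U \<inter> space (completion \<mu>)) \<inter>
      ((T2 ^^ (l * n)) -` V \<inter> space (completion \<mu>))) = 0" for n
    by (simp add: space_eq)
  have sets: "U \<in> sets \<mu>" "V \<in> sets \<mu>" using UV(1,2) by (simp_all add: open_in_sets)
  let ?f = "\<lambda>n. measure (completion \<mu>) (((T1 ^^ n) -` U \<inter> space (completion \<mu>)) \<inter>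
      ((T2 ^^ n) -` V \<inter> space (completion \<mu>)))"
  have "?f \<longlonglongrightarrow> measure (completion \<mu>) U * measure (completion \<mu>) V"
    using mix sets unfolding mixing_pair_def by blast
  \<comment> \<open>Only times divisible by \<open>l\<close> are controlled by \<open>Y\<close>;
    along this subsequence the mixing limit must be zero, although both open sets have positive
    measure.\<close>
  then have "(?f \<circ> (\<lambda>n. l * n)) \<longlonglongrightarrow> measure (completion \<mu>) U * measure (completion \<mu>) V"
    by (rule LIMSEQ_subseq_LIMSEQ) (use l(1) in \<open>simp add: strict_mono_def\<close>)
  then have "(\<lambda>n::nat. 0) \<longlonglongrightarrow> measure (completion \<mu>) U * measure (completion \<mu>) V"
    by (simp only: o_def zero)
  then have "measure \<mu> U * measure \<mu> V = 0"
    using sets by (simp add: LIMSEQ_const_iff)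
  moreover have "measure \<mu> U > 0" "measure \<mu> V > 0"
    using UV(1-4) measure_open_pos by blast+
  ultimately show False by simp
qed

text \<open>A set of the completion lies between a Borel set and its union with a null set.
  Preimages of null sets are null, so the intersections are squeezed in the same way at every
  time.\<close>

lemma mixing_completion:
  assumes T1: "epimorphism T1" and T2: "epimorphism T2"
    and mix: "\<And>B1 B2. B1 \<in> sets \<mu> \<Longrightarrow> B2 \<in> sets \<mu> \<Longrightarrow>
      (\<lambda>n. measure \<mu> ((T1 ^^ n) -` B1 \<inter> (T2 ^^ n) -` B2)) \<longlonglongrightarrow> measure \<mu> B1 * measure \<mu> B2"
  shows "mixing_pair (completion \<mu>) T1 T2"
  unfolding mixing_pair_def
proof (intro ballI)
  fix B1 B2 assume "B1 \<in> sets (completion \<mu>)" "B2 \<in> sets (completion \<mu>)"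
  then obtain S1 N1 N1' S2 N2 N2' where
    B1: "B1 = S1 \<union> N1" "N1 \<subseteq> N1'" "N1' \<in> null_sets \<mu>" "S1 \<in> sets \<mu>" and
    B2: "B2 = S2 \<union> N2" "N2 \<subseteq> N2'" "N2' \<in> null_sets \<mu>" "S2 \<in> sets \<mu>"
    by (elim sets_completionE)
  have sandwich: "measure (completion \<mu>) A = measure \<mu> S"
    if "S \<in> sets \<mu>" "S \<subseteq> A" "A \<subseteq> S \<union> N" "N \<in> null_sets \<mu>" for A S N
  proof -
    have "A \<in> sets (completion \<mu>)"
      by (rule sets_completionI[of _ S "A - S" N]) (use that in auto)
    have SN: "S \<union> N \<in> sets \<mu>" using that by auto
    have "emeasure (completion \<mu>) A = emeasure \<mu> S"
    proof (rule antisym)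
      have "emeasure (completion \<mu>) A \<le> emeasure (completion \<mu>) (S \<union> N)"
        using that(3) SN by (intro emeasure_mono) auto
      also have "\<dots> = emeasure \<mu> (S \<union> N)" using SN by simp
      also have "\<dots> = emeasure \<mu> S" using that(1,4) by (rule emeasure_Un_null_set)
      finally show "emeasure (completion \<mu>) A \<le> emeasure \<mu> S" .
      have "emeasure \<mu> S = emeasure (completion \<mu>) S" using that(1) by simp
      also have "\<dots> \<le> emeasure (completion \<mu>) A"
        by (rule emeasure_mono[OF that(2) \<open>A \<in> sets (completion \<mu>)\<close>])
      finally show "emeasure \<mu> S \<le> emeasure (completion \<mu>) A" .
    qed
    then show ?thesis by (simp only: measure_def)
  qed
  have null: "(T ^^ n) -` N \<in> null_sets \<mu>" if "epimorphism T" "N \<in> null_sets \<mu>" for T N n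
    using measure_vimage_epimorphism[OF epimorphism_funpow[OF that(1)], of N n]
      measurable_sets[OF epimorphism_measurable[OF epimorphism_funpow[OF that(1)]], of N n] that(2)
    by (auto simp: null_sets_def space_eq)
  have meas: "(T ^^ n) -` S \<in> sets \<mu>" if "epimorphism T" "S \<in> sets \<mu>" for T S n
    using measurable_sets[OF epimorphism_measurable[OF epimorphism_funpow[OF that(1)]] that(2), of n]
    by (simp add: space_eq)
  have "measure (completion \<mu>) ((T1 ^^ n) -` B1 \<inter> (T2 ^^ n) -` B2) = measure \<mu> ((T1 ^^ n) -` S1 \<inter> (T2 ^^ n) -` S2)" for n
  proof (rule sandwich)
    show "(T1 ^^ n) -` S1 \<inter> (T2 ^^ n) -` S2 \<in> sets \<mu>"
      using meas[OF T1 B1(4)] meas[OF T2 B2(4)] by blast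
    show "(T1 ^^ n) -` N1' \<union> (T2 ^^ n) -` N2' \<in> null_sets \<mu>"
      using null[OF T1 B1(3)] null[OF T2 B2(3)] by blast
  qed (use B1(1,2) B2(1,2) in auto)
  moreover have "measure (completion \<mu>) B1 = measure \<mu> S1" "measure (completion \<mu>) B2 = measure \<mu> S2"
    by (rule sandwich[of _ _ N1'], use B1 in auto, rule sandwich[of _ _ N2'], use B2 in auto)
  ultimately show "(\<lambda>n. measure (completion \<mu>) (((T1 ^^ n) -` B1 \<inter> space (completion \<mu>)) \<inter>
      ((T2 ^^ n) -` B2 \<inter> space (completion \<mu>)))) \<longlonglongrightarrow> measure (completion \<mu>) B1 * measure (completion \<mu>) B2"
    using mix[OF B1(4) B2(4)] by (simp add: space_eq)
qed

lemma ex_subgroup_of_character: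
  assumes T1: "epimorphism T1" and T2: "epimorphism T2"
    and \<phi>: "character \<phi>" "\<phi> y \<noteq> 1"
    and eq: "\<And>m x. \<phi> ((T1 ^^ (l * m)) x) = \<phi> ((T2 ^^ (l * m)) x)"
  obtains Y where "add_subgroup Y" "closed Y" "Y \<noteq> UNIV" "invariant_under (T1 ^^ l) Y"
    "invariant_under (T2 ^^ l) Y" "\<And>x. (T1 ^^ l) x - (T2 ^^ l) x \<in> Y"
proof -
  let ?S1 = "T1 ^^ l" and ?S2 = "T2 ^^ l"
  \<comment> \<open>All iterates are imposed to make \<open>Y\<close> invariant under
    \<open>?S1\<close>. The assumption for every \<open>m\<close> lets \<open>?S2\<close> replace
    \<open>?S1\<close> in this condition, which gives invariance under \<open>?S2\<close> as
    well.\<close>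
  define Y where "Y = {x. \<forall>m. \<phi> ((?S1 ^^ m) x) = 1}"
  have ch: "character (\<lambda>x. \<phi> ((?S1 ^^ m) x))" for m
    by (rule character_comp_epimorphism[OF \<phi>(1) epimorphism_funpow[OF epimorphism_funpow[OF T1]]])
  have eq': "\<phi> ((?S1 ^^ m) x) = \<phi> ((?S2 ^^ m) x)" for m x
    using eq[of m x] by (simp add: funpow_mult)
  have "add_subgroup Y"
    unfolding add_subgroup_def Y_def
    by (simp add: character_0[OF ch] character_add[OF ch] character_minus[OF ch])
  moreover have "closed Y"
  proof -
    have "Y = (\<Inter>m. (\<lambda>x. \<phi> ((?S1 ^^ m) x)) -` {1})" by (auto simp: Y_def)
    then show ?thesis by (auto intro!: closed_vimage character_cts[OF ch])
  qed
  moreover have "Y \<noteq> UNIV"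
  proof -
    have "\<phi> ((?S1 ^^ 0) y) \<noteq> 1" using \<phi>(2) by simp
    then have "y \<notin> Y" unfolding Y_def by blast
    then show ?thesis by blast
  qed
  moreover have "invariant_under ?S1 Y"
  proof -
    have "?S1 x \<in> Y" if "x \<in> Y" for x
    proof -
      have "\<phi> ((?S1 ^^ Suc m) x) = 1" for m using that unfolding Y_def by blast
      then show ?thesis unfolding Y_def by (simp only: funpow_Suc_right o_apply) simp
    qed
    then show ?thesis by (auto simp: invariant_under_def)
  qed
  moreover have "invariant_under ?S2 Y"
  proof -
    have "?S2 x \<in> Y" if "x \<in> Y" for x
    proof -
      have "\<phi> ((?S2 ^^ Suc m) x) = 1" for m using that unfolding Y_def eq' by blast
      then show ?thesis unfolding Y_def eq' by (simp only: funpow_Suc_right o_apply) simp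
    qed
    then show ?thesis by (auto simp: invariant_under_def)
  qed
  \<comment> \<open>After \<open>?S1 ^^ m\<close>, the subtracted term can be read with
    \<open>?S2 ^^ m\<close> instead, so the quotient compares the iterates \<open>Suc m\<close> of
    the two maps, on which \<open>\<phi>\<close> agrees.\<close>
  moreover have "?S1 x - ?S2 x \<in> Y" for x
  proof -
    have "\<phi> ((?S1 ^^ m) (?S1 x - ?S2 x)) = 1" for m
    proof -
      have "\<phi> ((?S1 ^^ m) (?S1 x - ?S2 x)) = \<phi> ((?S1 ^^ Suc m) x) / \<phi> ((?S2 ^^ Suc m) x)"
        unfolding character_diff[OF ch] eq'[of m "?S2 x"] by (simp only: funpow_Suc_right o_apply)
      also have "\<dots> = 1" unfolding eq' using character_nonzero[OF \<phi>(1)] by simp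
      finally show ?thesis .
    qed
    then show ?thesis by (simp add: Y_def)
  qed
  ultimately show ?thesis using that by blast
qed

end

theorem corollary1p6:
  fixes T1 T2 :: "'a::{topological_ab_group_add, t2_space} \<Rightarrow> 'a"
    and \<mu> :: "'a measure"
  assumes "compact (UNIV :: 'a set)"
    and "connected (UNIV :: 'a set)"
    and "covering_dim (euclidean :: 'a topology) < \<infinity>"
    and "normalized_haar_measure \<mu>"
    and "epimorphism T1" and "epimorphism T2" and "T1 \<noteq> T2"
  shows "mixing_pair (completion \<mu>) T1 T2 \<longleftrightarrow>
    \<not> (\<exists>Y. add_subgroup Y \<and> closed Y \<and> Y \<noteq> UNIV \<and>
         (\<exists>l\<ge>1. invariant_under (T1 ^^ l) Y \<and> invariant_under (T2 ^^ l) Y \<and>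
            (\<forall>C\<in>cosets Y. induced_map (T1 ^^ l) Y C = induced_map (T2 ^^ l) Y C)))"
proof -
  have "\<exists>d. covering_dim_le (euclidean :: 'a topology) d"
    using assms(3) by (simp only: covering_dim_finite_iff)
  with assms interpret finite_dim_haar_group \<mu>
    by unfold_locales
  note T1 = \<open>epimorphism T1\<close> and T2 = \<open>epimorphism T2\<close>
  have additive: "Modules.additive (T1 ^^ l)" "Modules.additive (T2 ^^ l)" for l
    using epimorphism_funpow[OF T1, of l] epimorphism_funpow[OF T2, of l] by (auto simp: epimorphism_def)
  define obstruction where "obstruction Y l \<longleftrightarrow> add_subgroup Y \<and> closed Y \<and> Y \<noteq> UNIV \<and> l \<ge> 1 \<and>
    invariant_under (T1 ^^ l) Y \<and> invariant_under (T2 ^^ l) Y \<and> (\<forall>x. (T1 ^^ l) x - (T2 ^^ l) x \<in> Y)" for Y l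
  have "(\<exists>Y. add_subgroup Y \<and> closed Y \<and> Y \<noteq> UNIV \<and>
         (\<exists>l\<ge>1. invariant_under (T1 ^^ l) Y \<and> invariant_under (T2 ^^ l) Y \<and>
            (\<forall>C\<in>cosets Y. induced_map (T1 ^^ l) Y C = induced_map (T2 ^^ l) Y C)))
      \<longleftrightarrow> (\<exists>Y l. obstruction Y l)"
    unfolding obstruction_def using induced_maps_eq_iff[OF _ additive(1) _ additive(2)] by blast
  moreover have "mixing_pair (completion \<mu>) T1 T2 \<longleftrightarrow> \<not> (\<exists>Y l. obstruction Y l)"
  proof
    assume "mixing_pair (completion \<mu>) T1 T2"
    then show "\<not> (\<exists>Y l. obstruction Y l)"
      using not_mixing_of_subgroup[OF T1 T2] unfolding obstruction_def by blast
  next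
    assume no: "\<not> (\<exists>Y l. obstruction Y l)"
    have "finite {n. \<forall>x. \<phi>1 ((T1 ^^ n) x) = \<phi>2 ((T2 ^^ n) x)}"
      if \<phi>: "character \<phi>1" "character \<phi>2" "\<phi>1 z \<noteq> 1" for \<phi>1 \<phi>2 z
    proof (rule ccontr)
      assume inf: "\<not> finite {n. \<forall>x. \<phi>1 ((T1 ^^ n) x) = \<phi>2 ((T2 ^^ n) x)}"
      obtain l \<phi> y where l: "l \<ge> 1" and \<phi>: "character \<phi>" "\<phi> y \<noteq> 1"
        "\<And>m x. \<phi> ((T1 ^^ (l * m)) x) = \<phi> ((T2 ^^ (l * m)) x)"
        using ex_common_character[OF T1 T2 \<phi> inf] by metis
      obtain Y where "add_subgroup Y" "closed Y" "Y \<noteq> UNIV" "invariant_under (T1 ^^ l) Y"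
        "invariant_under (T2 ^^ l) Y" "\<And>x. (T1 ^^ l) x - (T2 ^^ l) x \<in> Y"
        using ex_subgroup_of_character[OF T1 T2 \<phi>] by metis
      with l no show False unfolding obstruction_def by blast
    qed
    then show "mixing_pair (completion \<mu>) T1 T2"
      by (intro mixing_completion[OF T1 T2] measure_mixing[OF T1 T2])
  qed
  ultimately show ?thesis by simp
qed

end
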